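(* Let $A$ be an elliptic operator on $X$ such that both $A$ and $A^*$ possess the Unique Continuation Property on $X$, let $D$ be a relatively compact domain in $X$ with $\partial D\in C^\infty$, let $s\in\mathbb Z$, $1<p<+\infty$, and assume that $X\setminus D$ has no compact components in $X$. Let $v^{(\cdot)}_\infty=\{v^{(j,r)}\}_{j\in\mathbb N,\,1\le r\le k}\subset(S_A^{s,p}(D))^*$ be a linearly independent system with $\|v^{(j,r)}\|_{(S_A^{s,p}(D))^*}\le1$ for all $(j,r)$ whose linear span is dense in $(S_A^{s,p}(D))^*$. Let $\mathcal M_\infty:S_A^{s,p}(D)\to\mathfrak M$, $(\mathcal M_\infty u)_{j,r}=\langle u,v^{(j,r)}\rangle$, and for $N\in\mathbb N$ let $\mathcal M_{kN}=\Pi_{kN}\mathcal M_\infty$. Let $\vec h^{(0)}\in\mathfrak M$, $1\le q\le+\infty$, and for $N\in\mathbb N$, $\vec g\in\mathbb R^{kN}$, let $$F_{kN}(\vec g)=\begin{cases}\frac1q\|\vec g-\Pi_{kN}\vec h^{(0)}\|^{q}_{\mathbb R^{kN}_q},&1\le q<+\infty,\\ \|\vec g-\Pi_{kN}\vec h^{(0)}\|_{\mathbb R^{kN}_\infty},&q=+\infty.\end{cases}$$ Let $b_N>0$ with $\lim_{N\to+\infty}b_N=0$, let $\mathcal F_{kN}(u)=F_{kN}(\mathcal M_{kN}u)+b_N\|u\|_{[W^{s,p}(D)]^k}$, and let $u^{(0)}_{kN}$ be a minimizer of $\mathcal F_{kN}$ over $S_A^{s,p}(D)$, $N\in\mathbb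 N$. Then the equation $$\mathcal M_\infty u=\vec h^{(0)}$$ is solvable in $S_A^{s,p}(D)$ if and only if there is a positive constant $C_0$ such that $$\mathcal F_{kN}(u^{(0)}_{kN})\le C_0\,b_N\quad\text{for all }N\in\mathbb N.$$ Besides, if this equation admits a solution $u^{(0)}_\infty\in S_A^{s,p}(D)$, then the sequence $\{u^{(0)}_{kN}\}_{N\in\mathbb N}$ converges weakly to it in $S_A^{s,p}(D)$.
   Context: $X\subset\mathbb R^n$, $n\ge2$, is open and connected; $k,m\in\mathbb N$; $A=\sum_{|\alpha|\le m}a_\alpha(x)\partial^\alpha$ with $(k\times k)$-matrices $a_\alpha$ of real $C^\infty(X)$-functions. $A$ is elliptic if $\sum_{|\alpha|=m}a_\alpha(x)(\iota\zeta)^\alpha$ is invertible on $\mathbb C^k$ for all $x\in X$, $\zeta\in\mathbb R^n\setminus\{0\}$. The formal adjoint is $A^*g=\sum_{|\alpha|\le m}(-1)^{|\alpha|}\partial^\alpha(a_\alpha^Tg)$. An operator has the Unique Continuation Property on $X$ if, for every domain $O\subset X$, every solution in $O$ of the homogeneous equation vanishing on a non-empty open subset of $O$ is identically zero in $O$. $S_A(D)$ is the space of ($\mathbb R^k$-valued) solutions of $Au=0$ in $D$. $W^{s,p}(D)$ is the usual Sobolev space for $s\ge0$ and, for $s\in\mathbb N$, $W^{-s,p}(D)$ is the dual of $W_0^{s,p'}(D)$, $1/p+1/p'=1$, with the dual norm; $\|u\|_{[W^{s,p}(D)]^k}=(\sum_{r=1}^k\|u_r\|^p_{W^{s,p}(D)})^{1/p}$.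 $S_A^{s,p}(D)=S_A(D)\cap[W^{s,p}(D)]^k$ with this norm. $\mathfrak M$ is the Banach space of bounded sequences $\vec h=(\vec h_1,\vec h_2,\dots)$, $\vec h_\nu=(h_{\nu,1},\dots,h_{\nu,k})\in\mathbb R^k$, with norm $\sup_\nu\max_{1\le r\le k}|h_{\nu,r}|$; $\Pi_{kN}\vec h=(\vec h_1,\dots,\vec h_N)\in\mathbb R^{kN}$. $\mathbb R^{kN}_q$ is $\mathbb R^{kN}$ with the $\ell^q$-norm (maximum norm for $q=+\infty$). *)

theory Defs
  imports "HOL-Analysis.Analysis" "HOL-Library.Function_Algebras"
begin

section \<open>Linear functionals on normed spaces of functions\<close>

text \<open>
  All spaces of the statement are sets \<open>V\<close> of functions with pointwise operations, together with
  a (semi)norm \<open>nrm\<close> that is meaningful on \<open>V\<close> only. Functionals on \<open>V\<close> are extended by zero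
  outside \<open>V\<close>, so that equality of functionals is equality of functions, and the dual space
  is again a set of functions.
\<close>

definition fscale :: "real \<Rightarrow> ('a \<Rightarrow> 'b::real_vector) \<Rightarrow> 'a \<Rightarrow> 'b" where
  "fscale c f = (\<lambda>x. c *\<^sub>R f x)"

interpretation fun_vs: vector_space fscale
  by unfold_locales (auto simp: fscale_def fun_eq_iff algebra_simps)

definition linear_functionals :: "('a \<Rightarrow> 'b::real_vector) set \<Rightarrow> (('a \<Rightarrow> 'b) \<Rightarrow> real) set" where
  "linear_functionals V = {l.
     (\<forall>u\<in>V. \<forall>w\<in>V. l (u + w) = l u + l w) \<and>
     (\<forall>c. \<forall>u\<in>V. l (fscale c u) = c * l u) \<and>
     (\<forall>u. u \<notin> V \<longrightarrow> l u = 0)}"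

definition dual :: "('a \<Rightarrow> 'b::real_vector) set \<Rightarrow> (('a \<Rightarrow> 'b) \<Rightarrow> real) \<Rightarrow> (('a \<Rightarrow> 'b) \<Rightarrow> real) set" where
  "dual V nrm = {l \<in> linear_functionals V. \<exists>C. \<forall>u\<in>V. \<bar>l u\<bar> \<le> C * nrm u}"

definition dual_norm :: "('a \<Rightarrow> 'b) set \<Rightarrow> (('a \<Rightarrow> 'b) \<Rightarrow> real) \<Rightarrow> (('a \<Rightarrow> 'b) \<Rightarrow> real) \<Rightarrow> real" where
  "dual_norm V nrm l = (SUP u\<in>{u \<in> V. nrm u \<le> 1}. \<bar>l u\<bar>)"

definition weakly_converges ::
    "('a \<Rightarrow> 'b::real_vector) set \<Rightarrow> (('a \<Rightarrow> 'b) \<Rightarrow> real) \<Rightarrow> (nat \<Rightarrow> 'a \<Rightarrow> 'b) \<Rightarrow> ('a \<Rightarrow> 'b) \<Rightarrow> bool" where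
  "weakly_converges V nrm w u \<longleftrightarrow> (\<forall>l\<in>dual V nrm. (\<lambda>N. l (w N)) \<longlonglongrightarrow> l u)"


section \<open>Partial derivatives, smooth functions, test functions\<close>

type_synonym 'n multi_index = "nat ^ 'n"

definition mi_order :: "'n::finite multi_index \<Rightarrow> nat" where
  "mi_order \<alpha> = (\<Sum>i\<in>UNIV. \<alpha> $ i)"

definition partial :: "'n::finite \<Rightarrow> (real ^ 'n \<Rightarrow> 'b::real_normed_vector) \<Rightarrow> real ^ 'n \<Rightarrow> 'b" where
  "partial i f = (\<lambda>x. frechet_derivative f (at x) (axis i 1))"

text \<open>
  The operator \<open>\<partial>\<^sup>\<alpha>\<close> differentiates \<open>\<alpha> $ i\<close> times in direction \<open>i\<close>. The order of
  differentiation is an arbitrary fixed one, which is irrelevant for the smooth functions to which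
  the operator is applied (Schwarz).
\<close>

definition pderiv_mi :: "'n::finite multi_index \<Rightarrow> (real ^ 'n \<Rightarrow> 'b::real_normed_vector) \<Rightarrow> real ^ 'n \<Rightarrow> 'b" where
  "pderiv_mi \<alpha> f = foldr partial (SOME is. \<forall>i. count_list is i = \<alpha> $ i) f"

text \<open>For open \<open>U\<close>: all iterated partial derivatives exist and are differentiable, that is,
  \<open>f\<close> is of class \<open>C\<^sup>\<infinity>\<close> on \<open>U\<close>.\<close>

definition smooth_on :: "(real ^ 'n::finite) set \<Rightarrow> (real ^ 'n \<Rightarrow> 'b::real_normed_vector) \<Rightarrow> bool" where
  "smooth_on U f \<longleftrightarrow> (\<forall>is. foldr partial is f differentiable_on U)"

definition test_functions :: "(real ^ 'n::finite) set \<Rightarrow> (real ^ 'n \<Rightarrow> 'b::real_normed_vector) set" where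
  "test_functions U = {\<phi>. smooth_on UNIV \<phi> \<and> (\<exists>K. compact K \<and> K \<subseteq> U \<and> (\<forall>x. x \<notin> K \<longrightarrow> \<phi> x = 0))}"


section \<open>Distributions\<close>

text \<open>
  An \<open>\<real>\<^sup>k\<close>-valued distribution is a functional on \<open>\<real>\<^sup>k\<close>-valued test functions; its
  components act on scalar test functions.
\<close>

definition distributions :: "(real ^ 'n::finite) set \<Rightarrow> ((real ^ 'n \<Rightarrow> 'b::real_normed_vector) \<Rightarrow> real) set" where
  "distributions U = {T \<in> linear_functionals (test_functions U).
     \<forall>K. compact K \<and> K \<subseteq> U \<longrightarrow>
       (\<exists>C N. \<forall>\<phi>\<in>test_functions U. (\<forall>x. x \<notin> K \<longrightarrow> \<phi> x = 0) \<longrightarrow>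
          \<bar>T \<phi>\<bar> \<le> C * (\<Sum>\<alpha> | mi_order \<alpha> \<le> N. SUP x. norm (pderiv_mi \<alpha> \<phi> x)))}"

definition dist_component ::
    "'k::finite \<Rightarrow> ((real ^ 'n::finite \<Rightarrow> real ^ 'k) \<Rightarrow> real) \<Rightarrow> (real ^ 'n \<Rightarrow> real) \<Rightarrow> real" where
  "dist_component r T = (\<lambda>\<phi>. T (\<lambda>x. axis r (\<phi> x)))"

definition dist_deriv ::
    "'n::finite multi_index \<Rightarrow> ((real ^ 'n \<Rightarrow> 'b::real_normed_vector) \<Rightarrow> real) \<Rightarrow> (real ^ 'n \<Rightarrow> 'b) \<Rightarrow> real" where
  "dist_deriv \<alpha> T = (\<lambda>\<phi>. (-1) ^ mi_order \<alpha> * T (pderiv_mi \<alpha> \<phi>))"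

definition dist_mult ::
    "(real ^ 'n::finite \<Rightarrow> real ^ 'k ^ 'k) \<Rightarrow> ((real ^ 'n \<Rightarrow> real ^ 'k::finite) \<Rightarrow> real) \<Rightarrow> (real ^ 'n \<Rightarrow> real ^ 'k) \<Rightarrow> real" where
  "dist_mult M T = (\<lambda>\<phi>. T (\<lambda>x. transpose (M x) *v \<phi> x))"

definition vanishes_on ::
    "((real ^ 'n::finite \<Rightarrow> 'b::real_normed_vector) \<Rightarrow> real) \<Rightarrow> (real ^ 'n) set \<Rightarrow> bool" where
  "vanishes_on T U \<longleftrightarrow> (\<forall>\<phi>\<in>test_functions U. T \<phi> = 0)"


section \<open>Differential operators\<close>

text \<open>
  An operator of order at most \<open>m\<close> is given by its coefficients \<open>a \<alpha>\<close>; only those with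
  \<open>mi_order \<alpha> \<le> m\<close> and only their values on \<open>X\<close> matter.
\<close>

type_synonym ('n, 'k) coeffs = "'n multi_index \<Rightarrow> real ^ 'n \<Rightarrow> real ^ 'k ^ 'k"

type_synonym ('n, 'k) vdist = "(real ^ 'n \<Rightarrow> real ^ 'k) \<Rightarrow> real"

definition diff_op :: "('n::finite, 'k::finite) coeffs \<Rightarrow> nat \<Rightarrow> ('n, 'k) vdist \<Rightarrow> ('n, 'k) vdist" where
  "diff_op a m T = (\<lambda>\<phi>. \<Sum>\<alpha> | mi_order \<alpha> \<le> m. dist_mult (a \<alpha>) (dist_deriv \<alpha> T) \<phi>)"

definition formal_adjoint :: "('n::finite, 'k::finite) coeffs \<Rightarrow> nat \<Rightarrow> ('n, 'k) vdist \<Rightarrow> ('n, 'k) vdist" where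
  "formal_adjoint a m T = (\<lambda>\<phi>. \<Sum>\<alpha> | mi_order \<alpha> \<le> m.
     (-1) ^ mi_order \<alpha> * dist_deriv \<alpha> (dist_mult (\<lambda>x. transpose (a \<alpha> x)) T) \<phi>)"

definition principal_symbol ::
    "('n::finite, 'k::finite) coeffs \<Rightarrow> nat \<Rightarrow> real ^ 'n \<Rightarrow> real ^ 'n \<Rightarrow> complex ^ 'k ^ 'k" where
  "principal_symbol a m x \<zeta> = (\<chi> i j. \<Sum>\<alpha> | mi_order \<alpha> = m.
     complex_of_real (a \<alpha> x $ i $ j) * (\<Prod>l\<in>UNIV. (\<i> * complex_of_real (\<zeta> $ l)) ^ (\<alpha> $ l)))"

definition elliptic_on :: "(real ^ 'n::finite) set \<Rightarrow> ('n, 'k::finite) coeffs \<Rightarrow> nat \<Rightarrow> bool" where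
  "elliptic_on X a m \<longleftrightarrow> (\<forall>x\<in>X. \<forall>\<zeta>. \<zeta> \<noteq> 0 \<longrightarrow> invertible (principal_symbol a m x \<zeta>))"

definition domain :: "(real ^ 'n::finite) set \<Rightarrow> bool" where
  "domain U \<longleftrightarrow> open U \<and> connected U \<and> U \<noteq> {}"

text \<open>
  Solutions are distributional solutions. For an elliptic operator with smooth coefficients these
  are exactly the \<open>C\<^sup>\<infinity>\<close> functions \<open>u\<close> on \<open>U\<close> with \<open>L u = 0\<close>, identified with the
  distributions they define.
\<close>

definition solutions ::
    "(('n::finite, 'k::finite) vdist \<Rightarrow> ('n, 'k) vdist) \<Rightarrow> (real ^ 'n) set \<Rightarrow> ('n, 'k) vdist set" where
  "solutions L U = {u \<in> distributions U. vanishes_on (L u) U}"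

definition unique_continuation ::
    "(real ^ 'n::finite) set \<Rightarrow> (('n, 'k::finite) vdist \<Rightarrow> ('n, 'k) vdist) \<Rightarrow> bool" where
  "unique_continuation X L \<longleftrightarrow>
     (\<forall>U G. domain U \<and> U \<subseteq> X \<and> open G \<and> G \<noteq> {} \<and> G \<subseteq> U \<longrightarrow>
        (\<forall>u\<in>solutions L U. vanishes_on u G \<longrightarrow> vanishes_on u U))"

definition smooth_boundary :: "(real ^ 'n::finite) set \<Rightarrow> bool" where
  "smooth_boundary D \<longleftrightarrow> (\<forall>x\<in>frontier D. \<exists>U (\<rho> :: real ^ 'n \<Rightarrow> real).
     open U \<and> x \<in> U \<and> smooth_on U \<rho> \<and> (\<forall>y\<in>U. \<exists>i. partial i \<rho> y \<noteq> 0) \<and>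
     D \<inter> U = {y \<in> U. \<rho> y < 0} \<and> frontier D \<inter> U = {y \<in> U. \<rho> y = 0})"


section \<open>Sobolev spaces\<close>

definition Lp_fun :: "real \<Rightarrow> (real ^ 'n::finite) set \<Rightarrow> (real ^ 'n \<Rightarrow> real) set" where
  "Lp_fun p D = {f \<in> borel_measurable (lebesgue_on D). integrable (lebesgue_on D) (\<lambda>x. \<bar>f x\<bar> powr p)}"

definition locally_integrable :: "(real ^ 'n::finite) set \<Rightarrow> (real ^ 'n \<Rightarrow> real) \<Rightarrow> bool" where
  "locally_integrable D f \<longleftrightarrow> (\<forall>K. compact K \<and> K \<subseteq> D \<longrightarrow> integrable (lebesgue_on K) f)"

definition is_weak_deriv ::
    "(real ^ 'n::finite) set \<Rightarrow> 'n multi_index \<Rightarrow> (real ^ 'n \<Rightarrow> real) \<Rightarrow> (real ^ 'n \<Rightarrow> real) \<Rightarrow> bool" where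
  "is_weak_deriv D \<alpha> f g \<longleftrightarrow> locally_integrable D f \<and> locally_integrable D g \<and>
     (\<forall>\<phi>\<in>test_functions D.
        (LINT x|lebesgue_on D. f x * pderiv_mi \<alpha> \<phi> x) =
        (-1) ^ mi_order \<alpha> * (LINT x|lebesgue_on D. g x * \<phi> x))"

text \<open>
  \<open>W\<^sup>s\<^sup>,\<^sup>p(D)\<close> for integers \<open>s \<ge> 0\<close>, as a space of functions (representatives, not classes
  modulo null sets). Weak derivatives are unique almost everywhere, so the choice below
  does not influence the norm.
\<close>

definition sobolev_fun :: "nat \<Rightarrow> real \<Rightarrow> (real ^ 'n::finite) set \<Rightarrow> (real ^ 'n \<Rightarrow> real) set" where
  "sobolev_fun s p D = {f \<in> Lp_fun p D. \<forall>\<alpha>. mi_order \<alpha> \<le> s \<longrightarrow> (\<exists>g\<in>Lp_fun p D. is_weak_deriv D \<alpha> f g)}"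

definition weak_deriv ::
    "(real ^ 'n::finite) set \<Rightarrow> 'n multi_index \<Rightarrow> (real ^ 'n \<Rightarrow> real) \<Rightarrow> real ^ 'n \<Rightarrow> real" where
  "weak_deriv D \<alpha> f = (SOME g. is_weak_deriv D \<alpha> f g)"

definition sobolev_fun_norm :: "nat \<Rightarrow> real \<Rightarrow> (real ^ 'n::finite) set \<Rightarrow> (real ^ 'n \<Rightarrow> real) \<Rightarrow> real" where
  "sobolev_fun_norm s p D f =
     (\<Sum>\<alpha> | mi_order \<alpha> \<le> s. LINT x|lebesgue_on D. \<bar>weak_deriv D \<alpha> f x\<bar> powr p) powr (1 / p)"

text \<open>\<open>W\<^sub>0\<^sup>s\<^sup>,\<^sup>p(D)\<close>: the closure of the test functions.\<close>

definition sobolev_fun0 :: "nat \<Rightarrow> real \<Rightarrow> (real ^ 'n::finite) set \<Rightarrow> (real ^ 'n \<Rightarrow> real) set" where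
  "sobolev_fun0 s p D =
     {f \<in> sobolev_fun s p D. \<forall>\<epsilon>>0. \<exists>\<phi>\<in>test_functions D. sobolev_fun_norm s p D (f - \<phi>) < \<epsilon>}"

definition conj_exponent :: "real \<Rightarrow> real" where
  "conj_exponent p = p / (p - 1)"

definition dist_of_fun ::
    "(real ^ 'n::finite) set \<Rightarrow> (real ^ 'n \<Rightarrow> real) \<Rightarrow> (real ^ 'n \<Rightarrow> real) \<Rightarrow> real" where
  "dist_of_fun D f = (\<lambda>\<phi>. if \<phi> \<in> test_functions D then LINT x|lebesgue_on D. f x * \<phi> x else 0)"

definition dist_of_functional ::
    "(real ^ 'n::finite) set \<Rightarrow> ((real ^ 'n \<Rightarrow> real) \<Rightarrow> real) \<Rightarrow> (real ^ 'n \<Rightarrow> real) \<Rightarrow> real" where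
  "dist_of_functional D l = (\<lambda>\<phi>. if \<phi> \<in> test_functions D then l \<phi> else 0)"

abbreviation sobolev_neg :: "nat \<Rightarrow> real \<Rightarrow> (real ^ 'n::finite) set \<Rightarrow> ((real ^ 'n \<Rightarrow> real) \<Rightarrow> real) set" where
  "sobolev_neg s p D \<equiv>
     dual (sobolev_fun0 s (conj_exponent p) D) (sobolev_fun_norm s (conj_exponent p) D)"

abbreviation sobolev_neg_norm :: "nat \<Rightarrow> real \<Rightarrow> (real ^ 'n::finite) set \<Rightarrow> ((real ^ 'n \<Rightarrow> real) \<Rightarrow> real) \<Rightarrow> real" where
  "sobolev_neg_norm s p D \<equiv>
     dual_norm (sobolev_fun0 s (conj_exponent p) D) (sobolev_fun_norm s (conj_exponent p) D)"

text \<open>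
  \<open>W\<^sup>s\<^sup>,\<^sup>p(D)\<close> for every integer \<open>s\<close>, embedded in the distributions on \<open>D\<close>. A function is
  determined almost everywhere by its distribution, and for negative \<open>s\<close> a functional on
  \<open>W\<^sub>0\<close> is determined by its restriction to the dense subspace of test functions; so the
  norm does not depend on the choices below.
\<close>

definition sobolev :: "int \<Rightarrow> real \<Rightarrow> (real ^ 'n::finite) set \<Rightarrow> ((real ^ 'n \<Rightarrow> real) \<Rightarrow> real) set" where
  "sobolev s p D =
     (if 0 \<le> s then dist_of_fun D ` sobolev_fun (nat s) p D
      else dist_of_functional D ` sobolev_neg (nat (- s)) p D)"

definition sobolev_norm :: "int \<Rightarrow> real \<Rightarrow> (real ^ 'n::finite) set \<Rightarrow> ((real ^ 'n \<Rightarrow> real) \<Rightarrow> real) \<Rightarrow> real" where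
  "sobolev_norm s p D T =
     (if 0 \<le> s then sobolev_fun_norm (nat s) p D (SOME f. f \<in> sobolev_fun (nat s) p D \<and> dist_of_fun D f = T)
      else sobolev_neg_norm (nat (- s)) p D
             (SOME l. l \<in> sobolev_neg (nat (- s)) p D \<and> dist_of_functional D l = T))"

definition sobolev_vec_norm :: "int \<Rightarrow> real \<Rightarrow> (real ^ 'n::finite) set \<Rightarrow> ('n, 'k::finite) vdist \<Rightarrow> real" where
  "sobolev_vec_norm s p D u = (\<Sum>r\<in>UNIV. sobolev_norm s p D (dist_component r u) powr p) powr (1 / p)"

definition sobolev_solutions ::
    "('n::finite, 'k::finite) coeffs \<Rightarrow> nat \<Rightarrow> int \<Rightarrow> real \<Rightarrow> (real ^ 'n) set \<Rightarrow> ('n, 'k) vdist set" where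
  "sobolev_solutions a m s p D =
     {u \<in> solutions (diff_op a m) D. \<forall>r. dist_component r u \<in> sobolev s p D}"


section \<open>Measurements and regularising functionals\<close>

text \<open>
  Sequences are indexed from \<open>0\<close>: \<open>h \<nu> $ r\<close> is the component with index \<open>(\<nu> + 1, r)\<close> of the
  usual notation. Elements of \<open>\<real>\<^sup>k\<^sup>N\<close> are sequences that vanish from index \<open>N\<close> on, and
  \<open>bounded_sequences\<close> carries the norm \<open>sup \<bar>h \<nu> $ r\<bar>\<close>.
\<close>

definition bounded_sequences :: "(nat \<Rightarrow> real ^ 'k::finite) set" where
  "bounded_sequences = {h. \<exists>C. \<forall>\<nu> r. \<bar>h \<nu> $ r\<bar> \<le> C}"

definition truncation :: "nat \<Rightarrow> (nat \<Rightarrow> real ^ 'k::finite) \<Rightarrow> nat \<Rightarrow> real ^ 'k" where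
  "truncation N h = (\<lambda>\<nu>. if \<nu> < N then h \<nu> else 0)"

definition lq_norm :: "ereal \<Rightarrow> nat \<Rightarrow> (nat \<Rightarrow> real ^ 'k::finite) \<Rightarrow> real" where
  "lq_norm q N g =
     (if q = \<infinity> then Max {\<bar>g \<nu> $ r\<bar> | \<nu> r. \<nu> < N}
      else (\<Sum>\<nu><N. \<Sum>r\<in>UNIV. \<bar>g \<nu> $ r\<bar> powr real_of_ereal q) powr (1 / real_of_ereal q))"

definition misfit :: "ereal \<Rightarrow> nat \<Rightarrow> (nat \<Rightarrow> real ^ 'k::finite) \<Rightarrow> (nat \<Rightarrow> real ^ 'k) \<Rightarrow> real" where
  "misfit q N h g =
     (if q = \<infinity> then lq_norm q N (g - truncation N h)
      else 1 / real_of_ereal q * lq_norm q N (g - truncation N h) powr real_of_ereal q)"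

definition measurement ::
    "(nat \<Rightarrow> 'k::finite \<Rightarrow> ('n::finite, 'k) vdist \<Rightarrow> real) \<Rightarrow> ('n, 'k) vdist \<Rightarrow> nat \<Rightarrow> real ^ 'k" where
  "measurement v u = (\<lambda>j. \<chi> r. v j r u)"

definition regularised_misfit ::
    "int \<Rightarrow> real \<Rightarrow> (real ^ 'n::finite) set \<Rightarrow> (nat \<Rightarrow> 'k::finite \<Rightarrow> ('n, 'k) vdist \<Rightarrow> real) \<Rightarrow> ereal \<Rightarrow>
     (nat \<Rightarrow> real ^ 'k) \<Rightarrow> (nat \<Rightarrow> real) \<Rightarrow> nat \<Rightarrow> ('n, 'k) vdist \<Rightarrow> real" where
  "regularised_misfit s p D v q h b N u =
     misfit q N h (truncation N (measurement v u)) + b N * sobolev_vec_norm s p D u"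

end

theory Submission
  imports Defs
begin

text \<open>
  Let \<open>V\<close> be the space of solutions with norm \<open>\<parallel>u\<parallel>\<close>, and let \<open>u\<^sub>N\<close> be the minimisers of the regularised
  misfits \<open>F\<^sub>N\<close>.

  If \<open>u\<close> solves the equation, its misfit vanishes, so \<open>F\<^sub>N(u\<^sub>N) \<le> F\<^sub>N(u) = b\<^sub>N \<parallel>u\<parallel>\<close>. This is the estimate in
  question. It also says that \<open>\<parallel>u\<^sub>N\<parallel> \<le> \<parallel>u\<parallel>\<close> and that the misfits of the \<open>u\<^sub>N\<close> tend to zero, so that every
  measurement of \<open>u\<^sub>N\<close> tends to that of \<open>u\<close>. As the measurement functionals span a dense subspace of the
  dual, the bounded sequence \<open>u\<^sub>N\<close> converges weakly to \<open>u\<close> (\<open>weakly_convergesI\<close>).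

  Conversely, \<open>F\<^sub>N(u\<^sub>N) \<le> C\<^sub>0 b\<^sub>N\<close> bounds \<open>\<parallel>u\<^sub>N\<parallel>\<close> by \<open>C\<^sub>0\<close> and makes the measurements of \<open>u\<^sub>N\<close> converge to the data.
  One would now extract a weakly convergent subsequence, \<open>V\<close> being reflexive. The proof below uses
  what lies behind reflexivity, uniform convexity: decreasing nonempty bounded convex sets in a
  complete uniformly convex space contain points that converge in norm
  (\<open>nested_convex_sets_have_limit\<close>). For the sets of all \<open>u\<close> with \<open>\<parallel>u\<parallel> \<le> C\<^sub>0\<close> whose first \<open>n\<close> measurements
  deviate from the data by at most \<open>1 / (n + 1)\<close> the limit is a solution
  (\<open>solvable_of_approximate_solutions\<close>).

  It remains to see that \<open>V\<close> is complete and uniformly convex. For \<open>s \<ge> 0\<close> the norm of \<open>W\<^sup>s\<^sup>,\<^sup>p\<close> is an \<open>L\<^sup>p\<close>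
  norm of weak derivatives; it is uniformly convex because the function \<open>\<bar>x\<bar> powr p\<close> is, and
  completeness is that of \<open>L\<^sup>p\<close>. For \<open>s < 0\<close> the norm is dual to that of \<open>W\<^sub>0\<close> of order \<open>-s\<close> with the conjugate
  exponent, which is uniformly smooth by a similar estimate for numbers; duals are complete, and duals
  of uniformly smooth spaces are uniformly convex (\<open>uniformly_convexifiable_dual\<close>). Both properties pass
  to vectors of distributions, and to solutions of the equation, because convergence in norm implies
  convergence on test functions (\<open>sobolev_eval_bound\<close>).

  That the norms are seminorms at all, and do not depend on choices of representatives, rests on the
  uniqueness of weak derivatives, that is on the fundamental lemma of the calculus of variations
  (\<open>AE_eq_0_of_test_functions\<close>), and on integration by parts for test functions
  (\<open>integral_by_parts_pderiv_mi\<close>), by which they belong to the Sobolev spaces.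
\<close>

section \<open>Uniform convexity in spaces of functions\<close>

definition midpoint_of :: "('a \<Rightarrow> real) \<Rightarrow> ('a \<Rightarrow> real) \<Rightarrow> 'a \<Rightarrow> real" where
  "midpoint_of u w = fscale (1 / 2) (u + w)"

lemma fscale_apply: "fscale c f x = c *\<^sub>R f x"
  by (simp add: fscale_def)

text \<open>
  The spaces in question are sets of functions with a seminorm that means something on the set
  only. The seminorm of a function may vanish although the function does not, for instance when
  functions represent classes modulo null sets.
\<close>

locale seminormed =
  fixes V :: "('a \<Rightarrow> real) set" and N :: "('a \<Rightarrow> real) \<Rightarrow> real"
  assumes zero_mem: "0 \<in> V"
    and add_mem: "u \<in> V \<Longrightarrow> w \<in> V \<Longrightarrow> u + w \<in> V"
    and scale_mem: "u \<in> V \<Longrightarrow> fscale c u \<in> V"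
    and N_scale: "u \<in> V \<Longrightarrow> N (fscale c u) = \<bar>c\<bar> * N u"
    and N_triangle: "u \<in> V \<Longrightarrow> w \<in> V \<Longrightarrow> N (u + w) \<le> N u + N w"
begin

lemma uminus_mem: "u \<in> V \<Longrightarrow> - u \<in> V"
  using scale_mem[of u "-1"] by simp

lemma N_uminus: "u \<in> V \<Longrightarrow> N (- u) = N u"
  using N_scale[of u "-1"] by simp

lemma diff_mem: "u \<in> V \<Longrightarrow> w \<in> V \<Longrightarrow> u - w \<in> V"
  using add_mem[OF _ uminus_mem, of u w] by simp

lemma N_zero: "N 0 = 0"
proof -
  have "fscale 0 0 = (0 :: 'a \<Rightarrow> real)" by (auto simp: fscale_def)
  with N_scale[OF zero_mem, of 0] show ?thesis by simp
qed

lemma N_diff_le: "u \<in> V \<Longrightarrow> w \<in> V \<Longrightarrow> N (u - w) \<le> N u + N w"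
  using N_triangle[OF _ uminus_mem, of u w] N_uminus[of w] by simp

lemma N_nonneg: "u \<in> V \<Longrightarrow> 0 \<le> N u"
  using N_diff_le[of u u] N_zero by simp

lemma N_commute: "u \<in> V \<Longrightarrow> w \<in> V \<Longrightarrow> N (u - w) = N (w - u)"
  using N_uminus[OF diff_mem, of w u] by simp

lemma midpoint_mem: "u \<in> V \<Longrightarrow> w \<in> V \<Longrightarrow> midpoint_of u w \<in> V"
  unfolding midpoint_of_def by (intro add_mem scale_mem)

lemma N_midpoint_le: "u \<in> V \<Longrightarrow> w \<in> V \<Longrightarrow> N (midpoint_of u w) \<le> (N u + N w) / 2"
  unfolding midpoint_of_def using N_scale[OF add_mem, of u w "1/2"] N_triangle[of u w] by auto

end

definition complete_under :: "('a \<Rightarrow> real) set \<Rightarrow> (('a \<Rightarrow> real) \<Rightarrow> real) \<Rightarrow> bool" where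
  "complete_under V N \<longleftrightarrow> (\<forall>w. (\<forall>n. w n \<in> V) \<and> (\<forall>e>0. \<exists>M. \<forall>m\<ge>M. \<forall>n\<ge>M. N (w m - w n) < e) \<longrightarrow>
     (\<exists>u\<in>V. (\<lambda>n::nat. N (w n - u)) \<longlonglongrightarrow> 0))"

text \<open>
  Convexity of \<open>\<Phi>\<close> that is uniform on bounded sets, measured in the norm \<open>N\<close>. For a uniformly convex
  norm any power \<open>N ^ q\<close> with \<open>q > 1\<close> serves as \<open>\<Phi>\<close>; gauges other than functions of the norm are
  allowed because then the gauges of the components of a vector valued space may simply be added.
\<close>

definition convexity_gauge :: "('a \<Rightarrow> real) set \<Rightarrow> (('a \<Rightarrow> real) \<Rightarrow> real) \<Rightarrow> (('a \<Rightarrow> real) \<Rightarrow> real) \<Rightarrow> bool" where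
  "convexity_gauge V N \<Phi> \<longleftrightarrow>
     (\<forall>u\<in>V. 0 \<le> \<Phi> u) \<and>
     (\<forall>R. \<exists>M. \<forall>u\<in>V. N u \<le> R \<longrightarrow> \<Phi> u \<le> M) \<and>
     (\<forall>u\<in>V. \<forall>w\<in>V. \<Phi> (midpoint_of u w) \<le> (\<Phi> u + \<Phi> w) / 2) \<and>
     (\<forall>R. \<forall>e>0. \<exists>d>0. \<forall>u\<in>V. \<forall>w\<in>V. N u \<le> R \<and> N w \<le> R \<and>
        (\<Phi> u + \<Phi> w) / 2 - \<Phi> (midpoint_of u w) < d \<longrightarrow> N (u - w) < e)"

text \<open>
  Here the gauge has to be a function of the norm, so that the property passes to images under
  norm preserving linear maps, injective or not.
\<close>

definition uniformly_convexifiable :: "('a \<Rightarrow> real) set \<Rightarrow> (('a \<Rightarrow> real) \<Rightarrow> real) \<Rightarrow> bool" where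
  "uniformly_convexifiable V N \<longleftrightarrow> (\<exists>F. convexity_gauge V N (\<lambda>u. F (N u)))"

lemma complete_underD:
  assumes "complete_under V N" "\<And>n. w n \<in> V" "\<And>e. e > 0 \<Longrightarrow> \<exists>M. \<forall>m\<ge>M. \<forall>n\<ge>M. N (w m - w n) < e"
  shows "\<exists>u\<in>V. (\<lambda>n::nat. N (w n - u)) \<longlonglongrightarrow> 0"
  using assms unfolding complete_under_def by simp

lemma convexity_gaugeD:
  assumes "convexity_gauge V N \<Phi>" "e > 0"
  shows "\<exists>d>0. \<forall>u\<in>V. \<forall>w\<in>V. N u \<le> R \<and> N w \<le> R \<and>
        (\<Phi> u + \<Phi> w) / 2 - \<Phi> (midpoint_of u w) < d \<longrightarrow> N (u - w) < e"
  using assms unfolding convexity_gauge_def by simp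

text \<open>
  This is the substitute for weak compactness. The infima \<open>d n\<close> of the gauge over \<open>C n\<close> increase and
  stay bounded, so they converge. If the points \<open>w n\<close> of \<open>C n\<close> nearly attain them and \<open>m \<le> n\<close>, then the
  midpoint of \<open>w m\<close> and \<open>w n\<close> lies in \<open>C m\<close> and has gauge at least \<open>d m\<close>. Hence the convexity gap
  between \<open>w m\<close> and \<open>w n\<close> is small, and \<open>w\<close> is a Cauchy sequence.
\<close>

lemma (in seminormed) nested_convex_sets_have_limit:
  assumes compl: "complete_under V N" and \<Phi>: "convexity_gauge V N \<Phi>"
    and ne: "\<And>n. C n \<noteq> {}" and sub: "\<And>n. C n \<subseteq> V" and dec: "\<And>n. C (Suc n) \<subseteq> C n"
    and mid: "\<And>n u w. u \<in> C n \<Longrightarrow> w \<in> C n \<Longrightarrow> midpoint_of u w \<in> C n"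
    and bnd: "\<And>u. u \<in> C 0 \<Longrightarrow> N u \<le> R"
  obtains w u where "\<And>n. w n \<in> C n" "u \<in> V" "(\<lambda>n. N (w n - u)) \<longlonglongrightarrow> 0"
proof -
  have pos: "0 \<le> \<Phi> u" if "u \<in> V" for u using \<Phi> that unfolding convexity_gauge_def by blast
  obtain M where M: "\<Phi> u \<le> M" if "u \<in> V" "N u \<le> R" for u using \<Phi> unfolding convexity_gauge_def by meson
  have dec': "C n \<subseteq> C k" if "k \<le> n" for k n
    using that by (rule lift_Suc_antimono_le[of C, OF dec])
  have bdd: "bdd_below (\<Phi> ` C n)" for n
    by (rule bdd_belowI2[where m=0]) (use pos sub in blast)
  define d where "d n = Inf (\<Phi> ` C n)" for n
  have d_le: "d n \<le> \<Phi> u" if "u \<in> C n" for n u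
    unfolding d_def by (rule cInf_lower) (use that bdd in auto)
  have d_mono: "d k \<le> d n" if "k \<le> n" for k n
    unfolding d_def by (rule cInf_superset_mono) (use ne bdd dec'[OF that] in auto)
  have d_bdd: "d n \<le> M" for n
  proof -
    obtain u where u: "u \<in> C n" using ne by blast
    then have "u \<in> C 0" using dec'[of 0 n] by auto
    then have "\<Phi> u \<le> M" using M bnd sub by blast
    then show ?thesis using d_le[OF u] by simp
  qed
  have "\<exists>w\<in>C n. \<Phi> w < d n + 1 / real (Suc n)" for n
  proof -
    have "\<exists>y\<in>\<Phi> ` C n. y < d n + 1 / real (Suc n)"
      by (rule cInf_lessD) (use ne in \<open>auto simp: d_def\<close>)
    then show ?thesis by blast
  qed
  then obtain w where w: "\<And>n. w n \<in> C n" "\<And>n. \<Phi> (w n) < d n + 1 / real (Suc n)" by metis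
  have wV: "w n \<in> V" for n using w sub by blast
  have wR: "N (w n) \<le> R" for n using bnd w dec'[of 0 n] by auto
  have "Bseq d" by (rule BseqI'[where K="\<bar>d 0\<bar> + \<bar>M\<bar>"]) (use d_mono[of 0] d_bdd in \<open>smt (verit) real_norm_def le0\<close>)
  then have conv: "convergent d" using d_mono by (intro Bseq_monoseq_convergent) (auto simp: monoseq_def)
  have cau: "\<exists>M. \<forall>m\<ge>M. \<forall>n\<ge>M. N (w m - w n) < e" if e: "e > 0" for e
  proof -
    obtain \<delta> where \<delta>: "\<delta> > 0" and D: "\<And>u w. u \<in> V \<Longrightarrow> w \<in> V \<Longrightarrow> N u \<le> R \<Longrightarrow> N w \<le> R \<Longrightarrow>
        (\<Phi> u + \<Phi> w) / 2 - \<Phi> (midpoint_of u w) < \<delta> \<Longrightarrow> N (u - w) < e"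
      using convexity_gaugeD[OF \<Phi> e] by blast
    have "Cauchy d" using conv by (simp add: Cauchy_convergent_iff)
    then obtain M1 where M1: "\<And>m n. m \<ge> M1 \<Longrightarrow> n \<ge> M1 \<Longrightarrow> \<bar>d m - d n\<bar> < \<delta> / 3"
      unfolding Cauchy_iff using \<delta> by (metis real_norm_def divide_pos_pos zero_less_numeral)
    obtain M2 where M2: "1 / real (Suc M2) < \<delta> / 3" using \<delta> nat_approx_posE[of "\<delta>/3"] by auto
    have M2': "1 / real (Suc n) < \<delta> / 3" if "n \<ge> M2" for n
    proof -
      have "1 / real (Suc n) \<le> 1 / real (Suc M2)" using that by (simp add: field_simps)
      then show ?thesis using M2 by linarith
    qed
    have key: "N (w m - w n) < e" if "m \<ge> max M1 M2" "n \<ge> max M1 M2" "m \<le> n" for m n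
    proof (rule D)
      have "w n \<in> C m" using w dec'[OF that(3)] by auto
      then have "d m \<le> \<Phi> (midpoint_of (w m) (w n))" using mid d_le w by blast
      moreover have "\<bar>d m - d n\<bar> < \<delta> / 3" using M1 that by auto
      moreover have "1 / real (Suc m) < \<delta> / 3" "1 / real (Suc n) < \<delta> / 3" using M2' that by auto
      ultimately show "(\<Phi> (w m) + \<Phi> (w n)) / 2 - \<Phi> (midpoint_of (w m) (w n)) < \<delta>"
        using w(2)[of m] w(2)[of n] by argo
    qed (use wV wR in auto)
    have "N (w m - w n) < e" if "m \<ge> max M1 M2" "n \<ge> max M1 M2" for m n
      using key[of m n] key[of n m] that N_commute[OF wV wV, of m n] by (cases "m \<le> n") auto
    then show ?thesis by blast
  qed
  obtain u where "u \<in> V" "(\<lambda>n. N (w n - u)) \<longlonglongrightarrow> 0" using complete_underD[OF compl wV cau] by blast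
  with w(1) that show ?thesis by blast
qed


section \<open>Dual spaces\<close>

context seminormed begin

lemma dual_add: "l \<in> dual V N \<Longrightarrow> u \<in> V \<Longrightarrow> w \<in> V \<Longrightarrow> l (u + w) = l u + l w"
  and dual_scale: "l \<in> dual V N \<Longrightarrow> u \<in> V \<Longrightarrow> l (fscale c u) = c * l u"
  and dual_outside: "l \<in> dual V N \<Longrightarrow> u \<notin> V \<Longrightarrow> l u = 0"
  unfolding dual_def linear_functionals_def by auto

lemma dual_uminus: "l \<in> dual V N \<Longrightarrow> u \<in> V \<Longrightarrow> l (- u) = - l u"
  using dual_scale[of l u "-1"] by simp

lemma dual_diff: "l \<in> dual V N \<Longrightarrow> u \<in> V \<Longrightarrow> w \<in> V \<Longrightarrow> l (u - w) = l u - l w"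
  using dual_add[OF _ _ uminus_mem, of l u w] by (simp add: dual_uminus)

lemma dual_bdd_above: assumes "l \<in> dual V N" shows "bdd_above ((\<lambda>u. \<bar>l u\<bar>) ` {u \<in> V. N u \<le> 1})"
proof -
  obtain C where C: "\<forall>u\<in>V. \<bar>l u\<bar> \<le> C * N u" using assms unfolding dual_def by blast
  show ?thesis
  proof (rule bdd_aboveI2[where M="\<bar>C\<bar>"])
    fix u assume u: "u \<in> {u \<in> V. N u \<le> 1}"
    then have "\<bar>l u\<bar> \<le> \<bar>C\<bar> * N u" using C N_nonneg by (smt (verit) mem_Collect_eq mult_right_mono)
    also have "\<dots> \<le> \<bar>C\<bar> * 1" using u by (intro mult_left_mono) auto
    finally show "\<bar>l u\<bar> \<le> \<bar>C\<bar>" by simp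
  qed
qed

lemma dual_norm_upper: assumes "l \<in> dual V N" "u \<in> V" "N u \<le> 1" shows "\<bar>l u\<bar> \<le> dual_norm V N l"
  unfolding dual_norm_def by (rule cSUP_upper) (use assms dual_bdd_above in auto)

lemma dual_norm_nonneg: assumes "l \<in> dual V N" shows "0 \<le> dual_norm V N l"
  using dual_norm_upper[OF assms zero_mem] N_zero by simp

lemma dual_norm_le: assumes "\<And>u. u \<in> V \<Longrightarrow> N u \<le> 1 \<Longrightarrow> \<bar>l u\<bar> \<le> c" shows "dual_norm V N l \<le> c"
  unfolding dual_norm_def by (rule cSUP_least) (use assms zero_mem N_zero in auto)

text \<open>
  If \<open>N u\<close> vanishes, normalising \<open>u\<close> is impossible, but then boundedness of \<open>l\<close> forces \<open>l u = 0\<close>.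
\<close>

lemma dual_norm_bound: assumes l: "l \<in> dual V N" and u: "u \<in> V" shows "\<bar>l u\<bar> \<le> dual_norm V N l * N u"
proof (cases "N u = 0")
  case True
  obtain C where "\<bar>l u\<bar> \<le> C * N u" using l u unfolding dual_def by blast
  then show ?thesis using True by simp
next
  case False
  then have p: "N u > 0" using N_nonneg[OF u] by simp
  have "N (fscale (1 / N u) u) \<le> 1" using N_scale[OF u] p by simp
  then have "\<bar>l (fscale (1 / N u) u)\<bar> \<le> dual_norm V N l" using dual_norm_upper l scale_mem u by blast
  then show ?thesis using dual_scale[OF l u] p by (simp add: abs_mult field_simps)
qed

lemma dual_norm_approx: assumes "c < dual_norm V N l"
  obtains u where "u \<in> V" "N u \<le> 1" "c < \<bar>l u\<bar>"
  using assms dual_norm_le[of l c] by (meson not_le)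

lemma dual_norm_approx_signed: assumes l: "l \<in> dual V N" and c: "c < dual_norm V N l"
  obtains u where "u \<in> V" "N u \<le> 1" "c < l u"
proof -
  obtain u where u: "u \<in> V" "N u \<le> 1" "c < \<bar>l u\<bar>" using dual_norm_approx[OF c] by blast
  show ?thesis
  proof (cases "l u \<ge> 0")
    case True then show ?thesis using u that by simp
  next
    case False
    have "- u \<in> V" "N (- u) \<le> 1" "l (- u) = - l u"
      using u uminus_mem N_uminus dual_uminus[OF l u(1)] by auto
    then show ?thesis using that u False by (metis abs_of_neg not_le)
  qed
qed

lemma dual_memI:
  assumes "\<And>u w. u \<in> V \<Longrightarrow> w \<in> V \<Longrightarrow> l (u + w) = l u + l w" "\<And>c u. u \<in> V \<Longrightarrow> l (fscale c u) = c * l u"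
    "\<And>u. u \<notin> V \<Longrightarrow> l u = 0" "\<And>u. u \<in> V \<Longrightarrow> \<bar>l u\<bar> \<le> C * N u"
  shows "l \<in> dual V N"
  using assms unfolding dual_def linear_functionals_def by blast

lemma seminormed_dual: "seminormed (dual V N) (dual_norm V N)"
proof
  show "0 \<in> dual V N" by (rule dual_memI[where C=0]) auto
next
  fix u w assume uw: "u \<in> dual V N" "w \<in> dual V N"
  then show "u + w \<in> dual V N"
    by (intro dual_memI[where C="dual_norm V N u + dual_norm V N w"])
       (auto simp: dual_add dual_scale dual_outside distrib_left distrib_right
         intro!: order_trans[OF abs_triangle_ineq] add_mono dual_norm_bound)
  show "dual_norm V N (u + w) \<le> dual_norm V N u + dual_norm V N w"
    by (rule dual_norm_le) (auto intro!: order_trans[OF abs_triangle_ineq] add_mono dual_norm_upper uw)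
next
  fix c and u assume u: "u \<in> dual V N"
  show m: "fscale c u \<in> dual V N" for c
    by (intro dual_memI[where C="\<bar>c\<bar> * dual_norm V N u"])
       (use u in \<open>auto simp: fscale_apply dual_add dual_scale dual_outside distrib_left abs_mult mult.assoc
         intro!: mult_left_mono dual_norm_bound\<close>)
  have le: "dual_norm V N (fscale c u) \<le> \<bar>c\<bar> * dual_norm V N u" if "u \<in> dual V N" for c u
    by (rule dual_norm_le) (auto simp: fscale_def abs_mult intro!: mult_left_mono dual_norm_upper that)
  show "dual_norm V N (fscale c u) = \<bar>c\<bar> * dual_norm V N u"
  proof (cases "c = 0")
    case True
    have "dual_norm V N (fscale 0 u) \<le> 0" using le[OF u, of 0] by simp
    then show ?thesis using True dual_norm_nonneg[OF m[of 0]] by simp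
  next
    case False
    have "dual_norm V N (fscale (1/c) (fscale c u)) \<le> \<bar>1/c\<bar> * dual_norm V N (fscale c u)" by (rule le[OF m])
    moreover have "fscale (1/c) (fscale c u) = u" using False by (auto simp: fscale_def)
    ultimately have "\<bar>c\<bar> * dual_norm V N u \<le> dual_norm V N (fscale c u)" using False by (simp add: field_simps)
    then show ?thesis using le[OF u, of c] by simp
  qed
qed

lemma complete_dual: "complete_under (dual V N) (dual_norm V N)"
  unfolding complete_under_def
proof (intro allI impI, elim conjE)
  fix w :: "nat \<Rightarrow> ('a \<Rightarrow> real) \<Rightarrow> real"
  assume w: "\<forall>n. w n \<in> dual V N"
    and cau: "\<forall>e>0. \<exists>M. \<forall>m\<ge>M. \<forall>n\<ge>M. dual_norm V N (w m - w n) < e"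
  interpret dual: seminormed "dual V N" "dual_norm V N" by (rule seminormed_dual)
  have est: "\<bar>w m u - w n u\<bar> \<le> dual_norm V N (w m - w n) * N u" if "u \<in> V" for m n u
    using dual_norm_bound[OF dual.diff_mem, of "w m" "w n" u] w that by simp
  have lim_ex: "convergent (\<lambda>n. w n u)" if u: "u \<in> V" for u
  proof -
    have "Cauchy (\<lambda>n. w n u)"
      unfolding Cauchy_iff
    proof (intro allI impI)
      fix e :: real assume e: "e > 0"
      then obtain M where M: "\<And>m n. m \<ge> M \<Longrightarrow> n \<ge> M \<Longrightarrow> dual_norm V N (w m - w n) < e / (1 + N u)"
        using cau N_nonneg[OF u] by (metis add_pos_nonneg divide_pos_pos zero_less_one)
      have "norm (w m u - w n u) < e" if "m \<ge> M" "n \<ge> M" for m n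
      proof -
        have "\<bar>w m u - w n u\<bar> \<le> dual_norm V N (w m - w n) * N u" by (rule est[OF u])
        also have "\<dots> \<le> e / (1 + N u) * N u" using M[OF that] N_nonneg[OF u] by (intro mult_right_mono) auto
        also have "\<dots> < e" using e N_nonneg[OF u] by (simp add: field_simps)
        finally show ?thesis by simp
      qed
      then show "\<exists>M. \<forall>m\<ge>M. \<forall>n\<ge>M. norm (w m u - w n u) < e" by blast
    qed
    then show ?thesis by (simp add: Cauchy_convergent_iff)
  qed
  define l where "l u = (if u \<in> V then lim (\<lambda>n. w n u) else 0)" for u
  have lim: "(\<lambda>n. w n u) \<longlonglongrightarrow> l u" for u
  proof (cases "u \<in> V")
    case False
    then have "(\<lambda>n. w n u) = (\<lambda>n. 0)" using w dual_outside[OF _ False] by blast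
    then show ?thesis using False by (simp add: l_def)
  qed (use lim_ex[of u] in \<open>auto simp: l_def convergent_LIMSEQ_iff\<close>)
  have tail: "\<bar>w m u - l u\<bar> \<le> e * N u" if M: "\<And>n. n \<ge> M \<Longrightarrow> dual_norm V N (w m - w n) \<le> e" and u: "u \<in> V" for m e u M
  proof (rule tendsto_upperbound[OF _ _ trivial_limit_sequentially])
    show "(\<lambda>n. \<bar>w m u - w n u\<bar>) \<longlonglongrightarrow> \<bar>w m u - l u\<bar>" by (intro tendsto_intros lim)
    show "\<forall>\<^sub>F n in sequentially. \<bar>w m u - w n u\<bar> \<le> e * N u"
      using eventually_ge_at_top[of M]
    proof eventually_elim
      case (elim n)
      have "dual_norm V N (w m - w n) * N u \<le> e * N u" using M[OF elim] N_nonneg[OF u] by (intro mult_right_mono) auto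
      with est[OF u, of m n] show ?case by linarith
    qed
  qed
  obtain M1 where M1: "\<And>m n. m \<ge> M1 \<Longrightarrow> n \<ge> M1 \<Longrightarrow> dual_norm V N (w m - w n) < 1" using cau by (metis zero_less_one)
  have "l \<in> dual V N"
  proof (rule dual_memI)
    fix u v assume uv: "u \<in> V" "v \<in> V"
    have "(\<lambda>n. w n (u + v)) \<longlonglongrightarrow> l u + l v" using tendsto_add[OF lim lim, of u v] w uv by (simp add: dual_add)
    then show "l (u + v) = l u + l v" using lim LIMSEQ_unique by blast
  next
    fix c u assume u: "u \<in> V"
    have "(\<lambda>n. w n (fscale c u)) \<longlonglongrightarrow> c * l u" using tendsto_mult_left[OF lim, of c u] w u by (simp add: dual_scale)
    then show "l (fscale c u) = c * l u" using lim LIMSEQ_unique by blast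
  next
    fix u assume u: "u \<in> V"
    have "\<bar>w M1 u - l u\<bar> \<le> 1 * N u" by (rule tail[where M=M1]) (use M1 u less_imp_le in auto)
    moreover have "\<bar>w M1 u\<bar> \<le> dual_norm V N (w M1) * N u" using dual_norm_bound w u by blast
    ultimately show "\<bar>l u\<bar> \<le> (dual_norm V N (w M1) + 1) * N u" by (simp add: distrib_right)
  qed (simp add: l_def)
  moreover have "(\<lambda>n. dual_norm V N (w n - l)) \<longlonglongrightarrow> 0"
  proof (rule LIMSEQ_I)
    fix e :: real assume e: "e > 0"
    then obtain M where M: "\<And>m n. m \<ge> M \<Longrightarrow> n \<ge> M \<Longrightarrow> dual_norm V N (w m - w n) < e / 2"
      using cau[rule_format, of "e / 2"] by auto
    have "norm (dual_norm V N (w m - l) - 0) < e" if m: "m \<ge> M" for m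
    proof -
      have "dual_norm V N (w m - l) \<le> e / 2"
      proof (rule dual_norm_le)
        fix u assume u: "u \<in> V" "N u \<le> 1"
        have "\<bar>w m u - l u\<bar> \<le> e / 2 * N u" by (rule tail[where M=M]) (use M m u less_imp_le in auto)
        also have "\<dots> \<le> e / 2 * 1" using u e by (intro mult_left_mono) auto
        finally show "\<bar>(w m - l) u\<bar> \<le> e / 2" by simp
      qed
      moreover have "0 \<le> dual_norm V N (w m - l)" using dual_norm_nonneg[OF dual.diff_mem] w \<open>l \<in> dual V N\<close> by blast
      ultimately show ?thesis using e by simp
    qed
    then show "\<exists>M. \<forall>n\<ge>M. norm (dual_norm V N (w n - l) - 0) < e" by blast
  qed
  ultimately show "\<exists>u\<in>dual V N. (\<lambda>n. dual_norm V N (w n - u)) \<longlonglongrightarrow> 0" by blast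
qed

end

text \<open>
  The usual definition of a uniformly smooth norm, \<open>N (x + t y) + N (x - t y) = 2 + o(t)\<close> uniformly for
  \<open>x\<close> and \<open>y\<close> in the unit ball, asked for one \<open>t\<close> for every \<open>e\<close>.
\<close>

definition uniformly_smooth :: "('a \<Rightarrow> real) set \<Rightarrow> (('a \<Rightarrow> real) \<Rightarrow> real) \<Rightarrow> bool" where
  "uniformly_smooth V N \<longleftrightarrow> (\<forall>e>0. \<exists>t>0. \<forall>x\<in>V. \<forall>y\<in>V. N x \<le> 1 \<and> N y \<le> 1 \<longrightarrow>
     N (x + fscale t y) + N (x - fscale t y) \<le> 2 + e * t)"

lemma uniformly_smoothD:
  assumes "uniformly_smooth V N" "e > 0"
  shows "\<exists>t>0. \<forall>x\<in>V. \<forall>y\<in>V. N x \<le> 1 \<and> N y \<le> 1 \<longrightarrow>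
     N (x + fscale t y) + N (x - fscale t y) \<le> 2 + e * t"
  using assms unfolding uniformly_smooth_def by blast

text \<open>
  For the norms \<open>a\<close>, \<open>b\<close> of two vectors and the norm \<open>c\<close> of their midpoint: a small convexity gap of the
  squared norm makes \<open>a\<close>, \<open>b\<close> and \<open>c\<close> almost equal, since the gap is at least
  \<open>((a - b) / 2)^2 + ((a + b) / 2 - c)^2\<close>.
\<close>

lemma midpoint_norm_near_max:
  fixes a b c \<eta> :: real
  assumes "0 \<le> c" "c \<le> (a + b) / 2" "(a\<^sup>2 + b\<^sup>2) / 2 - c\<^sup>2 < \<eta>\<^sup>2" "0 < \<eta>"
  shows "max a b - 2 * \<eta> < c"
proof -
  define d where "d = (a - b) / 2"
  define g where "g = (a + b) / 2 - c"
  have ab: "a = c + g + d" "b = c + g - d" by (simp_all add: d_def g_def field_simps)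
  have "0 \<le> c * g" using assms(1,2) by (intro mult_nonneg_nonneg) (auto simp: g_def)
  moreover have "d\<^sup>2 + g\<^sup>2 + 2 * (c * g) < \<eta>\<^sup>2"
    using assms(3) unfolding ab by (simp add: power2_eq_square algebra_simps)
  ultimately have "d\<^sup>2 < \<eta>\<^sup>2" "g\<^sup>2 < \<eta>\<^sup>2" using zero_le_power2[of d] zero_le_power2[of g] by linarith+
  then have "\<bar>d\<bar> < \<eta>" "\<bar>g\<bar> < \<eta>"
    using assms(4) abs_le_square_iff[of \<eta> d] abs_le_square_iff[of \<eta> g] by auto
  then show ?thesis unfolding ab by linarith
qed

text \<open>
  The dual of a uniformly smooth space is uniformly convex. Let \<open>u\<close> and \<open>w\<close> be functionals of norm at
  most \<open>\<rho>\<close> whose midpoint has norm almost \<open>\<rho>\<close>, attained nearly at \<open>x\<close>. For every \<open>y\<close> in the unit ball the sum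
  \<open>u (x + t y) + w (x - t y)\<close> is at most \<open>\<rho>\<close> times \<open>2 + o(t)\<close> by smoothness, and it equals twice the value
  of the midpoint at \<open>x\<close>, which is almost \<open>2 \<rho>\<close>, plus \<open>t (u - w) y\<close>. So \<open>(u - w) y\<close> is small.
\<close>

lemma (in seminormed) uniformly_convexifiable_dual:
  assumes us: "uniformly_smooth V N"
  shows "uniformly_convexifiable (dual V N) (dual_norm V N)"
proof -
  interpret dual: seminormed "dual V N" "dual_norm V N" by (rule seminormed_dual)
  let ?D = "dual_norm V N"
  have "convexity_gauge (dual V N) ?D (\<lambda>l. (?D l)\<^sup>2)"
    unfolding convexity_gauge_def
  proof (intro conjI ballI allI impI)
    show "\<exists>M. \<forall>u\<in>dual V N. ?D u \<le> R \<longrightarrow> (?D u)\<^sup>2 \<le> M" for R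
      using power_mono[OF _ dual_norm_nonneg] by blast
  next
    fix u w assume uw: "u \<in> dual V N" "w \<in> dual V N"
    have "(?D (midpoint_of u w))\<^sup>2 \<le> ((?D u + ?D w) / 2)\<^sup>2"
      by (intro power_mono dual.N_midpoint_le dual.N_nonneg dual.midpoint_mem uw)
    also have "\<dots> = ((?D u)\<^sup>2 + (?D w)\<^sup>2) / 2 - ((?D u - ?D w) / 2)\<^sup>2" by (simp add: power2_eq_square field_simps)
    finally show "(?D (midpoint_of u w))\<^sup>2 \<le> ((?D u)\<^sup>2 + (?D w)\<^sup>2) / 2" by (smt (verit) zero_le_power2)
  next
    fix R e :: real assume e: "e > 0"
    define R' where "R' = \<bar>R\<bar> + 1"
    have R': "R' > 0" unfolding R'_def by simp
    obtain t where t: "t > 0" and T: "\<And>x y. x \<in> V \<Longrightarrow> y \<in> V \<Longrightarrow> N x \<le> 1 \<Longrightarrow> N y \<le> 1 \<Longrightarrow>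
        N (x + fscale t y) + N (x - fscale t y) \<le> 2 + e / (2 * R') * t"
      using uniformly_smoothD[OF us, of "e / (2 * R')"] e R' by auto
    \<comment> \<open>With this choice \<open>e / 2 + 4 * \<eta> / t < e\<close>; \<open>R'\<close> is a positive bound for the norms.\<close>
    define \<eta> where "\<eta> = e * t / 24"
    have \<eta>: "\<eta> > 0" using e t by (simp add: \<eta>_def)
    show "\<exists>d>0. \<forall>u\<in>dual V N. \<forall>w\<in>dual V N. ?D u \<le> R \<and> ?D w \<le> R \<and>
        ((?D u)\<^sup>2 + (?D w)\<^sup>2) / 2 - (?D (midpoint_of u w))\<^sup>2 < d \<longrightarrow> ?D (u - w) < e"
    proof (intro exI[of _ "\<eta>\<^sup>2"] conjI ballI impI)
      fix u w assume uw: "u \<in> dual V N" "w \<in> dual V N" and bounds: "?D u \<le> R \<and> ?D w \<le> R \<and>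
        ((?D u)\<^sup>2 + (?D w)\<^sup>2) / 2 - (?D (midpoint_of u w))\<^sup>2 < \<eta>\<^sup>2"
      then have uR: "?D u \<le> R" and wR: "?D w \<le> R" by auto
      let ?m = "midpoint_of u w"
      define \<rho> where "\<rho> = max (?D u) (?D w)"
      have m: "?m \<in> dual V N" by (rule dual.midpoint_mem[OF uw])
      have nn: "0 \<le> ?D u" "0 \<le> ?D w" "0 \<le> ?D ?m" using dual.N_nonneg uw m by auto
      have mle: "?D ?m \<le> (?D u + ?D w) / 2" by (rule dual.N_midpoint_le[OF uw])
      have \<rho>m: "\<rho> - 2 * \<eta> < ?D ?m" unfolding \<rho>_def
        by (rule midpoint_norm_near_max[OF nn(3) mle _ \<eta>]) (use bounds in blast)
      have \<rho>R: "\<rho> \<le> R'" "0 \<le> \<rho>" using uR wR nn unfolding \<rho>_def R'_def by auto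
      obtain x where x: "x \<in> V" "N x \<le> 1" "\<rho> - 2 * \<eta> < ?m x" using dual_norm_approx_signed[OF m \<rho>m] by blast
      have mx: "2 * ?m x = u x + w x" by (simp add: midpoint_of_def fscale_def)
      have "?D (u - w) \<le> e / 2 + 4 * \<eta> / t"
      proof (rule ccontr)
        assume "\<not> ?thesis"
        then have "e / 2 + 4 * \<eta> / t < ?D (u - w)" by simp
        then obtain y where y: "y \<in> V" "N y \<le> 1" "e / 2 + 4 * \<eta> / t < (u - w) y"
          using dual_norm_approx_signed[OF dual.diff_mem[OF uw]] by blast
        have ty: "fscale t y \<in> V" using y scale_mem by blast
        have "u (x + fscale t y) \<le> \<rho> * N (x + fscale t y)"
          using dual_norm_bound[OF uw(1) add_mem[OF x(1) ty]] N_nonneg[OF add_mem[OF x(1) ty]]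
          unfolding \<rho>_def by (smt (verit) mult_right_mono)
        moreover have "w (x - fscale t y) \<le> \<rho> * N (x - fscale t y)"
          using dual_norm_bound[OF uw(2) diff_mem[OF x(1) ty]] N_nonneg[OF diff_mem[OF x(1) ty]]
          unfolding \<rho>_def by (smt (verit) mult_right_mono)
        moreover have "u (x + fscale t y) = u x + t * u y" using uw x y ty by (simp add: dual_add dual_scale)
        moreover have "w (x - fscale t y) = w x - t * w y" using uw x y ty by (simp add: dual_diff dual_scale)
        ultimately have "2 * ?m x + t * (u - w) y \<le> \<rho> * (N (x + fscale t y) + N (x - fscale t y))"
          by (simp add: mx algebra_simps)
        also have "\<dots> \<le> \<rho> * (2 + e / (2 * R') * t)" by (intro mult_left_mono T x y \<rho>R)
        also have "\<dots> = 2 * \<rho> + (\<rho> / R') * (e / 2 * t)" by (simp add: field_simps)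
        also have "\<dots> \<le> 2 * \<rho> + 1 * (e / 2 * t)" using \<rho>R R' e t by (intro add_left_mono mult_right_mono) auto
        finally have "t * (u - w) y < 4 * \<eta> + e / 2 * t" using x(3) by simp
        then have "(u - w) y < 4 * \<eta> / t + e / 2" using t by (simp add: field_simps)
        then show False using y(3) by simp
      qed
      also have "\<dots> < e" using t e unfolding \<eta>_def by (simp add: field_simps)
      finally show "?D (u - w) < e" .
    qed (use \<eta> in auto)
  qed auto
  then show ?thesis unfolding uniformly_convexifiable_def by (intro exI[of _ "\<lambda>x. x\<^sup>2"])
qed

text \<open>
  Sobolev spaces of distributions are images of spaces of functions or functionals. On the image
  the norm is given by its values at the images only.
\<close>

lemma (in seminormed)
  fixes J :: "('a \<Rightarrow> real) \<Rightarrow> 'b \<Rightarrow> real"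
  assumes add: "\<And>u w. u \<in> V \<Longrightarrow> w \<in> V \<Longrightarrow> J (u + w) = J u + J w"
    and scale: "\<And>c u. u \<in> V \<Longrightarrow> J (fscale c u) = fscale c (J u)"
    and norm: "\<And>u. u \<in> V \<Longrightarrow> N' (J u) = N u"
  shows seminormed_image: "seminormed (J ` V) N'"
    and complete_image: "complete_under V N \<Longrightarrow> complete_under (J ` V) N'"
    and uniformly_convexifiable_image: "uniformly_convexifiable V N \<Longrightarrow> uniformly_convexifiable (J ` V) N'"
proof -
  have J0: "J 0 = 0" using scale[OF zero_mem, of 0] by simp
  have Jdiff: "J (u - w) = J u - J w" if "u \<in> V" "w \<in> V" for u w
    using add[OF that(1) uminus_mem[OF that(2)]] scale[OF that(2), of "-1"] by simp
  have Jmid: "J (midpoint_of u w) = midpoint_of (J u) (J w)" if "u \<in> V" "w \<in> V" for u w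
    unfolding midpoint_of_def using add[OF that] scale[OF add_mem[OF that]] by simp
  show "seminormed (J ` V) N'"
  proof
    show "0 \<in> J ` V" using J0 zero_mem by (metis imageI)
    show "u + w \<in> J ` V" if "u \<in> J ` V" "w \<in> J ` V" for u w
      using that add add_mem by (auto simp: image_iff) metis
    show "fscale c u \<in> J ` V" if "u \<in> J ` V" for c u
      using that scale scale_mem by (auto simp: image_iff) metis
    show "N' (fscale c u) = \<bar>c\<bar> * N' u" if "u \<in> J ` V" for c u
    proof -
      obtain x where x: "u = J x" "x \<in> V" using \<open>u \<in> J ` V\<close> by (elim imageE)
      then show ?thesis using scale[OF x(2), of c, symmetric] norm scale_mem N_scale by simp
    qed
    show "N' (u + w) \<le> N' u + N' w" if "u \<in> J ` V" "w \<in> J ` V" for u w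
    proof -
      obtain x y where "u = J x" "x \<in> V" "w = J y" "y \<in> V"
        using \<open>u \<in> J ` V\<close> \<open>w \<in> J ` V\<close> by (elim imageE)
      then show ?thesis using add[of x y, symmetric] norm add_mem N_triangle by simp
    qed
  qed
  show "complete_under (J ` V) N'" if c: "complete_under V N"
    unfolding complete_under_def
  proof (intro allI impI, elim conjE)
    fix w :: "nat \<Rightarrow> 'b \<Rightarrow> real" assume w: "\<forall>n. w n \<in> J ` V" and cau: "\<forall>e>0. \<exists>M. \<forall>m\<ge>M. \<forall>n\<ge>M. N' (w m - w n) < e"
    obtain x :: "nat \<Rightarrow> 'a \<Rightarrow> real" where x: "\<And>n. x n \<in> V" "\<And>n. w n = J (x n)" using w unfolding image_iff by metis
    have eq: "N' (w m - J y) = N (x m - y)" if "y \<in> V" for m y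
      using x Jdiff[OF x(1) that, of m] norm[OF diff_mem[OF x(1) that], of m] by simp
    have "\<exists>u\<in>V. (\<lambda>n. N (x n - u)) \<longlonglongrightarrow> 0"
      by (rule complete_underD[OF c x(1)]) (use cau eq[OF x(1)] x(2) in simp)
    then obtain y where "y \<in> V" "(\<lambda>n. N (x n - y)) \<longlonglongrightarrow> 0" by blast
    then show "\<exists>u\<in>J ` V. (\<lambda>n. N' (w n - u)) \<longlonglongrightarrow> 0" using eq by (intro bexI[of _ "J y"]) auto
  qed
  show "uniformly_convexifiable (J ` V) N'" if c: "uniformly_convexifiable V N"
  proof -
    obtain F where F: "convexity_gauge V N (\<lambda>u. F (N u))" using c unfolding uniformly_convexifiable_def by blast
    have "convexity_gauge (J ` V) N' (\<lambda>u. F (N' u))"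
      unfolding convexity_gauge_def ball_simps
    proof (intro conjI ballI allI impI)
      show "0 \<le> F (N' (J u))" if "u \<in> V" for u using F that norm unfolding convexity_gauge_def by simp
      show "\<exists>M. \<forall>u\<in>V. N' (J u) \<le> R \<longrightarrow> F (N' (J u)) \<le> M" for R
        using F norm unfolding convexity_gauge_def by simp
      show "F (N' (midpoint_of (J u) (J w))) \<le> (F (N' (J u)) + F (N' (J w))) / 2" if "u \<in> V" "w \<in> V" for u w
        using F that unfolding convexity_gauge_def by (simp add: norm midpoint_mem flip: Jmid)
      fix R e :: real assume "e > 0"
      from convexity_gaugeD[OF F this, of R]
      show "\<exists>d>0. \<forall>u\<in>V. \<forall>w\<in>V. N' (J u) \<le> R \<and> N' (J w) \<le> R \<and>
        (F (N' (J u)) + F (N' (J w))) / 2 - F (N' (midpoint_of (J u) (J w))) < d \<longrightarrow> N' (J u - J w) < e"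
        by (simp add: norm midpoint_mem diff_mem flip: Jmid Jdiff)
    qed
    then show ?thesis unfolding uniformly_convexifiable_def by blast
  qed
qed

section \<open>Seminorms given by homogeneous convex functionals\<close>

text \<open>
  A homogeneous functional satisfies the triangle inequality as soon as its unit ball is convex, and
  \<open>\<Phi>\<close> and its root have the same unit ball. With the integral of \<open>\<bar>f\<bar> powr p\<close> for \<open>\<Phi>\<close> this is Minkowski's
  inequality.
\<close>

lemma seminormed_powr:
  fixes \<Phi> :: "('a \<Rightarrow> real) \<Rightarrow> real"
  assumes p: "p > 0" and z: "0 \<in> V" and add: "\<And>u w. u \<in> V \<Longrightarrow> w \<in> V \<Longrightarrow> u + w \<in> V"
    and sc: "\<And>c u. u \<in> V \<Longrightarrow> fscale c u \<in> V"
    and pos: "\<And>u. u \<in> V \<Longrightarrow> 0 \<le> \<Phi> u"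
    and hom: "\<And>c u. u \<in> V \<Longrightarrow> \<Phi> (fscale c u) = \<bar>c\<bar> powr p * \<Phi> u"
    and conv: "\<And>u w c d. u \<in> V \<Longrightarrow> w \<in> V \<Longrightarrow> 0 \<le> c \<Longrightarrow> 0 \<le> d \<Longrightarrow> c + d = 1 \<Longrightarrow>
      \<Phi> (fscale c u + fscale d w) \<le> c * \<Phi> u + d * \<Phi> w"
  shows "seminormed V (\<lambda>u. \<Phi> u powr (1 / p))"
proof
  let ?N = "\<lambda>u. \<Phi> u powr (1 / p)"
  fix c u assume u: "u \<in> V"
  show hN: "?N (fscale c u) = \<bar>c\<bar> * ?N u" if "u \<in> V" for c u
    using hom[OF that] pos[OF that] p by (simp add: powr_mult powr_powr)
  fix w assume w: "w \<in> V"
  have unit: "\<Phi> (fscale (1/a) u) \<le> 1" if "?N u \<le> a" "a > 0" "u \<in> V" for a u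
  proof -
    have "\<Phi> u = ?N u powr p" using pos[OF that(3)] p by (simp add: powr_powr)
    also have "\<dots> \<le> a powr p" using that p by (intro powr_mono2) auto
    finally have "\<Phi> u \<le> a powr p" .
    then have "(1 / a) powr p * \<Phi> u \<le> (1 / a) powr p * a powr p" by (intro mult_left_mono) auto
    also have "(1 / a) powr p * a powr p = 1" using that(2) by (simp flip: powr_mult)
    finally show ?thesis using hom[OF that(3), of "1/a"] that(2) by simp
  qed
  have key: "?N (u + w) \<le> a + b" if "?N u \<le> a" "a > 0" "?N w \<le> b" "b > 0" for a b
  proof -
    have "\<Phi> (fscale (a/(a+b)) (fscale (1/a) u) + fscale (b/(a+b)) (fscale (1/b) w))
        \<le> a/(a+b) * \<Phi> (fscale (1/a) u) + b/(a+b) * \<Phi> (fscale (1/b) w)"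
      using that u w by (intro conv sc) (auto simp flip: add_divide_distrib)
    also have "\<dots> \<le> a/(a+b) * 1 + b/(a+b) * 1" using that u w by (intro add_mono mult_left_mono unit) auto
    also have "\<dots> = 1" using that by (simp flip: add_divide_distrib)
    also have "fscale (a/(a+b)) (fscale (1/a) u) + fscale (b/(a+b)) (fscale (1/b) w) = fscale (1/(a+b)) (u + w)"
    proof -
      have "a + b \<noteq> 0" using that by simp
      then show ?thesis using that by (auto simp: fscale_def fun_eq_iff add_divide_distrib)
    qed
    finally have "\<Phi> (fscale (1/(a+b)) (u + w)) \<le> 1" .
    then have "?N (fscale (1/(a+b)) (u + w)) \<le> 1"
      using powr_mono2[of "1/p" "\<Phi> (fscale (1/(a+b)) (u + w))" 1] p pos[OF sc[OF add[OF u w]]] by simp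
    moreover have "?N (fscale (1/(a+b)) (u + w)) = ?N (u + w) / (a + b)"
      using hN[OF add[OF u w], of "1/(a+b)"] that by simp
    ultimately show ?thesis using that by (simp add: divide_le_eq)
  qed
  show "?N (u + w) \<le> ?N u + ?N w"
  proof (rule field_le_epsilon)
    fix e :: real assume "e > 0"
    then have "?N (u + w) \<le> (?N u + e/2) + (?N w + e/2)" by (intro key) (auto simp: add_nonneg_pos)
    then show "?N (u + w) \<le> ?N u + ?N w + e" by simp
  qed
qed (use assms in auto)

text \<open>
  The mean of \<open>N (x + t y)\<close> and \<open>N (x - t y)\<close> is at most their \<open>p\<close>-mean, which the assumption on \<open>\<Phi>\<close> bounds
  by \<open>(1 + e t / 2) powr (1 / p)\<close>, and that is at most \<open>1 + e t / 2\<close>.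
\<close>

lemma uniformly_smooth_powr:
  fixes \<Phi> :: "('a \<Rightarrow> real) \<Rightarrow> real"
  assumes p: "p \<ge> 1" and V: "\<And>u w c. u \<in> V \<Longrightarrow> w \<in> V \<Longrightarrow> u + fscale c w \<in> V"
    and pos: "\<And>u. u \<in> V \<Longrightarrow> 0 \<le> \<Phi> u"
    and smooth: "\<And>e. e > 0 \<Longrightarrow> \<exists>t>0. \<forall>x\<in>V. \<forall>y\<in>V.
       \<Phi> (x + fscale t y) + \<Phi> (x - fscale t y) \<le> 2 * \<Phi> x + e * t * (\<Phi> x + \<Phi> y)"
    and convex: "convex_on {0..} (\<lambda>x::real. x powr p)"
  shows "uniformly_smooth V (\<lambda>u. \<Phi> u powr (1 / p))"
  unfolding uniformly_smooth_def
proof (intro allI impI)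
  fix e :: real assume e: "e > 0"
  then obtain t where t: "t > 0" and T: "\<And>x y. x \<in> V \<Longrightarrow> y \<in> V \<Longrightarrow>
     \<Phi> (x + fscale t y) + \<Phi> (x - fscale t y) \<le> 2 * \<Phi> x + e / 2 * t * (\<Phi> x + \<Phi> y)"
    using smooth[of "e/2"] by (metis half_gt_zero)
  have mc: "((a + b) / 2) powr p \<le> (a powr p + b powr p) / 2" if "a \<ge> 0" "b \<ge> 0" for a b
    using convex_onD[OF convex, of "1/2" a b] that by (simp add: add_divide_distrib)
  show "\<exists>t>0. \<forall>x\<in>V. \<forall>y\<in>V. \<Phi> x powr (1/p) \<le> 1 \<and> \<Phi> y powr (1/p) \<le> 1 \<longrightarrow>
     \<Phi> (x + fscale t y) powr (1/p) + \<Phi> (x - fscale t y) powr (1/p) \<le> 2 + e * t"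
  proof (intro exI[of _ t] conjI ballI impI t, elim conjE)
    fix x y assume x: "x \<in> V" "\<Phi> x powr (1/p) \<le> 1" and y: "y \<in> V" "\<Phi> y powr (1/p) \<le> 1"
    have le1: "\<Phi> z \<le> 1" if "z \<in> V" "\<Phi> z powr (1/p) \<le> 1" for z
      using powr_mono2[of p "\<Phi> z powr (1/p)" 1] that pos[OF that(1)] p by (simp add: powr_powr)
    have "x - fscale t y = x + fscale (-t) y" by (auto simp: fscale_def fun_eq_iff)
    then have mem: "x + fscale t y \<in> V" "x - fscale t y \<in> V" using V x y by metis+
    let ?A = "\<Phi> (x + fscale t y) powr (1/p)" and ?B = "\<Phi> (x - fscale t y) powr (1/p)"
    have Ap: "?A powr p = \<Phi> (x + fscale t y)" "?B powr p = \<Phi> (x - fscale t y)"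
      using pos mem p by (auto simp: powr_powr)
    have "((?A + ?B) / 2) powr p \<le> (?A powr p + ?B powr p) / 2" by (rule mc) auto
    also have "\<dots> \<le> (2 * \<Phi> x + e / 2 * t * (\<Phi> x + \<Phi> y)) / 2" unfolding Ap by (intro divide_right_mono T x y) simp
    also have "\<dots> \<le> (2 * 1 + e / 2 * t * (1 + 1)) / 2"
    proof -
      have "e / 2 * t * (\<Phi> x + \<Phi> y) \<le> e / 2 * t * (1 + 1)"
        using e t le1[OF x] le1[OF y] by (intro mult_left_mono) auto
      then show ?thesis using le1[OF x] by simp
    qed
    finally have le: "((?A + ?B) / 2) powr p \<le> 1 + e * t / 2" by simp
    have "(?A + ?B) / 2 = (((?A + ?B) / 2) powr p) powr (1/p)" using p by (simp add: powr_powr)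
    also have "\<dots> \<le> (1 + e * t / 2) powr (1/p)" using le p by (intro powr_mono2) auto
    also have "\<dots> \<le> (1 + e * t / 2) powr 1" using p e t by (intro powr_mono) auto
    finally show "?A + ?B \<le> 2 + e * t" using e t by simp
  qed
qed

section \<open>Smooth functions and test functions\<close>

abbreviation smooth :: "(real ^ 'n::finite \<Rightarrow> 'b::real_normed_vector) \<Rightarrow> bool" where
  "smooth f \<equiv> smooth_on UNIV f"

lemma partial_eqI: "(f has_derivative f') (at x) \<Longrightarrow> partial i f x = f' (axis i 1)"
  unfolding partial_def using frechet_derivative_at by metis

lemma smooth_differentiable: "smooth f \<Longrightarrow> f differentiable (at x)"
  unfolding smooth_on_def differentiable_on_def by (metis UNIV_I foldr.simps(1) id_apply)

lemma smooth_has_derivative: "smooth f \<Longrightarrow> (f has_derivative frechet_derivative f (at x)) (at x)"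
  using smooth_differentiable frechet_derivative_works by blast

lemma smooth_foldr_partial: "smooth f \<Longrightarrow> smooth (foldr partial is f)"
  unfolding smooth_on_def by (metis foldr_append comp_apply)

lemma smooth_partial: "smooth f \<Longrightarrow> smooth (partial i f)"
  using smooth_foldr_partial[of f "[i]"] by simp

text \<open>
  Smoothness of functions of an explicit form follows once the form is preserved by partial
  derivatives; there is no need to compute the derivatives of higher order.
\<close>

lemma smooth_coinduct:
  assumes "f \<in> S" "\<And>g x. g \<in> S \<Longrightarrow> g differentiable (at x)" "\<And>g i. g \<in> S \<Longrightarrow> partial i g \<in> S"
  shows "smooth f"
proof -
  have "foldr partial is f \<in> S" for "is" by (induction "is") (use assms in auto)
  then show ?thesis unfolding smooth_on_def differentiable_on_def using assms(2) by auto
qed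

lemma smooth_continuous_on: "smooth f \<Longrightarrow> continuous_on A f"
  by (meson differentiable_imp_continuous_within smooth_differentiable continuous_at_imp_continuous_on)

lemma partial_const: "partial i (\<lambda>x. c) = (\<lambda>x. 0)"
  unfolding partial_def by simp

lemma smooth_const: "smooth (\<lambda>x. c)"
  by (rule smooth_coinduct[where S="range (\<lambda>c x. c)"]) (auto simp: partial_const)

lemma partial_add: "smooth f \<Longrightarrow> smooth g \<Longrightarrow> partial i (f + g) = partial i f + partial i g"
proof
  fix x assume "smooth f" "smooth g"
  from partial_eqI[OF has_derivative_add[OF this[THEN smooth_has_derivative, of x]]]
  show "partial i (f + g) x = (partial i f + partial i g) x" by (simp add: partial_def plus_fun_def)
qed

lemma smooth_add:
  fixes f g :: "real ^ 'n::finite \<Rightarrow> 'b::real_normed_vector"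
  assumes "smooth f" "smooth g" shows "smooth (f + g)"
proof -
  let ?S = "{f + g | f g. smooth f \<and> smooth g} :: (real ^ 'n \<Rightarrow> 'b) set"
  show ?thesis
  proof (rule smooth_coinduct[where S="?S"])
    show "f + g \<in> ?S" using assms by blast
  next
    fix h x i assume "h \<in> ?S"
    then obtain f g where h: "h = f + g" and fg: "smooth f" "smooth g" by blast
    have "(\<lambda>x. f x + g x) differentiable at x" by (intro differentiable_add smooth_differentiable fg)
    then show "h differentiable at x" by (simp add: h plus_fun_def)
    have "partial i h = partial i f + partial i g" "smooth (partial i f)" "smooth (partial i g)"
      using fg by (simp_all only: h partial_add smooth_partial)
    then show "partial i h \<in> ?S" by blast
  qed
qed

lemma partial_linear:
  assumes "bounded_linear L" "smooth f"
  shows "partial i (\<lambda>x. L (f x)) = (\<lambda>x. L (partial i f x))"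
proof
  fix x
  from partial_eqI[OF bounded_linear.has_derivative[OF assms(1) smooth_has_derivative[OF assms(2)], of x]]
  show "partial i (\<lambda>x. L (f x)) x = L (partial i f x)" by (simp add: partial_def)
qed

lemma smooth_linear: assumes "bounded_linear L" "smooth f" shows "smooth (\<lambda>x. L (f x))"
proof (rule smooth_coinduct[where S="{\<lambda>x. L (f x) | f. smooth f}"])
  show "(\<lambda>x. L (f x)) \<in> {\<lambda>x. L (f x) | f. smooth f}" using assms by auto
  show "g differentiable at x" if "g \<in> {\<lambda>x. L (f x) |f. smooth f}" for g x
    using that bounded_linear.has_derivative[OF assms(1) smooth_has_derivative] unfolding differentiable_def by blast
  show "partial i g \<in> {\<lambda>x. L (f x) |f. smooth f}" if "g \<in> {\<lambda>x. L (f x) |f. smooth f}" for g i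
    using that partial_linear[OF assms(1)] smooth_partial by blast
qed

lemma foldr_partial_linear:
  "bounded_linear L \<Longrightarrow> smooth f \<Longrightarrow> foldr partial is (\<lambda>x. L (f x)) = (\<lambda>x. L (foldr partial is f x))"
  by (induction "is") (auto simp: partial_linear smooth_foldr_partial)

lemma pderiv_mi_linear:
  "bounded_linear L \<Longrightarrow> smooth f \<Longrightarrow> pderiv_mi \<alpha> (\<lambda>x. L (f x)) = (\<lambda>x. L (pderiv_mi \<alpha> f x))"
  unfolding pderiv_mi_def by (rule foldr_partial_linear)

lemma partial_mult:
  fixes f g :: "real ^ 'n::finite \<Rightarrow> real"
  assumes "smooth f" "smooth g"
  shows "partial i (\<lambda>x. f x * g x) = (\<lambda>x. partial i f x * g x) + (\<lambda>x. f x * partial i g x)"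
proof
  fix x
  show "partial i (\<lambda>x. f x * g x) x = ((\<lambda>x. partial i f x * g x) + (\<lambda>x. f x * partial i g x)) x"
    using partial_eqI[OF has_derivative_mult[OF assms[THEN smooth_has_derivative, of x]]] by (simp add: partial_def)
qed

text \<open>
  The smallest class that contains the products of smooth functions and, by the product rule, is
  closed under partial derivatives.
\<close>

inductive_set sums_of_products :: "(real ^ 'n::finite \<Rightarrow> real) set" where
  prod: "smooth f \<Longrightarrow> smooth g \<Longrightarrow> (\<lambda>x. f x * g x) \<in> sums_of_products"
| sum: "f \<in> sums_of_products \<Longrightarrow> g \<in> sums_of_products \<Longrightarrow> f + g \<in> sums_of_products"

lemma sums_of_products_closed:
  "f \<in> sums_of_products \<Longrightarrow> (\<forall>x. f differentiable (at x)) \<and> (\<forall>i. partial i f \<in> sums_of_products)"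
proof (induction rule: sums_of_products.induct)
  case (prod f g)
  have "(\<lambda>x. f x * g x) differentiable at x" for x
    by (intro differentiable_mult smooth_differentiable prod)
  moreover have "partial i (\<lambda>x. f x * g x) \<in> sums_of_products" for i
    unfolding partial_mult[OF prod] by (intro sums_of_products.intros smooth_partial prod)
  ultimately show ?case by blast
next
  case (sum f g)
  have der: "(f + g has_derivative (\<lambda>v. frechet_derivative f (at x) v + frechet_derivative g (at x) v)) (at x)" for x
    unfolding plus_fun_def using sum.IH by (intro has_derivative_add) (simp_all add: frechet_derivative_works[symmetric])
  have "partial i (f + g) = partial i f + partial i g" for i
    using partial_eqI[OF der] by (auto simp: partial_def)
  then have "partial i (f + g) \<in> sums_of_products" for i
    using sum.IH sums_of_products.sum[of "partial i f" "partial i g"] by metis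
  then show ?case using der unfolding differentiable_def by blast
qed

lemma smooth_mult:
  fixes f g :: "real ^ 'n::finite \<Rightarrow> real"
  shows "smooth f \<Longrightarrow> smooth g \<Longrightarrow> smooth (\<lambda>x. f x * g x)"
  by (rule smooth_coinduct[where S=sums_of_products]) (use sums_of_products_closed in \<open>auto intro: sums_of_products.prod\<close>)

lemma smooth_prod:
  fixes f :: "'i \<Rightarrow> real ^ 'n::finite \<Rightarrow> real"
  shows "finite A \<Longrightarrow> (\<And>j. j \<in> A \<Longrightarrow> smooth (f j)) \<Longrightarrow> smooth (\<lambda>x. \<Prod>j\<in>A. f j x)"
  by (induction A rule: finite_induct) (auto simp: smooth_const intro!: smooth_mult)

lemma partial_eq_0_outside:
  assumes "closed K" "\<And>x. x \<notin> K \<Longrightarrow> f x = 0" "x \<notin> K" shows "partial i f x = 0"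
proof -
  have "((\<lambda>x. 0) has_derivative (\<lambda>x. 0)) (at x)" by simp
  then have "(f has_derivative (\<lambda>x. 0)) (at x)"
    by (rule has_derivative_transform_within_open[of _ _ _ _ "- K"]) (use assms in auto)
  from partial_eqI[OF this] show ?thesis .
qed

lemma foldr_partial_eq_0_outside:
  assumes "closed K" "\<And>x. x \<notin> K \<Longrightarrow> f x = 0" "x \<notin> K" shows "foldr partial is f x = 0"
  using assms(3)
proof (induction "is" arbitrary: x)
  case (Cons i "is")
  then show ?case using partial_eq_0_outside[OF assms(1), of "foldr partial is f"] by simp
qed (use assms in auto)

lemma test_functions_smooth: "f \<in> test_functions U \<Longrightarrow> smooth f"
  by (simp add: test_functions_def)

lemma test_functionsE:
  assumes "f \<in> test_functions U" obtains K where "compact K" "K \<subseteq> U" "\<And>x. x \<notin> K \<Longrightarrow> f x = 0"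
  using assms by (auto simp: test_functions_def)

lemma test_functionsI: "smooth f \<Longrightarrow> compact K \<Longrightarrow> K \<subseteq> U \<Longrightarrow> (\<And>x. x \<notin> K \<Longrightarrow> f x = 0) \<Longrightarrow> f \<in> test_functions U"
  by (auto simp: test_functions_def)

lemma test_functions_outside: "f \<in> test_functions U \<Longrightarrow> x \<notin> U \<Longrightarrow> f x = 0"
  by (auto simp: test_functions_def)

lemma test_functions_zero: "0 \<in> test_functions U"
  by (rule test_functionsI[of _ "{}"]) (auto simp: zero_fun_def smooth_const)

lemma test_functions_add: assumes "f \<in> test_functions U" "g \<in> test_functions U" shows "f + g \<in> test_functions U"
proof -
  obtain K K' where K: "compact K" "K \<subseteq> U" "\<And>x. x \<notin> K \<Longrightarrow> f x = 0" and K': "compact K'" "K' \<subseteq> U" "\<And>x. x \<notin> K' \<Longrightarrow> g x = 0"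
    using assms test_functionsE by meson
  show ?thesis
    by (rule test_functionsI[of _ "K \<union> K'"])
       (use K K' smooth_add[OF assms[THEN test_functions_smooth]] in auto)
qed

lemma test_functions_linear:
  assumes "bounded_linear L" "f \<in> test_functions U" shows "(\<lambda>x. L (f x)) \<in> test_functions U"
proof -
  obtain K where K: "compact K" "K \<subseteq> U" "\<And>x. x \<notin> K \<Longrightarrow> f x = 0" using assms test_functionsE by meson
  show ?thesis
    by (rule test_functionsI[of _ K])
       (use K smooth_linear[OF assms(1) test_functions_smooth[OF assms(2)]] in
         \<open>auto simp: linear_0[OF bounded_linear.linear[OF assms(1)]]\<close>)
qed

lemma test_functions_fscale: "f \<in> test_functions U \<Longrightarrow> fscale c f \<in> test_functions U"
  unfolding fscale_def by (rule test_functions_linear[OF bounded_linear_scaleR_right])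

lemma test_functions_foldr_partial: assumes "f \<in> test_functions U" shows "foldr partial is f \<in> test_functions U"
proof -
  obtain K where K: "compact K" "K \<subseteq> U" "\<And>x. x \<notin> K \<Longrightarrow> f x = 0" using assms test_functionsE by meson
  show ?thesis
  proof (rule test_functionsI[OF _ K(1,2)])
    show "smooth (foldr partial is f)" by (rule smooth_foldr_partial[OF test_functions_smooth[OF assms]])
    show "foldr partial is f x = 0" if "x \<notin> K" for x
      by (rule foldr_partial_eq_0_outside[OF compact_imp_closed[OF K(1)] K(3) that])
  qed
qed

lemma test_functions_pderiv_mi: "f \<in> test_functions U \<Longrightarrow> pderiv_mi \<alpha> f \<in> test_functions U"
  unfolding pderiv_mi_def by (rule test_functions_foldr_partial)

lemma test_functions_partial: "f \<in> test_functions U \<Longrightarrow> partial i f \<in> test_functions U"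
  using test_functions_foldr_partial[of f U "[i]"] by simp

lemma test_functions_mono: "f \<in> test_functions U \<Longrightarrow> U \<subseteq> W \<Longrightarrow> f \<in> test_functions W"
  unfolding test_functions_def by blast

lemma test_functions_mult:
  fixes f g :: "real ^ 'n::finite \<Rightarrow> real"
  assumes "f \<in> test_functions U" "smooth g" shows "(\<lambda>x. f x * g x) \<in> test_functions U"
proof -
  obtain K where K: "compact K" "K \<subseteq> U" "\<And>x. x \<notin> K \<Longrightarrow> f x = 0" using assms test_functionsE by meson
  show ?thesis
    by (rule test_functionsI[of _ K]) (use K smooth_mult[OF test_functions_smooth[OF assms(1)] assms(2)] in auto)
qed

lemma test_functions_bounded: assumes "f \<in> test_functions U" obtains B where "B > 0" "\<And>x. norm (f x) \<le> B"
proof -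
  obtain K where K: "compact K" "K \<subseteq> U" "\<And>x. x \<notin> K \<Longrightarrow> f x = 0" using assms test_functionsE by meson
  have "bounded (f ` K)"
    by (intro compact_imp_bounded compact_continuous_image K smooth_continuous_on test_functions_smooth[OF assms])
  then obtain B where B: "B > 0" "\<forall>y\<in>f ` K. norm y \<le> B" unfolding bounded_pos by blast
  have "norm (f x) \<le> B" for x using B K(3)[of x] by (cases "x \<in> K") auto
  with B(1) that show ?thesis by blast
qed

lemma test_functions_bdd_above: "f \<in> test_functions U \<Longrightarrow> bdd_above (range (\<lambda>x. norm (f x)))"
  by (meson test_functions_bounded bdd_aboveI2)

lemma test_functions_borel_measurable: "f \<in> test_functions U \<Longrightarrow> f \<in> borel_measurable borel"
  by (intro borel_measurable_continuous_onI smooth_continuous_on test_functions_smooth)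

lemma test_functions_integrable:
  fixes f :: "real ^ 'n::finite \<Rightarrow> real" assumes "f \<in> test_functions U" shows "integrable lborel f"
proof -
  obtain K where K: "compact K" "K \<subseteq> U" "\<And>x. x \<notin> K \<Longrightarrow> f x = 0" using assms test_functionsE by meson
  have "integrable lborel (\<lambda>x. indicator K x *\<^sub>R f x)"
    by (intro borel_integrable_compact K smooth_continuous_on test_functions_smooth[OF assms])
  moreover have "(\<lambda>x. indicator K x *\<^sub>R f x) = f" using K(3) by (auto simp: indicator_def fun_eq_iff)
  ultimately show ?thesis by simp
qed

section \<open>Integration by parts\<close>

lemma has_real_derivative_along_axis:
  fixes F :: "real ^ 'n::finite \<Rightarrow> real"
  assumes "smooth F"
  shows "((\<lambda>t. F (x + t *\<^sub>R axis i 1)) has_real_derivative partial i F (x + t *\<^sub>R axis i 1)) (at t)"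
proof -
  have l: "((\<lambda>t. x + t *\<^sub>R axis i 1) has_derivative (\<lambda>s. s *\<^sub>R axis i 1)) (at t)" by (auto intro!: derivative_eq_intros)
  have "((\<lambda>t. F (x + t *\<^sub>R axis i 1)) has_derivative
      (\<lambda>s. frechet_derivative F (at (x + t *\<^sub>R axis i 1)) (s *\<^sub>R axis i 1))) (at t)"
    by (rule has_derivative_compose[OF l smooth_has_derivative[OF assms]])
  moreover have "linear (frechet_derivative F (at (x + t *\<^sub>R axis i 1)))"
    by (rule linear_frechet_derivative[OF smooth_differentiable[OF assms]])
  ultimately have "((\<lambda>t. F (x + t *\<^sub>R axis i 1)) has_derivative (\<lambda>s. s * partial i F (x + t *\<^sub>R axis i 1))) (at t)"
    unfolding partial_def by (simp add: linear_cmul)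
  then show ?thesis by (simp add: has_field_derivative_def mult.commute[of "partial i F _"] mult_commute_abs)
qed

lemma mean_value_along_axis:
  fixes F :: "real ^ 'n::finite \<Rightarrow> real"
  assumes "smooth F" "h > 0"
  obtains t where "0 < t" "t < h" "F (x + h *\<^sub>R axis i 1) - F x = h * partial i F (x + t *\<^sub>R axis i 1)"
  using MVT2[OF assms(2), of "\<lambda>t. F (x + t *\<^sub>R axis i 1)"] has_real_derivative_along_axis[OF assms(1)] by force

lemma lborel_integral_translate:
  fixes f :: "'a::euclidean_space \<Rightarrow> real"
  assumes "f \<in> borel_measurable borel"
  shows "(\<integral>x. f (x + c) \<partial>lborel) = (\<integral>x. f x \<partial>lborel)"
proof -
  have "(\<integral>x. f x \<partial>lborel) = (\<integral>x. f x \<partial>distr lborel borel ((+) c))" by (simp add: lborel_distr_plus)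
  also have "\<dots> = (\<integral>x. f (c + x) \<partial>lborel)" by (rule integral_distr) (use assms in auto)
  finally show ?thesis by (simp add: add.commute)
qed

lemma lborel_integrable_translate:
  fixes f :: "'a::euclidean_space \<Rightarrow> real"
  assumes "integrable lborel f"
  shows "integrable lborel (\<lambda>x. f (x + c))"
proof -
  have "integrable (distr lborel borel ((+) c)) f" using assms by (simp add: lborel_distr_plus)
  then have "integrable lborel (\<lambda>x. f (c + x))" by (subst (asm) integrable_distr_eq) (use assms in auto)
  then show ?thesis by (simp add: add.commute)
qed

text \<open>
  By translation invariance the difference quotients of \<open>F\<close> have integral zero. They converge to the
  partial derivative, and they are bounded by its supremum and supported in a fixed ball.
\<close>

lemma integral_partial_eq_0:
  fixes F :: "real ^ 'n::finite \<Rightarrow> real"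
  assumes F: "F \<in> test_functions UNIV"
  shows "(\<integral>x. partial i F x \<partial>lborel) = 0"
proof -
  define e where "e = (axis i 1 :: real ^ 'n)"
  define h where "h n = inverse (real (Suc n))" for n
  have h: "h n > 0" "h n \<le> 1" for n unfolding h_def by (auto simp: inverse_le_1_iff)
  define q where "q n x = (F (x + h n *\<^sub>R e) - F x) / h n" for n x
  have sm: "smooth F" by (rule test_functions_smooth[OF F])
  have bm: "F \<in> borel_measurable borel" "partial i F \<in> borel_measurable borel"
    using test_functions_borel_measurable F test_functions_partial by blast+
  have q0: "(\<integral>x. q n x \<partial>lborel) = 0" for n
  proof -
    have "(\<integral>x. (F (x + h n *\<^sub>R e) - F x) \<partial>lborel) = 0"
      using test_functions_integrable[OF F] bm
      by (subst Bochner_Integration.integral_diff) (auto simp: lborel_integral_translate intro!: lborel_integrable_translate)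
    then show ?thesis unfolding q_def by simp
  qed
  obtain K where K: "compact K" "\<And>x. x \<notin> K \<Longrightarrow> F x = 0" using F test_functionsE by meson
  obtain R where R: "\<And>x. x \<in> K \<Longrightarrow> norm x \<le> R" using compact_imp_bounded[OF K(1)] unfolding bounded_iff by blast
  obtain B where B: "B > 0" "\<And>x. norm (partial i F x) \<le> B" using test_functions_bounded test_functions_partial F by blast
  have bound: "norm (q n x) \<le> B * indicator (cball 0 (R + 1)) x" for n x
  proof (cases "norm x \<le> R + 1")
    case True
    obtain t where "F (x + h n *\<^sub>R e) - F x = h n * partial i F (x + t *\<^sub>R e)"
      using mean_value_along_axis[OF sm h(1)] unfolding e_def by metis
    then have "q n x = partial i F (x + t *\<^sub>R e)" unfolding q_def using h(1)[of n] by simp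
    then show ?thesis using B True by simp
  next
    case False
    then have "x \<notin> K" using R by force
    moreover have "x + h n *\<^sub>R e \<notin> K"
    proof
      assume "x + h n *\<^sub>R e \<in> K"
      then have "norm (x + h n *\<^sub>R e) \<le> R" by (rule R)
      moreover have "norm x \<le> norm (x + h n *\<^sub>R e) + norm (h n *\<^sub>R e)" by (metis add_diff_cancel_right' norm_triangle_ineq4)
      moreover have "norm (h n *\<^sub>R e) \<le> 1" using h[of n] by (simp add: e_def)
      ultimately show False using False by simp
    qed
    ultimately have "q n x = 0" unfolding q_def using K(2) by simp
    then show ?thesis using B(1) by simp
  qed
  have "(\<lambda>n. \<integral>x. q n x \<partial>lborel) \<longlonglongrightarrow> (\<integral>x. partial i F x \<partial>lborel)"
  proof (rule integral_dominated_convergence)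
    show "integrable lborel (\<lambda>x. B * indicator (cball 0 (R + 1)) x)"
      by (intro integrable_mult_right integrable_real_indicator) (use emeasure_lborel_cball_finite[of 0 "R + 1"] in \<open>auto simp: less_top\<close>)
    show "AE x in lborel. (\<lambda>n. q n x) \<longlonglongrightarrow> partial i F x"
    proof (rule AE_I2)
      fix x
      have "(\<lambda>t. (F (x + t *\<^sub>R e) - F x) / t) \<midarrow>0\<rightarrow> partial i F x"
        using has_real_derivative_along_axis[OF sm, of x i 0] unfolding has_field_derivative_def e_def DERIV_def[symmetric]
        by (simp add: has_field_derivative_def[symmetric] DERIV_def)
      moreover have "filterlim h (at 0) sequentially"
        unfolding filterlim_at using h(1) LIMSEQ_inverse_real_of_nat by (auto simp: h_def[abs_def])
      ultimately show "(\<lambda>n. q n x) \<longlonglongrightarrow> partial i F x" unfolding q_def by (rule filterlim_compose)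
    qed
    show "q n \<in> borel_measurable lborel" for n unfolding q_def using bm by simp
  qed (use bm bound in auto)
  then show ?thesis unfolding q0 using LIMSEQ_unique tendsto_const by blast
qed

lemma integral_by_parts_partial:
  fixes f g :: "real ^ 'n::finite \<Rightarrow> real"
  assumes f: "f \<in> test_functions UNIV" and g: "g \<in> test_functions UNIV"
  shows "(\<integral>x. f x * partial i g x \<partial>lborel) = - (\<integral>x. partial i f x * g x \<partial>lborel)"
proof -
  have sm: "smooth f" "smooth g" using f g by (auto intro: test_functions_smooth)
  have "(\<integral>x. partial i f x * g x + f x * partial i g x \<partial>lborel) = 0"
    using integral_partial_eq_0[OF test_functions_mult[OF f sm(2)]] by (simp add: partial_mult sm plus_fun_def)
  moreover have "integrable lborel (\<lambda>x. partial i f x * g x)" "integrable lborel (\<lambda>x. f x * partial i g x)"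
    using f g sm by (auto intro!: test_functions_integrable test_functions_mult test_functions_partial smooth_partial)
  ultimately show ?thesis by simp
qed

text \<open>
  The mean value theorem, applied first in direction \<open>i\<close> to the difference in direction \<open>j\<close>.
\<close>

lemma second_difference:
  fixes F :: "real ^ 'n::finite \<Rightarrow> real"
  assumes F: "smooth F" and h: "h > 0"
  obtains s t where "0 < s" "s < h" "0 < t" "t < h"
    "F (x + h *\<^sub>R axis i 1 + h *\<^sub>R axis j 1) - F (x + h *\<^sub>R axis i 1) - F (x + h *\<^sub>R axis j 1) + F x
      = h\<^sup>2 * partial j (partial i F) (x + t *\<^sub>R axis i 1 + s *\<^sub>R axis j 1)"
proof -
  define G where "G = (\<lambda>y. F (y + h *\<^sub>R axis j 1) - F y)"
  have "((\<lambda>t. G (x + t *\<^sub>R axis i 1)) has_real_derivative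
      partial i F (x + t *\<^sub>R axis i 1 + h *\<^sub>R axis j 1) - partial i F (x + t *\<^sub>R axis i 1)) (at t)" for t
    unfolding G_def using has_real_derivative_along_axis[OF F, of "x + h *\<^sub>R axis j 1" i t]
    by (intro DERIV_diff has_real_derivative_along_axis F) (simp add: algebra_simps)
  with MVT2[OF h, of "\<lambda>t. G (x + t *\<^sub>R axis i 1)"] obtain t where t: "0 < t" "t < h"
    "G (x + h *\<^sub>R axis i 1) - G x = h * (partial i F (x + t *\<^sub>R axis i 1 + h *\<^sub>R axis j 1) - partial i F (x + t *\<^sub>R axis i 1))"
    by force
  obtain s where "0 < s" "s < h" "partial i F (x + t *\<^sub>R axis i 1 + h *\<^sub>R axis j 1) - partial i F (x + t *\<^sub>R axis i 1)
      = h * partial j (partial i F) (x + t *\<^sub>R axis i 1 + s *\<^sub>R axis j 1)"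
    using mean_value_along_axis[OF smooth_partial[OF F] h] by blast
  with t that show ?thesis unfolding G_def by (simp add: power2_eq_square algebra_simps)
qed

text \<open>
  Schwarz's theorem. The second difference is symmetric in \<open>i\<close> and \<open>j\<close>, and up to the factor \<open>h\<^sup>2\<close> it is
  the mixed derivative in either order at a point close to \<open>x\<close>.
\<close>

lemma partial_commute:
  fixes F :: "real ^ 'n::finite \<Rightarrow> real"
  assumes F: "smooth F"
  shows "partial i (partial j F) = partial j (partial i F)"
proof
  fix x
  define h where "h n = inverse (real (Suc n))" for n
  have h: "h n > 0" for n by (simp add: h_def)
  define \<Delta> where "\<Delta> k l n = F (x + h n *\<^sub>R axis k 1 + h n *\<^sub>R axis l 1) - F (x + h n *\<^sub>R axis k 1) - F (x + h n *\<^sub>R axis l 1) + F x"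
    for k l n
  have "\<exists>y. y \<longlonglongrightarrow> x \<and> (\<forall>n. \<Delta> k l n = (h n)\<^sup>2 * partial l (partial k F) (y n))" for k l
  proof -
    have "\<exists>z. norm (z - x) \<le> 2 * h n \<and> \<Delta> k l n = (h n)\<^sup>2 * partial l (partial k F) z" for n
    proof -
      obtain s t where st: "0 < s" "s < h n" "0 < t" "t < h n"
        "\<Delta> k l n = (h n)\<^sup>2 * partial l (partial k F) (x + t *\<^sub>R axis k 1 + s *\<^sub>R axis l 1)"
        unfolding \<Delta>_def by (rule second_difference[OF F h])
      have "norm (t *\<^sub>R axis k 1 + s *\<^sub>R axis l 1 :: real ^ 'n) \<le> t + s"
        using norm_triangle_ineq[of "t *\<^sub>R axis k 1" "s *\<^sub>R axis l 1 :: real ^ 'n"] st by simp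
      then have "norm (x + t *\<^sub>R axis k 1 + s *\<^sub>R axis l 1 - x) \<le> 2 * h n" using st by (simp add: algebra_simps)
      then show ?thesis using st(5) by blast
    qed
    then obtain y where y: "\<And>n. norm (y n - x) \<le> 2 * h n" "\<And>n. \<Delta> k l n = (h n)\<^sup>2 * partial l (partial k F) (y n)" by metis
    have "(\<lambda>n. 2 * h n) \<longlonglongrightarrow> 0" using tendsto_mult_left[OF LIMSEQ_inverse_real_of_nat, of 2] by (simp add: h_def)
    then have "(\<lambda>n. y n - x) \<longlonglongrightarrow> 0" by (rule Lim_null_comparison[OF always_eventually, rotated]) (use y(1) in blast)
    then show ?thesis using y(2) LIM_zero_cancel by blast
  qed
  then obtain y z where y: "y \<longlonglongrightarrow> x" "\<And>n. \<Delta> i j n = (h n)\<^sup>2 * partial j (partial i F) (y n)"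
    and z: "z \<longlonglongrightarrow> x" "\<And>n. \<Delta> j i n = (h n)\<^sup>2 * partial i (partial j F) (z n)" by metis
  have "\<Delta> i j n = \<Delta> j i n" for n by (simp add: \<Delta>_def add_ac)
  then have eq: "partial j (partial i F) (y n) = partial i (partial j F) (z n)" for n using y(2)[of n] z(2)[of n] h[of n] by simp
  have cont: "isCont (partial l (partial k F)) x" for k l
    using smooth_continuous_on[OF smooth_partial[OF smooth_partial[OF F]], of UNIV] by (simp add: continuous_on_eq_continuous_at)
  show "partial i (partial j F) x = partial j (partial i F) x"
    using LIMSEQ_unique[OF isCont_tendsto_compose[OF cont y(1), of j i] isCont_tendsto_compose[OF cont z(1), of i j, folded eq]] by simp
qed

lemma foldr_partial_snoc:
  fixes F :: "real ^ 'n::finite \<Rightarrow> real"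
  assumes "smooth F" shows "foldr partial (is @ [i]) F = partial i (foldr partial is F)"
  by (induction "is") (use assms in \<open>auto simp: partial_commute smooth_foldr_partial\<close>)

text \<open>
  Integration by parts moves iterated derivatives to the other factor in reverse order, whereas weak
  derivatives are defined with the same order on both sides.
\<close>

lemma foldr_partial_rev:
  fixes F :: "real ^ 'n::finite \<Rightarrow> real"
  shows "smooth F \<Longrightarrow> foldr partial (rev is) F = foldr partial is F"
proof (induction "is" arbitrary: F)
  case (Cons i "is")
  have "foldr partial (rev (i # is)) F = foldr partial is (partial i F)"
    using Cons.IH[OF smooth_partial[OF Cons.prems]] by simp
  also have "\<dots> = foldr partial (i # is) F" using foldr_partial_snoc[OF Cons.prems, of "is" i] by simp
  finally show ?case .
qed simp

lemma multi_index_list_exists: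
  fixes \<alpha> :: "'n::finite multi_index"
  shows "\<exists>is. \<forall>i. count_list is i = \<alpha> $ i"
proof -
  have "\<exists>is. \<forall>i. count_list is i = (if i \<in> A then \<alpha> $ i else 0)" if "finite A" for A
    using that
  proof induction
    case (insert a A)
    then obtain "is" where is': "\<forall>i. count_list is i = (if i \<in> A then \<alpha> $ i else 0)" by blast
    have "count_list (replicate n a) i = (if i = a then n else 0)" for n i by (induction n) auto
    with is' insert have "\<forall>i. count_list (replicate (\<alpha> $ a) a @ is) i = (if i \<in> insert a A then \<alpha> $ i else 0)" by auto
    then show ?case by blast
  qed (auto intro: exI[of _ "[]"])
  from this[of UNIV] show ?thesis by simp
qed

text \<open>
  The properties of the list of directions that \<open>pderiv_mi\<close> chooses. The same list serves all functions,
  which is why the equation is one between operators.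
\<close>

lemma pderiv_mi_foldr:
  fixes \<alpha> :: "'n::finite multi_index"
  obtains "is" where "length is = mi_order \<alpha>" "\<And>i. count_list is i = \<alpha> $ i"
    "pderiv_mi \<alpha> = (foldr partial is :: _ \<Rightarrow> real ^ 'n \<Rightarrow> 'b::real_normed_vector)"
proof -
  define "is" where "is = (SOME is. \<forall>i. count_list is i = \<alpha> $ i)"
  have c: "\<forall>i. count_list is i = \<alpha> $ i" unfolding is_def by (rule someI_ex[OF multi_index_list_exists])
  have "length is = (\<Sum>i\<in>set is. count_list is i)" by (simp add: sum_count_set)
  also have "\<dots> = (\<Sum>i\<in>UNIV. count_list is i)" by (rule sum.mono_neutral_left) auto
  finally have "length is = mi_order \<alpha>" using c by (simp add: mi_order_def)
  with c that show ?thesis unfolding pderiv_mi_def is_def by (metis (no_types, lifting) ext)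
qed

lemma pderiv_mi_0: "pderiv_mi 0 f = f"
proof (rule pderiv_mi_foldr[of 0])
  fix "is" :: "'a list"
  assume "length is = mi_order (0 :: 'a multi_index)" "pderiv_mi 0 = (foldr partial is :: _ \<Rightarrow> real ^ 'a \<Rightarrow> 'b)"
  then show ?thesis by (simp add: mi_order_def)
qed

lemma integral_by_parts_foldr:
  fixes f g :: "real ^ 'n::finite \<Rightarrow> real"
  shows "f \<in> test_functions UNIV \<Longrightarrow> g \<in> test_functions UNIV \<Longrightarrow>
    (\<integral>x. f x * foldr partial is g x \<partial>lborel) = (-1) ^ length is * (\<integral>x. foldr partial (rev is) f x * g x \<partial>lborel)"
proof (induction "is" arbitrary: f)
  case (Cons i "is")
  then show ?case
    using integral_by_parts_partial[OF Cons.prems(1) test_functions_foldr_partial[OF Cons.prems(2)], of i "is"]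
      Cons.IH[OF test_functions_partial[OF Cons.prems(1)] Cons.prems(2)] by simp
qed simp

lemma integral_by_parts_pderiv_mi:
  fixes f g :: "real ^ 'n::finite \<Rightarrow> real"
  assumes "f \<in> test_functions UNIV" "g \<in> test_functions UNIV"
  shows "(\<integral>x. f x * pderiv_mi \<alpha> g x \<partial>lborel) = (-1) ^ mi_order \<alpha> * (\<integral>x. pderiv_mi \<alpha> f x * g x \<partial>lborel)"
proof -
  obtain "is" where "length is = mi_order \<alpha>" "pderiv_mi \<alpha> = (foldr partial is :: _ \<Rightarrow> real ^ 'n \<Rightarrow> real)"
    by (rule pderiv_mi_foldr)
  then show ?thesis using integral_by_parts_foldr[OF assms, of "is"] test_functions_smooth[OF assms(1)]
    by (simp add: foldr_partial_rev)
qed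

section \<open>Bump functions\<close>

text \<open>
  The functions \<open>P(1/t) exp(-1/t)\<close>, extended by zero to \<open>t \<le> 0\<close>, form a class that is closed under
  differentiation; the polynomial of the derivative is \<open>poly_exp_inv_deriv P\<close>. In particular
  \<open>exp(-1/t)\<close> is smooth.
\<close>

definition poly_exp_inv :: "real poly \<Rightarrow> real \<Rightarrow> real" where
  "poly_exp_inv P t = (if t > 0 then poly P (1 / t) * exp (- 1 / t) else 0)"

lemma poly_times_exp_tendsto_0: "((\<lambda>x::real. poly P x * exp (- x)) \<longlongrightarrow> 0) at_top"
proof -
  have "((\<lambda>x::real. \<Sum>i\<le>degree P. coeff P i * (x ^ i / exp x)) \<longlongrightarrow> (\<Sum>i\<le>degree P. coeff P i * 0)) at_top"
    by (intro tendsto_intros tendsto_power_div_exp_0)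
  then show ?thesis by (simp add: poly_altdef exp_minus divide_inverse sum_distrib_right mult.assoc)
qed

lemma poly_exp_inv_tendsto_0: "(poly_exp_inv P \<longlongrightarrow> 0) (at 0)"
proof -
  have "((\<lambda>t. poly P (1 / t) * exp (- (1 / t))) \<longlongrightarrow> 0) (at_right 0)"
    by (rule filterlim_compose[OF poly_times_exp_tendsto_0]) (simp add: filterlim_inverse_at_top_right divide_inverse[of 1, simplified])
  then have "(poly_exp_inv P \<longlongrightarrow> 0) (at_right 0)"
    by (rule Lim_transform_eventually) (auto simp: poly_exp_inv_def eventually_at_filter)
  moreover have "(poly_exp_inv P \<longlongrightarrow> 0) (at_left 0)"
    by (rule Lim_transform_eventually[OF tendsto_const]) (auto simp: poly_exp_inv_def eventually_at_filter)
  ultimately show ?thesis using filterlim_split_at by blast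
qed

definition poly_exp_inv_deriv :: "real poly \<Rightarrow> real poly" where
  "poly_exp_inv_deriv P = [:0, 0, 1:] * (P - pderiv P)"

lemma poly_exp_inv_has_derivative:
  "(poly_exp_inv P has_real_derivative poly_exp_inv (poly_exp_inv_deriv P) t) (at t)"
proof -
  consider "t > 0" | "t < 0" | "t = 0" by linarith
  then show ?thesis
  proof cases
    case 1
    have "((\<lambda>t. poly P (1 / t) * exp (- 1 / t)) has_real_derivative poly_exp_inv (poly_exp_inv_deriv P) t) (at t)"
      using 1 by (auto intro!: derivative_eq_intros simp: poly_exp_inv_def poly_exp_inv_deriv_def divide_simps)
         (auto simp: algebra_simps)
    then show ?thesis
      by (rule has_field_derivative_transform_within[where d=t]) (use 1 in \<open>auto simp: poly_exp_inv_def dist_real_def\<close>)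
  next
    case 2
    have "((\<lambda>t. 0) has_real_derivative poly_exp_inv (poly_exp_inv_deriv P) t) (at t)"
      using 2 by (simp add: poly_exp_inv_def)
    then show ?thesis
      by (rule has_field_derivative_transform_within[where d="- t"]) (use 2 in \<open>auto simp: poly_exp_inv_def dist_real_def\<close>)
  next
    case 3
    have "((\<lambda>h. (poly_exp_inv P (0 + h) - poly_exp_inv P 0) / h) \<longlongrightarrow> 0) (at 0)"
      by (rule Lim_transform_eventually[OF poly_exp_inv_tendsto_0[of "[:0, 1:] * P"]])
         (auto simp: poly_exp_inv_def eventually_at_filter)
    then show ?thesis using 3 by (simp add: DERIV_def poly_exp_inv_def)
  qed
qed

lemma poly_exp_inv_smult: "poly_exp_inv (smult c P) t = c * poly_exp_inv P t"
  by (simp add: poly_exp_inv_def)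

lemma poly_exp_inv_affine_has_derivative:
  "((\<lambda>x :: real ^ 'n::finite. poly_exp_inv P (c * x $ j + d)) has_derivative
     (\<lambda>v. poly_exp_inv (poly_exp_inv_deriv P) (c * x $ j + d) * (c * v $ j))) (at x)"
proof -
  have l: "((\<lambda>x :: real ^ 'n. c * x $ j + d) has_derivative (\<lambda>v. c * v $ j)) (at x)"
    by (auto intro!: derivative_eq_intros bounded_linear_imp_has_derivative bounded_linear_vec_nth)
  show ?thesis
    by (rule has_derivative_compose[OF l, of "poly_exp_inv P" "\<lambda>y. poly_exp_inv (poly_exp_inv_deriv P) (c * x $ j + d) * y"])
       (use poly_exp_inv_has_derivative in \<open>auto simp: has_field_derivative_def\<close>)
qed

lemma smooth_poly_exp_inv_affine: "smooth (\<lambda>x :: real ^ 'n::finite. poly_exp_inv P (c * x $ j + d))"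
proof (rule smooth_coinduct[where S="range (\<lambda>P (x :: real ^ 'n). poly_exp_inv P (c * x $ j + d))"])
  fix g i x assume "g \<in> range (\<lambda>P (x :: real ^ 'n). poly_exp_inv P (c * x $ j + d))"
  then obtain P where g: "g = (\<lambda>x. poly_exp_inv P (c * x $ j + d))" by blast
  show "g differentiable at x" unfolding g differentiable_def using poly_exp_inv_affine_has_derivative by blast
  have "partial i g = (\<lambda>x. poly_exp_inv (smult (c * axis i 1 $ j) (poly_exp_inv_deriv P)) (c * x $ j + d))"
    unfolding g by (rule ext, subst partial_eqI[OF poly_exp_inv_affine_has_derivative]) (simp add: poly_exp_inv_smult)
  then show "partial i g \<in> range (\<lambda>P (x :: real ^ 'n). poly_exp_inv P (c * x $ j + d))" by blast
qed auto

text \<open>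
  For \<open>t > 0\<close> the numbers \<open>exp(-1/(n t))\<close> increase to 1. The product of these functions of the distances of
  \<open>x\<close> from the faces of the box is smooth, vanishes outside of the box and tends to 1 inside.
\<close>

lemma box_indicator_approx:
  fixes a b :: "real ^ 'n::finite"
  obtains \<phi> :: "nat \<Rightarrow> real ^ 'n \<Rightarrow> real" where
    "\<And>n U. cbox a b \<subseteq> U \<Longrightarrow> \<phi> n \<in> test_functions U" "\<And>n x. 0 \<le> \<phi> n x" "\<And>n x. \<phi> n x \<le> 1"
    "\<And>x. (\<lambda>n. \<phi> n x) \<longlonglongrightarrow> indicator (box a b) x"
proof -
  let ?e = "poly_exp_inv 1"
  define \<phi> where "\<phi> n x = (\<Prod>j\<in>UNIV. ?e (real (Suc n) * x $ j + - real (Suc n) * a $ j) * ?e (- real (Suc n) * x $ j + real (Suc n) * b $ j))" for n x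
  have e: "0 \<le> ?e t" "?e t \<le> 1" for t by (auto simp: poly_exp_inv_def)
  have sm: "smooth (\<phi> n)" for n
    unfolding \<phi>_def by (intro smooth_prod smooth_mult smooth_poly_exp_inv_affine) auto
  have out: "\<phi> n x = 0" if x: "x \<notin> box a b" for n x
  proof -
    obtain j where "\<not> (a $ j < x $ j \<and> x $ j < b $ j)" using x by (auto simp: mem_box_cart)
    then have "real (Suc n) * x $ j + - real (Suc n) * a $ j \<le> 0 \<or> - real (Suc n) * x $ j + real (Suc n) * b $ j \<le> 0"
      by (auto simp: not_less simp del: of_nat_Suc)
    then have "?e (real (Suc n) * x $ j + - real (Suc n) * a $ j) * ?e (- real (Suc n) * x $ j + real (Suc n) * b $ j) = 0"
      by (auto simp: poly_exp_inv_def)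
    then show ?thesis unfolding \<phi>_def by (meson UNIV_I finite prod_zero)
  qed
  have lim: "(\<lambda>n. ?e (real (Suc n) * t)) \<longlonglongrightarrow> 1" if "t > 0" for t
  proof -
    have "(\<lambda>n. exp (- (1 / t) * inverse (real (Suc n)))) \<longlonglongrightarrow> exp (- (1 / t) * 0)"
      by (intro tendsto_intros LIMSEQ_inverse_real_of_nat)
    moreover have "exp (- (1 / t) * inverse (real (Suc n))) = ?e (real (Suc n) * t)" for n
      using that by (simp add: poly_exp_inv_def divide_simps add_pos_nonneg)
    ultimately show ?thesis by simp
  qed
  show ?thesis
  proof (rule that)
    show "\<phi> n \<in> test_functions U" if "cbox a b \<subseteq> U" for n U
      by (rule test_functionsI[OF sm compact_cbox that]) (use out box_subset_cbox in blast)
    show "0 \<le> \<phi> n x" "\<phi> n x \<le> 1" for n x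
      unfolding \<phi>_def using e by (auto intro!: prod_nonneg prod_le_1 mult_nonneg_nonneg mult_le_one)
    show "(\<lambda>n. \<phi> n x) \<longlonglongrightarrow> indicator (box a b) x" for x
    proof (cases "x \<in> box a b")
      case True
      have "(\<lambda>n. \<Prod>j\<in>UNIV. ?e (real (Suc n) * (x $ j - a $ j)) * ?e (real (Suc n) * (b $ j - x $ j))) \<longlonglongrightarrow> (\<Prod>j\<in>(UNIV::'n set). 1 * 1)"
        using True by (intro tendsto_intros lim) (auto simp: mem_box_cart)
      then show ?thesis using True by (simp add: \<phi>_def algebra_simps)
    qed (simp add: out)
  qed
qed

section \<open>Convexity and smoothness of powers of the absolute value\<close>

lemma convex_on_powr: assumes "p \<ge> 1" shows "convex_on {0..} (\<lambda>x::real. x powr p)"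
proof (rule convex_onI)
  fix t x y :: real assume t: "0 < t" "t < 1" and xy: "x \<in> {0..}" "y \<in> {0..}"
  have z: "(c * z) powr p \<le> c * z powr p" if "0 < c" "c < 1" "z \<ge> 0" for c z :: real
  proof -
    have "c powr p \<le> c powr 1" using that assms by (intro powr_mono') auto
    then show ?thesis using that by (simp add: powr_mult mult_right_mono)
  qed
  consider "x = 0" | "y = 0" | "x > 0" "y > 0" using xy by fastforce
  then show "((1 - t) *\<^sub>R x + t *\<^sub>R y) powr p \<le> (1 - t) * x powr p + t * y powr p"
  proof cases
    case 3
    then show ?thesis using convex_onD[OF powr_convex[OF assms], of t x y] t by simp
  qed (use z[of t y] z[of "1 - t" x] t xy in auto)
qed simp

lemma abs_powr_convex:
  fixes a b c d :: real
  assumes "p \<ge> 1" "c \<ge> 0" "d \<ge> 0" "c + d = 1"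
  shows "\<bar>c * a + d * b\<bar> powr p \<le> c * \<bar>a\<bar> powr p + d * \<bar>b\<bar> powr p"
proof -
  have "\<bar>c * a + d * b\<bar> powr p \<le> (c * \<bar>a\<bar> + d * \<bar>b\<bar>) powr p"
    using assms abs_triangle_ineq[of "c * a" "d * b"] by (intro powr_mono2) (auto simp: abs_mult)
  also have "\<dots> \<le> c * \<bar>a\<bar> powr p + d * \<bar>b\<bar> powr p"
  proof -
    have c: "c = 1 - d" using assms by simp
    show ?thesis
      using convex_onD[OF convex_on_powr[OF assms(1)], of d "\<bar>a\<bar>" "\<bar>b\<bar>"] assms(2,3) unfolding c by simp
  qed
  finally show ?thesis .
qed

text \<open>
  The derivative of \<open>x powr p\<close> is strictly increasing, so the increment over the right half of the
  interval exceeds the one over the left half. The derivative is needed in the interior only, which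
  admits \<open>x = 0\<close>.
\<close>

lemma powr_midpoint_strict:
  fixes x y :: real assumes "p > 1" "0 \<le> x" "x < y"
  shows "((x + y) / 2) powr p < (x powr p + y powr p) / 2"
proof -
  let ?m = "(x + y) / 2"
  have mvt: "\<exists>z. u < z \<and> z < v \<and> v powr p - u powr p = (v - u) * (p * z powr (p - 1))" if "0 \<le> u" "u < v" for u v :: real
  proof -
    have der: "((\<lambda>x. x powr p) has_real_derivative p * z powr (p - 1)) (at z)" if "z > 0" for z :: real
      using that by (auto intro!: derivative_eq_intros)
    have "continuous_on {u..v} (\<lambda>x. x powr p)"
      using that assms by (intro continuous_on_powr' continuous_intros) auto
    moreover have "(\<lambda>x. x powr p) differentiable (at z)" if "u < z" for z :: real
      unfolding real_differentiable_def by (rule exI, rule der) (use that \<open>0 \<le> u\<close> in simp)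
    ultimately obtain l z where z: "u < z" "z < v" "((\<lambda>x. x powr p) has_real_derivative l) (at z)"
      "v powr p - u powr p = (v - u) * l"
      using MVT[OF \<open>u < v\<close>, of "\<lambda>x. x powr p"] by blast
    then have "l = p * z powr (p - 1)" using DERIV_unique[OF z(3) der] that by auto
    then show ?thesis using z by blast
  qed
  obtain z where z: "x < z" "z < ?m" "?m powr p - x powr p = (?m - x) * (p * z powr (p - 1))"
    using mvt[of x ?m] assms by auto
  obtain w where w: "?m < w" "w < y" "y powr p - ?m powr p = (y - ?m) * (p * w powr (p - 1))"
    using mvt[of ?m y] assms by auto
  have "z powr (p - 1) < w powr (p - 1)" using z w assms by (intro powr_less_mono2) auto
  then have "(y - x) / 2 * (p * z powr (p - 1)) < (y - x) / 2 * (p * w powr (p - 1))"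
    using assms by (intro mult_strict_left_mono) auto
  moreover have eqs: "?m - x = (y - x) / 2" "y - ?m = (y - x) / 2" by (simp_all add: field_simps)
  ultimately have "?m powr p - x powr p < y powr p - ?m powr p" unfolding z(3) w(3) eqs by simp
  then show ?thesis by simp
qed

lemma abs_powr_midpoint_strict:
  fixes a b :: real assumes "p > 1" "a \<noteq> b"
  shows "\<bar>(a + b) / 2\<bar> powr p < (\<bar>a\<bar> powr p + \<bar>b\<bar> powr p) / 2"
proof (cases "\<bar>a\<bar> = \<bar>b\<bar>")
  case True
  then have "b = - a" "a \<noteq> 0" using assms(2) by auto
  then show ?thesis by simp
next
  case False
  have "\<bar>(a + b) / 2\<bar> powr p \<le> ((\<bar>a\<bar> + \<bar>b\<bar>) / 2) powr p"
    using assms by (intro powr_mono2) auto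
  also have "\<dots> < (\<bar>a\<bar> powr p + \<bar>b\<bar> powr p) / 2"
    using powr_midpoint_strict[OF assms(1), of "\<bar>a\<bar>" "\<bar>b\<bar>"] powr_midpoint_strict[OF assms(1), of "\<bar>b\<bar>" "\<bar>a\<bar>"] False
    by (cases "\<bar>a\<bar> < \<bar>b\<bar>") (auto simp: add.commute)
  finally show ?thesis .
qed

text \<open>
  All inequalities below compare sums of terms \<open>c * \<bar>a * x + b * y\<bar> powr p\<close>, encoded by lists of triples
  \<open>(c, a, b)\<close>. Such sums are homogeneous in \<open>(x, y)\<close>, so it suffices to consider pairs whose larger entry
  has modulus 1. The same encoding serves to integrate the inequalities.
\<close>

lemma abs_powr_inequality_by_scaling:
  fixes L :: "(real \<times> real \<times> real) list" and x y :: real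
  assumes "\<And>x y. \<bar>x\<bar> \<le> 1 \<Longrightarrow> \<bar>y\<bar> \<le> 1 \<Longrightarrow> \<bar>x\<bar> = 1 \<or> \<bar>y\<bar> = 1 \<Longrightarrow>
    0 \<le> (\<Sum>(c, a, b)\<leftarrow>L. c * \<bar>a * x + b * y\<bar> powr p)"
  shows "0 \<le> (\<Sum>(c, a, b)\<leftarrow>L. c * \<bar>a * x + b * y\<bar> powr p)"
proof (cases "x = 0 \<and> y = 0")
  case True
  then have "(\<Sum>(c, a, b)\<leftarrow>L. c * \<bar>a * x + b * y\<bar> powr p) = 0" by (induction L) auto
  then show ?thesis by simp
next
  case False
  define r where "r = max \<bar>x\<bar> \<bar>y\<bar>"
  have r: "r > 0" using False by (auto simp: r_def)
  have "\<bar>a * x + b * y\<bar> = r * \<bar>a * (x / r) + b * (y / r)\<bar>" for a b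
  proof -
    have "a * x + b * y = r * (a * (x / r) + b * (y / r))" using r by (simp add: distrib_left)
    then show ?thesis using r by (simp only: abs_mult)
  qed
  then have "(\<Sum>(c, a, b)\<leftarrow>L. c * \<bar>a * x + b * y\<bar> powr p) =
      r powr p * (\<Sum>(c, a, b)\<leftarrow>L. c * \<bar>a * (x / r) + b * (y / r)\<bar> powr p)"
    using r by (induction L) (auto simp: powr_mult distrib_left mult.left_commute)
  also have "0 \<le> \<dots>"
    by (intro mult_nonneg_nonneg assms) (use r in \<open>auto simp: r_def max_def divide_simps split: if_splits\<close>)
  finally show ?thesis .
qed

lemma continuous_on_abs_powr: "p > 0 \<Longrightarrow> continuous_on A f \<Longrightarrow> continuous_on A (\<lambda>x. \<bar>f x :: real\<bar> powr p)"
  by (intro continuous_on_powr' continuous_intros) auto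

text \<open>
  Among the normalised pairs, those with \<open>\<bar>a - b\<bar> powr p \<ge> e\<close> form a compact set on which the convexity gap
  is positive, hence bounded below; there the second term dominates. For the other pairs the first
  term does.
\<close>

lemma abs_powr_uniformly_convex:
  fixes p e :: real assumes p: "p > 1" and e: "e > 0"
  obtains C where "C \<ge> 0" "\<And>a b :: real. \<bar>a - b\<bar> powr p \<le> e * (\<bar>a\<bar> powr p + \<bar>b\<bar> powr p) +
     C * ((\<bar>a\<bar> powr p + \<bar>b\<bar> powr p) / 2 - \<bar>(a + b) / 2\<bar> powr p)"
proof -
  define g where "g = (\<lambda>(a, b). (\<bar>a :: real\<bar> powr p + \<bar>b\<bar> powr p) / 2 - \<bar>(a + b) / 2\<bar> powr p)"
  define S where "S = {-1..1} \<times> {-1..1} \<inter> {(a, b). \<bar>a - b :: real\<bar> powr p \<ge> e}"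
  have g0: "0 \<le> g (a, b)" for a b
    using abs_powr_midpoint_strict[OF p, of a b] by (cases "a = b") (auto simp: g_def abs_mult)
  have cont: "continuous_on UNIV g"
    unfolding g_def case_prod_unfold using p by (intro continuous_intros continuous_on_abs_powr) auto
  have "closed {x. e \<le> \<bar>fst x - snd x :: real\<bar> powr p}"
    using p by (intro closed_Collect_le continuous_on_abs_powr continuous_intros) auto
  then have comp: "compact S" unfolding S_def case_prod_unfold by (intro compact_Int_closed compact_Times compact_Icc)
  obtain c where c: "c > 0" "\<And>x. x \<in> S \<Longrightarrow> c \<le> g x"
  proof (cases "S = {}")
    case False
    then obtain x where x: "x \<in> S" "\<And>y. y \<in> S \<Longrightarrow> g x \<le> g y"
      using continuous_attains_inf[OF comp False continuous_on_subset[OF cont]] by auto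
    have "fst x \<noteq> snd x" using x(1) e by (auto simp: S_def)
    then have "g x > 0" using abs_powr_midpoint_strict[OF p, of "fst x" "snd x"] by (simp add: g_def case_prod_unfold)
    then show ?thesis using x that by blast
  qed (use that[of 1] in auto)
  \<comment> \<open>On the normalised pairs \<open>\<bar>x - y\<bar> powr p\<close> is at most \<open>2 powr p\<close>.\<close>
  define C where "C = 2 powr p / c"
  have C: "C \<ge> 0" using c(1) by (simp add: C_def)
  have normalised: "\<bar>x - y\<bar> powr p \<le> e * (\<bar>x\<bar> powr p + \<bar>y\<bar> powr p) + C * g (x, y)"
    if xy: "\<bar>x\<bar> \<le> 1" "\<bar>y\<bar> \<le> 1" "\<bar>x\<bar> = 1 \<or> \<bar>y\<bar> = 1" for x y
  proof (cases "e \<le> \<bar>x - y\<bar> powr p")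
    case True
    then have "c \<le> g (x, y)" using xy by (intro c) (auto simp: S_def)
    then have "2 powr p \<le> C * g (x, y)" using c(1) by (simp add: C_def field_simps)
    moreover have "\<bar>x - y\<bar> powr p \<le> 2 powr p" using xy p by (intro powr_mono2) auto
    moreover have "0 \<le> e * (\<bar>x\<bar> powr p + \<bar>y\<bar> powr p)" using e by simp
    ultimately show ?thesis by linarith
  next
    case False
    have "1 \<le> \<bar>x\<bar> powr p + \<bar>y\<bar> powr p" using xy(3) by auto
    then have "e * 1 \<le> e * (\<bar>x\<bar> powr p + \<bar>y\<bar> powr p)" using e by (intro mult_left_mono) auto
    then show ?thesis using False mult_nonneg_nonneg[OF C g0[of x y]] by linarith
  qed
  have ineq: "0 \<le> (\<Sum>(c, a, b)\<leftarrow>[(e + C / 2, 1, 0), (e + C / 2, 0, 1), (- C, 1/2, 1/2), (- 1, 1, - 1)].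
      c * \<bar>a * x + b * y\<bar> powr p)" for x y :: real
  proof (rule abs_powr_inequality_by_scaling)
    fix x y :: real assume xy: "\<bar>x\<bar> \<le> 1" "\<bar>y\<bar> \<le> 1" "\<bar>x\<bar> = 1 \<or> \<bar>y\<bar> = 1"
    have "\<bar>x / 2 + y / 2\<bar> = \<bar>(x + y) / 2\<bar>" by (simp add: add_divide_distrib)
    then show "0 \<le> (\<Sum>(c, a, b)\<leftarrow>[(e + C / 2, 1, 0), (e + C / 2, 0, 1), (- C, 1/2, 1/2), (- 1, 1, - 1)].
        c * \<bar>a * x + b * y\<bar> powr p)"
      using normalised[OF xy] by (simp add: g_def distrib_left distrib_right right_diff_distrib add_divide_distrib)
  qed
  show ?thesis
  proof (rule that[OF C])
    fix a b :: real
    have "\<bar>a / 2 + b / 2\<bar> = \<bar>(a + b) / 2\<bar>" by (simp add: add_divide_distrib)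
    then show "\<bar>a - b\<bar> powr p \<le> e * (\<bar>a\<bar> powr p + \<bar>b\<bar> powr p) +
        C * ((\<bar>a\<bar> powr p + \<bar>b\<bar> powr p) / 2 - \<bar>(a + b) / 2\<bar> powr p)"
      using ineq[of a b] by (simp add: distrib_left distrib_right right_diff_distrib add_divide_distrib)
  qed
qed

lemma abs_powr_has_derivative:
  fixes p x :: real assumes p: "p > 1"
  shows "((\<lambda>x. \<bar>x\<bar> powr p) has_real_derivative p * (sgn x * \<bar>x\<bar> powr (p - 1))) (at x)"
proof -
  consider "x > 0" | "x < 0" | "x = 0" by linarith
  then show ?thesis
  proof cases
    case 1
    then have "((\<lambda>x. x powr p) has_real_derivative p * (sgn x * \<bar>x\<bar> powr (p - 1))) (at x)"
      by (auto intro!: derivative_eq_intros)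
    then show ?thesis
      by (rule has_field_derivative_transform_within[where d=x]) (use 1 in \<open>auto simp: dist_real_def\<close>)
  next
    case 2
    then have "((\<lambda>x. (- x) powr p) has_real_derivative p * (sgn x * \<bar>x\<bar> powr (p - 1))) (at x)"
      by (auto intro!: derivative_eq_intros)
    then show ?thesis
      by (rule has_field_derivative_transform_within[where d="- x"]) (use 2 in \<open>auto simp: dist_real_def\<close>)
  next
    case 3
    have "((\<lambda>h. sgn h * \<bar>h\<bar> powr (p - 1)) \<longlongrightarrow> 0) (at 0)"
    proof (rule Lim_null_comparison[where g="\<lambda>h. \<bar>h\<bar> powr (p - 1)"])
      have "continuous_on UNIV (\<lambda>h::real. \<bar>h\<bar> powr (p - 1))" using p by (intro continuous_on_abs_powr continuous_intros) auto
      then show "((\<lambda>h::real. \<bar>h\<bar> powr (p - 1)) \<longlongrightarrow> 0) (at 0)"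
        using p by (simp add: continuous_on_def) (metis abs_zero powr_0)
    qed (auto simp: abs_mult sgn_if)
    then have "((\<lambda>h. (\<bar>0 + h\<bar> powr p - \<bar>0\<bar> powr p) / h) \<longlongrightarrow> 0) (at (0::real))"
    proof (rule Lim_transform_eventually)
      have "sgn h * \<bar>h\<bar> powr (p - 1) = \<bar>h\<bar> powr p / h" if "h \<noteq> 0" for h :: real
        using that by (simp add: powr_diff sgn_if field_simps)
      then show "\<forall>\<^sub>F h in at 0. sgn h * \<bar>h\<bar> powr (p - 1) = (\<bar>0 + h\<bar> powr p - \<bar>0\<bar> powr p) / h"
        using p by (auto simp: eventually_at_filter)
    qed
    then show ?thesis using 3 by (simp add: DERIV_def)
  qed
qed

lemma continuous_sgn_powr:
  fixes q :: real assumes "q > 0" shows "continuous_on UNIV (\<lambda>x::real. sgn x * \<bar>x\<bar> powr q)"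
proof -
  have "(\<lambda>x::real. sgn x * \<bar>x\<bar> powr q) = (\<lambda>x. max x 0 powr q - max (- x) 0 powr q)"
    using assms by (auto simp: fun_eq_iff sgn_if max_def)
  moreover have "continuous_on UNIV (\<lambda>x::real. max x 0 powr q - max (- x) 0 powr q)"
    using assms by (intro continuous_intros continuous_on_powr') auto
  ultimately show ?thesis by (simp only:)
qed

text \<open>
  The derivative of \<open>\<bar>x\<bar> powr p\<close> is uniformly continuous on \<open>{-2..2}\<close>. For normalised pairs the mean value
  theorem turns \<open>\<bar>a + t b\<bar> powr p + \<bar>a - t b\<bar> powr p - 2 \<bar>a\<bar> powr p\<close> into \<open>t b\<close> times a difference of two values of the
  derivative at points with distance at most \<open>2 t\<close>.
\<close>

lemma abs_powr_uniformly_smooth: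
  fixes p e :: real assumes p: "p > 1" and e: "e > 0"
  obtains t where "t > 0" "\<And>a b :: real. \<bar>a + t * b\<bar> powr p + \<bar>a - t * b\<bar> powr p \<le>
     2 * \<bar>a\<bar> powr p + e * t * (\<bar>a\<bar> powr p + \<bar>b\<bar> powr p)"
proof -
  define k where "k x = p * (sgn x * \<bar>x\<bar> powr (p - 1))" for x :: real
  have "continuous_on {-2..2} k"
    unfolding k_def using continuous_on_subset[OF continuous_sgn_powr[of "p - 1"]] p by (intro continuous_on_mult_left) auto
  then have "uniformly_continuous_on {-2..2} k" by (intro compact_uniformly_continuous) auto
  then obtain d where d: "d > 0" "\<And>x y. x \<in> {-2..2} \<Longrightarrow> y \<in> {-2..2} \<Longrightarrow> \<bar>y - x\<bar> < d \<Longrightarrow> \<bar>k y - k x\<bar> < e"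
    unfolding uniformly_continuous_on_def dist_real_def using e by metis
  define t where "t = min 1 (d / 2)"
  have t: "t > 0" "t \<le> 1" "2 * t \<le> d" using d(1) by (auto simp: t_def)
  have normalised: "\<bar>x + t * y\<bar> powr p + \<bar>x - t * y\<bar> powr p \<le> 2 * \<bar>x\<bar> powr p + e * t * (\<bar>x\<bar> powr p + \<bar>y\<bar> powr p)"
    if xy: "\<bar>x\<bar> \<le> 1" "\<bar>y\<bar> \<le> 1" "\<bar>x\<bar> = 1 \<or> \<bar>y\<bar> = 1" for x y
  proof -
    define \<phi> where "\<phi> s = \<bar>x + s * y\<bar> powr p + \<bar>x - s * y\<bar> powr p" for s
    have "(\<phi> has_real_derivative y * (k (x + s * y) - k (x - s * y))) (at s)" for s
      unfolding \<phi>_def k_def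
      by (rule derivative_eq_intros DERIV_chain2[OF abs_powr_has_derivative[OF p]] refl)+ (simp add: algebra_simps)
    with MVT2[OF t(1), of \<phi>] obtain s where s: "0 < s" "s < t" "\<phi> t - \<phi> 0 = t * (y * (k (x + s * y) - k (x - s * y)))"
      by force
    have "\<bar>s * y\<bar> \<le> s * 1" unfolding abs_mult using s xy by (intro mult_mono) auto
    then have sy: "\<bar>s * y\<bar> \<le> s" by simp
    have "\<bar>k (x + s * y) - k (x - s * y)\<bar> < e"
    proof (rule d(2))
      have "\<bar>s * y\<bar> \<le> 1" using sy s(2) t(2) by linarith
      then show "x - s * y \<in> {-2..2}" "x + s * y \<in> {-2..2}" using xy(1) by auto
      have "\<bar>x + s * y - (x - s * y)\<bar> = 2 * \<bar>s * y\<bar>" by (simp add: abs_mult)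
      then show "\<bar>x + s * y - (x - s * y)\<bar> < d" using sy s(2) t(3) by linarith
    qed
    then have "\<bar>y * (k (x + s * y) - k (x - s * y))\<bar> \<le> 1 * e" unfolding abs_mult using xy by (intro mult_mono) auto
    then have "\<phi> t - \<phi> 0 \<le> t * e" unfolding s(3) using t(1) by (intro mult_left_mono) auto
    moreover have "1 \<le> \<bar>x\<bar> powr p + \<bar>y\<bar> powr p" using xy(3) by auto
    then have "e * t * 1 \<le> e * t * (\<bar>x\<bar> powr p + \<bar>y\<bar> powr p)" using e t by (intro mult_left_mono) auto
    ultimately show ?thesis by (simp add: \<phi>_def mult.commute)
  qed
  have ineq: "0 \<le> (\<Sum>(c, a, b)\<leftarrow>[(2 + e * t, 1, 0), (e * t, 0, 1), (- 1, 1, t), (- 1, 1, - t)].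
      c * \<bar>a * x + b * y\<bar> powr p)" for x y :: real
  proof (rule abs_powr_inequality_by_scaling)
    fix x y :: real assume "\<bar>x\<bar> \<le> 1" "\<bar>y\<bar> \<le> 1" "\<bar>x\<bar> = 1 \<or> \<bar>y\<bar> = 1"
    from normalised[OF this]
    show "0 \<le> (\<Sum>(c, a, b)\<leftarrow>[(2 + e * t, 1, 0), (e * t, 0, 1), (- 1, 1, t), (- 1, 1, - t)]. c * \<bar>a * x + b * y\<bar> powr p)"
      by (simp add: distrib_left distrib_right)
  qed
  show ?thesis
  proof (rule that[OF t(1)])
    fix a b :: real
    show "\<bar>a + t * b\<bar> powr p + \<bar>a - t * b\<bar> powr p \<le> 2 * \<bar>a\<bar> powr p + e * t * (\<bar>a\<bar> powr p + \<bar>b\<bar> powr p)"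
      using ineq[of a b] by (simp add: distrib_left distrib_right)
  qed
qed

section \<open>Functions with integrable powers on finite measure spaces\<close>

lemma abs_le_powr:
  fixes x \<eta> :: real assumes "p > 1" "\<eta> > 0" shows "\<bar>x\<bar> \<le> \<eta> + \<eta> powr (1 - p) * \<bar>x\<bar> powr p"
proof (cases "\<bar>x\<bar> \<le> \<eta>")
  case False
  have "\<bar>x\<bar> = \<eta> powr (1 - p) * (\<bar>x\<bar> * \<eta> powr (p - 1))"
    using assms(2) by (simp add: powr_diff)
  also have "\<dots> \<le> \<eta> powr (1 - p) * (\<bar>x\<bar> * \<bar>x\<bar> powr (p - 1))"
    using False assms by (intro mult_left_mono powr_mono2) auto
  also have "\<bar>x\<bar> * \<bar>x\<bar> powr (p - 1) = \<bar>x\<bar> powr p"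
    using False assms by (simp add: powr_diff)
  finally show ?thesis using assms(2) by simp
qed (use assms in \<open>auto intro: add_increasing2\<close>)

definition p_integrable :: "'a measure \<Rightarrow> real \<Rightarrow> ('a \<Rightarrow> real) \<Rightarrow> bool" where
  "p_integrable M p f \<longleftrightarrow> f \<in> borel_measurable M \<and> integrable M (\<lambda>x. \<bar>f x\<bar> powr p)"

lemma p_integrable_lincomb:
  assumes p: "p \<ge> 1" and f: "p_integrable M p f" and g: "p_integrable M p g"
  shows "p_integrable M p (\<lambda>x. c * f x + d * g x)"
proof -
  have "integrable M (\<lambda>x. \<bar>2 * c\<bar> powr p * \<bar>f x\<bar> powr p + \<bar>2 * d\<bar> powr p * \<bar>g x\<bar> powr p)"
    using f g unfolding p_integrable_def by auto
  moreover have [measurable]: "f \<in> borel_measurable M" "g \<in> borel_measurable M" using f g unfolding p_integrable_def by auto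
  moreover have "\<bar>c * y + d * z\<bar> powr p \<le> \<bar>2 * c\<bar> powr p * \<bar>y\<bar> powr p + \<bar>2 * d\<bar> powr p * \<bar>z\<bar> powr p" for y z
  proof -
    have "\<bar>c * y + d * z\<bar> powr p = \<bar>1/2 * (2 * c * y) + 1/2 * (2 * d * z)\<bar> powr p" by simp
    also have "\<dots> \<le> 1/2 * \<bar>2 * c * y\<bar> powr p + 1/2 * \<bar>2 * d * z\<bar> powr p" by (rule abs_powr_convex) (use p in auto)
    also have "\<dots> \<le> \<bar>2 * c * y\<bar> powr p + \<bar>2 * d * z\<bar> powr p"
      using powr_ge_zero[of "\<bar>2 * c * y\<bar>" p] powr_ge_zero[of "\<bar>2 * d * z\<bar>" p] by linarith
    finally show ?thesis by (simp add: abs_mult powr_mult mult.assoc)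
  qed
  ultimately have "integrable M (\<lambda>x. \<bar>c * f x + d * g x\<bar> powr p)"
    by (elim Bochner_Integration.integrable_bound) (auto intro!: AE_I2)
  then show ?thesis unfolding p_integrable_def by simp
qed

context finite_measure begin

lemma p_integrable_imp_integrable:
  assumes p: "p > 1" and f: "p_integrable M p f" shows "integrable M f"
proof (rule Bochner_Integration.integrable_bound)
  show "integrable M (\<lambda>x. 1 + \<bar>f x\<bar> powr p)" using f by (simp add: p_integrable_def)
  show "AE x in M. norm (f x) \<le> norm (1 + \<bar>f x\<bar> powr p)"
    using abs_le_powr[OF p, of 1] by (auto intro!: AE_I2)
qed (use f in \<open>simp add: p_integrable_def\<close>)

text \<open>
  A form of Hoelder's inequality whose constant is not optimal. It results from integrating
  \<open>abs_le_powr\<close>, with \<open>\<eta>\<close> slightly larger than the \<open>L\<^sup>p\<close> norm \<open>N\<close>.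
\<close>

lemma L1_le_Lp:
  assumes p: "p > 1" and f: "p_integrable M p f"
  shows "(\<integral>x. \<bar>f x\<bar> \<partial>M) \<le> (measure M (space M) + 1) * (\<integral>x. \<bar>f x\<bar> powr p \<partial>M) powr (1 / p)"
proof -
  let ?m = "measure M (space M)"
  define N where "N = (\<integral>x. \<bar>f x\<bar> powr p \<partial>M) powr (1 / p)"
  have Np: "(\<integral>x. \<bar>f x\<bar> powr p \<partial>M) = N powr p" using p by (simp add: N_def powr_powr)
  have i: "integrable M (\<lambda>x. \<bar>f x\<bar> powr p)" using f by (simp add: p_integrable_def)
  have "(\<integral>x. \<bar>f x\<bar> \<partial>M) / (?m + 1) \<le> \<eta>" if \<eta>: "N < \<eta>" for \<eta>
  proof -
    have \<eta>0: "\<eta> > 0" using \<eta> by (simp add: N_def le_less_trans[OF powr_ge_zero])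
    have "(\<integral>x. \<bar>f x\<bar> \<partial>M) \<le> (\<integral>x. \<eta> + \<eta> powr (1 - p) * \<bar>f x\<bar> powr p \<partial>M)"
      using i p_integrable_imp_integrable[OF p f] abs_le_powr[OF p \<eta>0] by (intro integral_mono) auto
    also have "\<dots> = \<eta> * ?m + \<eta> powr (1 - p) * N powr p" using i Np by simp
    also have "\<dots> \<le> \<eta> * ?m + \<eta> powr (1 - p) * \<eta> powr p"
      using \<eta> p by (intro add_left_mono mult_left_mono powr_mono2) (auto simp: N_def)
    also have "\<dots> = (?m + 1) * \<eta>" using \<eta>0 by (simp add: algebra_simps flip: powr_add)
    finally show ?thesis by (simp add: divide_le_eq add_nonneg_pos mult.commute)
  qed
  then have "(\<integral>x. \<bar>f x\<bar> \<partial>M) / (?m + 1) \<le> N" by (rule dense_ge)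
  then show ?thesis by (simp add: N_def divide_le_eq add_nonneg_pos mult.commute)
qed

lemma L1_tendsto_0_of_Lp:
  assumes p: "p > 1" and f: "\<And>n. p_integrable M p (f n)" and lim: "((\<lambda>n. \<integral>x. \<bar>f n x\<bar> powr p \<partial>M) \<longlongrightarrow> 0) F"
  shows "((\<lambda>n. \<integral>x. \<bar>f n x\<bar> \<partial>M) \<longlongrightarrow> 0) F"
proof (rule Lim_null_comparison)
  have "((\<lambda>n. (\<integral>x. \<bar>f n x\<bar> powr p \<partial>M) powr (1 / p)) \<longlongrightarrow> 0) F"
    using p by (intro tendsto_zero_powrI[OF lim tendsto_const]) auto
  from tendsto_mult_left[OF this, of "measure M (space M) + 1"]
  show "((\<lambda>n. (measure M (space M) + 1) * (\<integral>x. \<bar>f n x\<bar> powr p \<partial>M) powr (1 / p)) \<longlongrightarrow> 0) F" by simp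
  show "\<forall>\<^sub>F n in F. norm (\<integral>x. \<bar>f n x\<bar> \<partial>M) \<le> (measure M (space M) + 1) * (\<integral>x. \<bar>f n x\<bar> powr p \<partial>M) powr (1 / p)"
    using L1_le_Lp[OF p f] by (intro always_eventually) simp
qed

text \<open>
  Since the measure is finite, the sequence is also Cauchy in \<open>L\<^sup>1\<close>, and a subsequence converges almost
  everywhere. By Fatou's lemma its limit is the limit in \<open>L\<^sup>p\<close>.
\<close>

lemma Lp_complete:
  assumes p: "p > 1" and f: "\<And>n. p_integrable M p (f n)"
    and cau: "\<And>e. e > 0 \<Longrightarrow> \<exists>K. \<forall>m\<ge>K. \<forall>n\<ge>K. (\<integral>x. \<bar>f m x - f n x\<bar> powr p \<partial>M) < e"
  obtains g where "p_integrable M p g" "(\<lambda>n. \<integral>x. \<bar>f n x - g x\<bar> powr p \<partial>M) \<longlonglongrightarrow> 0"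
proof -
  have diff: "p_integrable M p (\<lambda>x. u x - v x)" if "p_integrable M p u" "p_integrable M p v" for u v
    using p_integrable_lincomb[OF _ that, of 1 "-1"] p by simp
  have [measurable]: "f n \<in> borel_measurable M" for n using f by (simp add: p_integrable_def)
  have cau1: "\<exists>K. \<forall>m\<ge>K. \<forall>n\<ge>K. (\<integral>x. norm (f m x - f n x) \<partial>M) < e" if e: "e > 0" for e
  proof -
    define m where "m = measure M (space M) + 1"
    have m: "m > 0" by (simp add: m_def add_nonneg_pos)
    obtain K where K: "\<And>i j. i \<ge> K \<Longrightarrow> j \<ge> K \<Longrightarrow> (\<integral>x. \<bar>f i x - f j x\<bar> powr p \<partial>M) < (e / m) powr p"
      using cau[of "(e / m) powr p"] e m by auto
    have "(\<integral>x. norm (f i x - f j x) \<partial>M) < e" if "i \<ge> K" "j \<ge> K" for i j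
    proof -
      have "(\<integral>x. \<bar>f i x - f j x\<bar> powr p \<partial>M) powr (1 / p) < ((e / m) powr p) powr (1 / p)"
        using K[OF that] p by (intro powr_less_mono2) auto
      also have "\<dots> = e / m" using e m p by (simp add: powr_powr)
      finally have "m * (\<integral>x. \<bar>f i x - f j x\<bar> powr p \<partial>M) powr (1 / p) < e" using m by (simp add: field_simps)
      then show ?thesis using L1_le_Lp[OF p diff[OF f f], of i j] by (simp add: m_def)
    qed
    then show ?thesis by blast
  qed
  obtain r where r: "strict_mono r" "AE x in M. Cauchy (\<lambda>i. f (r i) x)"
    by (rule cauchy_L1_AE_cauchy_subseq[OF p_integrable_imp_integrable[OF p f] cau1])
  define g where "g x = lim (\<lambda>i. f (r i) x)" for x
  have [measurable]: "g \<in> borel_measurable M" unfolding g_def by (rule borel_measurable_lim_metric) simp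
  have lim: "AE x in M. (\<lambda>i. f (r i) x) \<longlonglongrightarrow> g x"
    using r(2) by eventually_elim (auto simp: g_def Cauchy_convergent_iff convergent_LIMSEQ_iff)
  have fatou: "p_integrable M p (\<lambda>x. f n x - g x) \<and> (\<integral>x. \<bar>f n x - g x\<bar> powr p \<partial>M) \<le> e"
    if K: "\<And>m. m \<ge> K \<Longrightarrow> (\<integral>x. \<bar>f n x - f m x\<bar> powr p \<partial>M) \<le> e" for n K e
  proof -
    have "0 \<le> (\<integral>x. \<bar>f n x - f K x\<bar> powr p \<partial>M)" by simp
    then have e0: "e \<ge> 0" using K[of K] by linarith
    have "(\<integral>\<^sup>+x. ennreal (\<bar>f n x - g x\<bar> powr p) \<partial>M) = (\<integral>\<^sup>+x. liminf (\<lambda>i. ennreal (\<bar>f n x - f (r i) x\<bar> powr p)) \<partial>M)"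
    proof (rule nn_integral_cong_AE)
      show "AE x in M. ennreal (\<bar>f n x - g x\<bar> powr p) = liminf (\<lambda>i. ennreal (\<bar>f n x - f (r i) x\<bar> powr p))"
        using lim
      proof eventually_elim
        case (elim x)
        have "continuous_on UNIV (\<lambda>y::real. \<bar>f n x - y\<bar> powr p)" using p by (intro continuous_on_abs_powr continuous_intros) auto
        then have "(\<lambda>i. \<bar>f n x - f (r i) x\<bar> powr p) \<longlonglongrightarrow> \<bar>f n x - g x\<bar> powr p"
          by (rule continuous_on_tendsto_compose[OF _ elim]) auto
        then have "(\<lambda>i. ennreal (\<bar>f n x - f (r i) x\<bar> powr p)) \<longlonglongrightarrow> ennreal (\<bar>f n x - g x\<bar> powr p)" by (rule tendsto_ennrealI)
        from lim_imp_Liminf[OF _ this] show ?case by simp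
      qed
    qed
    also have "\<dots> \<le> liminf (\<lambda>i. \<integral>\<^sup>+x. ennreal (\<bar>f n x - f (r i) x\<bar> powr p) \<partial>M)" by (rule nn_integral_liminf) simp
    also have "\<dots> \<le> liminf (\<lambda>i. ennreal e)"
    proof (rule Liminf_mono)
      show "\<forall>\<^sub>F i in sequentially. (\<integral>\<^sup>+x. ennreal (\<bar>f n x - f (r i) x\<bar> powr p) \<partial>M) \<le> ennreal e"
        using eventually_ge_at_top[of K]
      proof eventually_elim
        case (elim i)
        then have "r i \<ge> K" using seq_suble[OF r(1), of i] by simp
        moreover have "(\<integral>\<^sup>+x. ennreal (\<bar>f n x - f (r i) x\<bar> powr p) \<partial>M) = ennreal (\<integral>x. \<bar>f n x - f (r i) x\<bar> powr p \<partial>M)"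
          using diff[OF f f] by (intro nn_integral_eq_integral) (auto simp: p_integrable_def)
        ultimately show ?case using K by (simp add: ennreal_leI)
      qed
    qed
    also have "\<dots> = ennreal e" by (simp add: Liminf_const)
    finally have le: "(\<integral>\<^sup>+x. ennreal (\<bar>f n x - g x\<bar> powr p) \<partial>M) \<le> ennreal e" .
    then have "integrable M (\<lambda>x. \<bar>f n x - g x\<bar> powr p)"
      by (intro integrableI_bounded) (auto intro: le_less_trans)
    moreover from this have "(\<integral>x. \<bar>f n x - g x\<bar> powr p \<partial>M) \<le> e"
      using le e0 by (simp add: nn_integral_eq_integral)
    ultimately show ?thesis by (simp add: p_integrable_def)
  qed
  obtain K1 where "\<And>m n. m \<ge> K1 \<Longrightarrow> n \<ge> K1 \<Longrightarrow> (\<integral>x. \<bar>f m x - f n x\<bar> powr p \<partial>M) < 1" using cau[of 1] by auto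
  then have "p_integrable M p (\<lambda>x. f K1 x - g x)" using fatou[of K1 K1 1] by (meson le_refl less_imp_le)
  from diff[OF f[of K1] this] have "p_integrable M p g" by simp
  moreover have "(\<lambda>n. \<integral>x. \<bar>f n x - g x\<bar> powr p \<partial>M) \<longlonglongrightarrow> 0"
  proof (rule LIMSEQ_I)
    fix e :: real assume e: "e > 0"
    obtain K where K: "\<And>m n. m \<ge> K \<Longrightarrow> n \<ge> K \<Longrightarrow> (\<integral>x. \<bar>f m x - f n x\<bar> powr p \<partial>M) < e / 2" using cau[of "e/2"] e by auto
    have "norm ((\<integral>x. \<bar>f n x - g x\<bar> powr p \<partial>M) - 0) < e" if "n \<ge> K" for n
      using fatou[of K n "e/2"] K[OF that] e by (simp add: less_imp_le)
    then show "\<exists>K. \<forall>n\<ge>K. norm ((\<integral>x. \<bar>f n x - g x\<bar> powr p \<partial>M) - 0) < e" by blast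
  qed
  ultimately show ?thesis using that by blast
qed

end

section \<open>The fundamental lemma of the calculus of variations\<close>

lemma integrable_indicator_compact:
  assumes "locally_integrable D f" "compact K" "K \<subseteq> D"
  shows "integrable lebesgue (\<lambda>x. indicator K x * f x)"
proof -
  have "integrable (lebesgue_on K) f" using assms unfolding locally_integrable_def by blast
  then show ?thesis using assms(2) 
    by (subst (asm) integrable_restrict_space) (auto intro: fmeasurableD lmeasurable_compact)
qed

text \<open>
  An open set is a countable union of compact boxes, and \<open>f\<close> is the pointwise limit of its restrictions
  to finite unions of these.
\<close>

lemma locally_integrable_measurable:
  fixes D :: "(real ^ 'n::finite) set"
  assumes D: "open D" and f: "locally_integrable D f"
  shows "f \<in> borel_measurable (lebesgue_on D)"
proof -
  obtain \<D> where \<D>: "countable \<D>" "\<D> \<subseteq> Pow D" "\<And>X. X \<in> \<D> \<Longrightarrow> \<exists>a b. X = cbox a b" "\<Union>\<D> = D"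
    by (rule open_countable_Union_open_cbox[OF D]) blast
  define C where "C n = (if \<D> = {} then {} else from_nat_into \<D> n)" for n
  define E where "E n = (\<Union>i\<le>n. C i)" for n
  have C: "compact (C n)" "C n \<subseteq> D" for n
  proof -
    have "C n = {} \<or> C n \<in> \<D>" using from_nat_into[of \<D> n] by (auto simp: C_def)
    then show "compact (C n)" "C n \<subseteq> D" using \<D>(2) \<D>(3)[of "C n"] by auto
  qed
  have E: "compact (E n)" "E n \<subseteq> D" for n unfolding E_def using C by (auto intro!: compact_UN)
  have "(\<lambda>x. indicator (E n) x * f x) \<in> borel_measurable (lebesgue_on D)" for n
    using integrable_indicator_compact[OF f E, THEN borel_measurable_integrable]
    by (rule measurable_restrict_space1)
  then show ?thesis
  proof (rule borel_measurable_LIMSEQ_real[rotated])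
    fix x assume "x \<in> space (lebesgue_on D)"
    then have "x \<in> \<Union>\<D>" using \<D> by simp
    then obtain n where "x \<in> C n" unfolding C_def using \<D>(1) by (metis UnionE empty_iff from_nat_into_surj)
    then have "x \<in> E k" if "n \<le> k" for k using that by (auto simp: E_def)
    then have ev: "\<forall>\<^sub>F k in sequentially. indicator (E k) x * f x = f x"
      by (intro eventually_mono[OF eventually_ge_at_top[of n]]) simp
    then show "(\<lambda>k. indicator (E k) x * f x) \<longlonglongrightarrow> f x" by (rule tendsto_eventually)
  qed
qed

lemma locally_integrable_mult_test_lebesgue:
  assumes "locally_integrable D f" "\<phi> \<in> test_functions D"
  shows "integrable lebesgue (\<lambda>x. f x * \<phi> x)"
proof -
  obtain K where K: "compact K" "K \<subseteq> D" "\<And>x. x \<notin> K \<Longrightarrow> \<phi> x = 0" using assms test_functionsE by meson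
  obtain B where B: "\<And>x. norm (\<phi> x) \<le> B" using assms test_functions_bounded by meson
  have i: "integrable lebesgue (\<lambda>x. indicator K x * f x)" by (rule integrable_indicator_compact[OF assms(1) K(1,2)])
  have "\<phi> \<in> borel_measurable lebesgue"
    using test_functions_borel_measurable[OF assms(2)] by (intro measurable_completion) simp
  then have "integrable lebesgue (\<lambda>x. (indicator K x * f x) * \<phi> x)"
  proof (intro Bochner_Integration.integrable_bound[OF integrable_mult_right[OF i, of B]]
        borel_measurable_times[OF borel_measurable_integrable[OF i]] AE_I2)
    fix x
    have "\<bar>indicator K x * f x\<bar> * \<bar>\<phi> x\<bar> \<le> \<bar>indicator K x * f x\<bar> * \<bar>B\<bar>"
      using B[of x] by (intro mult_left_mono) auto
    then show "norm (indicator K x * f x * \<phi> x) \<le> norm (B * (indicator K x * f x))"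
      by (simp only: real_norm_def abs_mult mult_ac)
  qed
  moreover have "(\<lambda>x. (indicator K x * f x) * \<phi> x) = (\<lambda>x. f x * \<phi> x)" using K(3) by (auto simp: indicator_def fun_eq_iff)
  ultimately show ?thesis by simp
qed

lemma integral_lebesgue_on_eq:
  fixes f :: "real ^ 'n::finite \<Rightarrow> real"
  assumes "D \<in> sets lebesgue" "\<And>x. x \<notin> D \<Longrightarrow> f x = 0"
  shows "(LINT x|lebesgue_on D. f x) = (LINT x|lebesgue. f x)"
    and "integrable (lebesgue_on D) f \<longleftrightarrow> integrable lebesgue f"
proof -
  have *: "(\<lambda>x. indicator D x *\<^sub>R f x) = f" using assms(2) by (auto simp: indicator_def fun_eq_iff)
  have D: "D \<inter> space lebesgue \<in> sets lebesgue" using assms(1) by simp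
  show "(LINT x|lebesgue_on D. f x) = (LINT x|lebesgue. f x)" using integral_restrict_space[OF D, of f] * by simp
  show "integrable (lebesgue_on D) f \<longleftrightarrow> integrable lebesgue f" using integrable_restrict_space[OF D, of f] * by simp
qed

lemma locally_integrable_mult_test:
  assumes "D \<in> sets lebesgue" "locally_integrable D f" "\<phi> \<in> test_functions D"
  shows "integrable (lebesgue_on D) (\<lambda>x. f x * \<phi> x)"
  using integral_lebesgue_on_eq(2)[OF assms(1), of "\<lambda>x. f x * \<phi> x"] test_functions_outside[OF assms(3)]
    locally_integrable_mult_test_lebesgue[OF assms(2,3)] by simp

lemma integral_box_eq_0:
  fixes D :: "(real ^ 'n::finite) set"
  assumes D: "D \<in> sets lebesgue" and f: "locally_integrable D f"
    and 0: "\<And>\<phi>. \<phi> \<in> test_functions D \<Longrightarrow> (LINT x|lebesgue_on D. f x * \<phi> x) = 0"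
    and ab: "cbox a b \<subseteq> D"
  shows "integral (cbox a b) f = 0" "f integrable_on cbox a b"
proof -
  have i: "integrable lebesgue (\<lambda>x. indicator (cbox a b) x * f x)" by (rule integrable_indicator_compact[OF f compact_cbox ab])
  obtain \<phi> :: "nat \<Rightarrow> real ^ 'n \<Rightarrow> real" where
    \<phi>: "\<And>n U. cbox a b \<subseteq> U \<Longrightarrow> \<phi> n \<in> test_functions U" "\<And>n x. 0 \<le> \<phi> n x" "\<And>n x. \<phi> n x \<le> 1"
    "\<And>x. (\<lambda>n. \<phi> n x) \<longlonglongrightarrow> indicator (box a b) x" 
    using box_indicator_approx[of a b] by metis
  have out: "\<phi> n x = 0" if "x \<notin> cbox a b" for n x using test_functions_outside[OF \<phi>(1)[OF subset_refl] that] .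
  have "(\<lambda>n. LINT x|lebesgue. f x * \<phi> n x) \<longlonglongrightarrow> (LINT x|lebesgue. f x * indicator (box a b) x)"
  proof (rule integral_dominated_convergence)
    have "(\<lambda>x. indicator (box a b) x * (indicator (cbox a b) x * f x)) \<in> borel_measurable lebesgue"
      by (intro borel_measurable_times[OF _ borel_measurable_integrable[OF i]] borel_measurable_indicator) auto
    moreover have "indicator (box a b) x * (indicator (cbox a b) x * f x) = f x * indicator (box a b) x" for x
      using box_subset_cbox by (auto simp: indicator_def)
    ultimately show "(\<lambda>x. f x * indicator (box a b) x) \<in> borel_measurable lebesgue" by simp
    show "(\<lambda>x. f x * \<phi> n x) \<in> borel_measurable lebesgue" for n
      by (rule borel_measurable_integrable[OF locally_integrable_mult_test_lebesgue[OF f \<phi>(1)[OF ab]]])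
    show "integrable lebesgue (\<lambda>x. \<bar>indicator (cbox a b) x * f x\<bar>)" using i by (rule integrable_abs)
    show "AE x in lebesgue. (\<lambda>n. f x * \<phi> n x) \<longlonglongrightarrow> f x * indicator (box a b) x"
      by (intro AE_I2 tendsto_intros \<phi>(4))
    show "AE x in lebesgue. norm (f x * \<phi> n x) \<le> \<bar>indicator (cbox a b) x * f x\<bar>" for n
    proof (rule AE_I2)
      fix x show "norm (f x * \<phi> n x) \<le> \<bar>indicator (cbox a b) x * f x\<bar>"
        using \<phi>(2,3)[of n x] out[of x n] by (cases "x \<in> cbox a b") (auto simp: abs_mult intro: mult_left_le)
    qed
  qed
  moreover have "(LINT x|lebesgue. f x * \<phi> n x) = 0" for n
    using 0[OF \<phi>(1)[OF ab, of n]] integral_lebesgue_on_eq(1)[OF D, of "\<lambda>x. f x * \<phi> n x"] test_functions_outside[OF \<phi>(1)[OF ab]] by simp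
  ultimately have "(LINT x|lebesgue. f x * indicator (box a b) x) = 0" by (simp add: LIMSEQ_const_iff)
  moreover have "(LINT x|lebesgue. f x * indicator (box a b) x) = (LINT x|lebesgue. indicator (cbox a b) x * f x)"
  proof (rule integral_cong_AE)
    have "AE x in lebesgue. x \<notin> cbox a b - box a b"
      using negligible_frontier_interval[of a b] by (intro AE_not_in) (simp add: negligible_iff_null_sets)
    then show "AE x in lebesgue. f x * indicator (box a b) x = indicator (cbox a b) x * f x"
      by eventually_elim (use box_subset_cbox in \<open>auto simp: indicator_def\<close>)
    have "(\<lambda>x. indicator (box a b) x * (indicator (cbox a b) x * f x)) \<in> borel_measurable lebesgue"
      by (intro borel_measurable_times[OF _ borel_measurable_integrable[OF i]] borel_measurable_indicator) auto
    moreover have "indicator (box a b) x * (indicator (cbox a b) x * f x) = f x * indicator (box a b) x" for x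
      using box_subset_cbox by (auto simp: indicator_def)
    ultimately show "(\<lambda>x. f x * indicator (box a b) x) \<in> borel_measurable lebesgue" by simp
  qed (use i in auto)
  ultimately have *: "(LINT x|lebesgue. indicator (cbox a b) x * f x) = 0" by simp
  have set: "f absolutely_integrable_on cbox a b" using i by (simp add: set_integrable_def)
  then show "f integrable_on cbox a b" by (rule set_lebesgue_integral_eq_integral)
  show "integral (cbox a b) f = 0" using set_lebesgue_integral_eq_integral(2)[OF set] * by (simp add: set_lebesgue_integral_def)
qed

text \<open>
  The fundamental lemma of the calculus of variations. Approximating indicators of boxes by test
  functions shows that the integrals of \<open>f\<close> over all boxes in \<open>D\<close> vanish. By the Lebesgue differentiation
  theorem \<open>f\<close> vanishes almost everywhere in each of countably many boxes that cover \<open>D\<close>.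
\<close>

lemma AE_eq_0_of_test_functions:
  fixes D :: "(real ^ 'n::finite) set"
  assumes D: "open D" and f: "locally_integrable D f"
    and 0: "\<And>\<phi>. \<phi> \<in> test_functions D \<Longrightarrow> (LINT x|lebesgue_on D. f x * \<phi> x) = 0"
  shows "AE x in lebesgue_on D. f x = 0"
proof -
  have Dl: "D \<in> sets lebesgue" using D by (simp add: borel_open)
  have box: "AE x in lebesgue. x \<in> cbox a b \<longrightarrow> f x = 0" if ab: "cbox a b \<subseteq> D" for a b
  proof -
    define g where "g x = (if x \<in> cbox a b then f x else 0)" for x
    have "g integrable_on UNIV"
      using integral_box_eq_0(2)[OF Dl f 0 ab] unfolding g_def by (simp add: integrable_restrict_UNIV)
    then have "g integrable_on cbox c d" for c d by (rule integrable_on_subcbox) auto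
    from integrable_ccontinuous_explicit[OF this] obtain N where N: "negligible N"
      "\<And>x e. x \<notin> N \<Longrightarrow> 0 < e \<Longrightarrow> \<exists>d>0. \<forall>h. 0 < h \<and> h < d \<longrightarrow>
         norm (integral (cbox x (x + h *\<^sub>R One)) g /\<^sub>R h ^ DIM(real ^ 'n) - g x) < e" by blast
    have z: "f x = 0" if x: "x \<in> box a b" "x \<notin> N" for x
    proof -
      obtain \<delta> where \<delta>: "\<delta> > 0" "ball x \<delta> \<subseteq> box a b" using open_box x(1) openE by metis
      have "\<bar>f x\<bar> \<le> 0"
      proof (rule field_le_epsilon)
        fix e :: real assume "e > 0"
        from N(2)[OF x(2) this] obtain d where d: "d > 0" "\<And>h. 0 < h \<Longrightarrow> h < d \<Longrightarrow>
          norm (integral (cbox x (x + h *\<^sub>R One)) g /\<^sub>R h ^ DIM(real ^ 'n) - g x) < e" by blast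
        \<comment> \<open>The cube at \<open>x\<close> with side \<open>h\<close> is to be small enough for the differentiation theorem and to stay in the box.\<close>
        define h where "h = min (d / 2) (\<delta> / (2 * (norm (One :: real ^ 'n) + 1)))"
        have pos: "norm (One :: real ^ 'n) + 1 > 0" by (simp add: add_nonneg_pos)
        have h: "0 < h" "h < d" "h \<le> \<delta> / (2 * (norm (One :: real ^ 'n) + 1))"
        proof -
          have "h \<le> d / 2" unfolding h_def by (rule min.cobounded1)
          then show "h < d" using d(1) by simp
        qed (use d(1) \<delta>(1) pos in \<open>auto simp: h_def\<close>)
        have "h * norm (One :: real ^ 'n) < \<delta>"
        proof -
          have "h * (norm (One :: real ^ 'n) + 1) \<le> \<delta> / (2 * (norm (One :: real ^ 'n) + 1)) * (norm (One :: real ^ 'n) + 1)"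
            using pos by (intro mult_right_mono h(3)) auto
          also have "\<dots> = \<delta> / 2" using pos by (simp add: divide_simps)
          finally have "h * (norm (One :: real ^ 'n) + 1) \<le> \<delta> / 2" .
          then show ?thesis using h(1) \<delta>(1) unfolding distrib_left by simp
        qed
        then have "dist x (x + h *\<^sub>R One) < \<delta>" using h(1) by (simp add: dist_norm)
        then have "x \<in> box a b" "x + h *\<^sub>R One \<in> box a b" using \<delta> x by auto
        then have sub: "cbox x (x + h *\<^sub>R One) \<subseteq> box a b" unfolding mem_box subset_box by blast
        then have sub': "cbox x (x + h *\<^sub>R One) \<subseteq> cbox a b" using box_subset_cbox by blast
        have "integral (cbox x (x + h *\<^sub>R One)) g = integral (cbox x (x + h *\<^sub>R One)) f"
          by (rule integral_cong) (use sub' in \<open>auto simp: g_def\<close>)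
        also have "\<dots> = 0" by (rule integral_box_eq_0(1)[OF Dl f 0]) (use sub' ab in auto)
        finally have "\<bar>g x\<bar> < e" using d(2)[OF h(1,2)] by simp
        moreover have "x \<in> cbox a b" using x(1) box_subset_cbox by blast
        ultimately show "\<bar>f x\<bar> \<le> 0 + e" by (simp add: g_def)
      qed
      then show ?thesis by simp
    qed
    have "AE x in lebesgue. x \<notin> cbox a b - box a b"
      using negligible_frontier_interval[of a b] by (intro AE_not_in) (simp add: negligible_iff_null_sets)
    moreover have "AE x in lebesgue. x \<notin> N" using N(1) by (intro AE_not_in) (simp add: negligible_iff_null_sets)
    ultimately show ?thesis by eventually_elim (use z in auto)
  qed
  obtain \<D> where \<D>: "countable \<D>" "\<D> \<subseteq> Pow D" "\<And>X. X \<in> \<D> \<Longrightarrow> \<exists>a b. X = cbox a b" "\<Union>\<D> = D"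
    by (rule open_countable_Union_open_cbox[OF D]) blast
  have "\<forall>X\<in>\<D>. AE x in lebesgue. x \<in> X \<longrightarrow> f x = 0"
  proof
    fix X assume X: "X \<in> \<D>"
    then obtain a b where "X = cbox a b" using \<D>(3) by blast
    then show "AE x in lebesgue. x \<in> X \<longrightarrow> f x = 0" using box X \<D>(2) by blast
  qed
  then have "AE x in lebesgue. \<forall>X\<in>\<D>. x \<in> X \<longrightarrow> f x = 0" by (simp only: AE_ball_countable[OF \<D>(1)])
  then have "AE x in lebesgue. x \<in> D \<longrightarrow> f x = 0" by eventually_elim (use \<D>(4) in auto)
  then show ?thesis using Dl by (simp add: AE_restrict_space_iff)
qed

section \<open>Weak derivatives\<close>

lemma finite_mi_order_le: "finite {\<alpha> :: 'n::finite multi_index. mi_order \<alpha> \<le> s}"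
proof (rule finite_subset)
  show "{\<alpha> :: 'n multi_index. mi_order \<alpha> \<le> s} \<subseteq> {\<alpha>. \<forall>i. \<alpha> $ i \<in> {..s}}"
  proof clarsimp
    fix \<alpha> :: "'n multi_index" and i assume "mi_order \<alpha> \<le> s"
    moreover have "\<alpha> $ i \<le> mi_order \<alpha>" unfolding mi_order_def by (rule member_le_sum) auto
    ultimately show "\<alpha> $ i \<le> s" by simp
  qed
  have "(\<lambda>\<alpha> :: 'n multi_index. vec_nth \<alpha>) ` {\<alpha>. \<forall>i. \<alpha> $ i \<in> {..s}} \<subseteq> PiE UNIV (\<lambda>_. {..s})" by auto
  then have "finite ((\<lambda>\<alpha> :: 'n multi_index. vec_nth \<alpha>) ` {\<alpha>. \<forall>i. \<alpha> $ i \<in> {..s}})"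
    by (rule finite_subset) (intro finite_PiE, auto)
  then show "finite {\<alpha> :: 'n multi_index. \<forall>i. \<alpha> $ i \<in> {..s}}"
    by (rule finite_imageD) (auto simp: inj_on_def vec_nth_inject)
qed

lemma mi_order_0: "mi_order 0 = 0"
  by (simp add: mi_order_def)

locale bounded_open =
  fixes D :: "(real ^ 'n::finite) set"
  assumes open_D: "open D" and bounded_D: "bounded D"
begin

abbreviation M where "M \<equiv> lebesgue_on D"

lemma D_sets: "D \<in> sets lebesgue"
  using open_D by (simp add: borel_open)

lemma D_lmeasurable: "D \<in> lmeasurable"
  using bounded_D D_sets by (rule bounded_set_imp_lmeasurable)

sublocale finite_measure M
  by (rule finite_measure_lebesgue_on[OF D_lmeasurable])

lemma Lp_fun_iff: "f \<in> Lp_fun p D \<longleftrightarrow> p_integrable M p f"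
  by (simp add: Lp_fun_def p_integrable_def)

lemma locally_integrable_lincomb:
  "locally_integrable D f \<Longrightarrow> locally_integrable D g \<Longrightarrow> locally_integrable D (\<lambda>x. c * f x + d * g x)"
  unfolding locally_integrable_def by auto

lemma integrable_imp_locally_integrable:
  assumes "integrable M f" shows "locally_integrable D f"
  unfolding locally_integrable_def
proof (intro allI impI, elim conjE)
  fix K assume K: "compact K" "K \<subseteq> D"
  have Ks: "K \<in> sets lebesgue" using K(1) by (intro fmeasurableD lmeasurable_compact)
  have "set_integrable lebesgue D f" using assms D_sets by (simp add: set_integrable_restrict_space integrable_restrict_space set_integrable_def)
  then have "set_integrable lebesgue K f" using Ks K(2) by (rule set_integrable_subset)
  then show "integrable (lebesgue_on K) f" using Ks by (simp add: integrable_restrict_space set_integrable_def)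
qed

lemma Lp_locally_integrable: "p > 1 \<Longrightarrow> p_integrable M p f \<Longrightarrow> locally_integrable D f"
  by (intro integrable_imp_locally_integrable p_integrable_imp_integrable)

lemma test_measurable: "\<phi> \<in> test_functions U \<Longrightarrow> \<phi> \<in> borel_measurable M"
  using test_functions_borel_measurable by (intro measurable_restrict_space1 measurable_completion) simp

lemma test_p_integrable: assumes "\<phi> \<in> test_functions U" "p > 0" shows "p_integrable M p \<phi>"
proof -
  have [measurable]: "\<phi> \<in> borel_measurable M" by (rule test_measurable[OF assms(1)])
  obtain B where B: "B > 0" "\<And>x. norm (\<phi> x) \<le> B" using test_functions_bounded[OF assms(1)] by blast
  have "integrable M (\<lambda>x. \<bar>\<phi> x\<bar> powr p)"
  proof (rule integrable_const_bound)
    show "AE x in M. norm (\<bar>\<phi> x\<bar> powr p) \<le> B powr p" using B assms(2) by (auto intro!: AE_I2 powr_mono2)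
  qed simp
  then show ?thesis by (simp add: p_integrable_def)
qed

lemma test_locally_integrable: "\<phi> \<in> test_functions U \<Longrightarrow> locally_integrable D \<phi>"
  using Lp_locally_integrable[of 2] test_p_integrable[of _ U 2] by simp

lemma integrable_mult_test: "locally_integrable D f \<Longrightarrow> \<phi> \<in> test_functions D \<Longrightarrow> integrable M (\<lambda>x. f x * \<phi> x)"
  by (rule locally_integrable_mult_test[OF D_sets])

lemma test_lincomb_integral:
  assumes "locally_integrable D f" "locally_integrable D g" "\<phi> \<in> test_functions D"
  shows "(LINT x|M. (c * f x + d * g x) * \<phi> x) = c * (LINT x|M. f x * \<phi> x) + d * (LINT x|M. g x * \<phi> x)"
proof -
  have "(LINT x|M. (c * f x + d * g x) * \<phi> x) = (LINT x|M. c * (f x * \<phi> x) + d * (g x * \<phi> x))"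
    by (simp add: algebra_simps)
  also have "\<dots> = c * (LINT x|M. f x * \<phi> x) + d * (LINT x|M. g x * \<phi> x)"
    using integrable_mult_test[OF assms(1,3)] integrable_mult_test[OF assms(2,3)] by simp
  finally show ?thesis .
qed

lemma AE_eq_of_test_functions:
  assumes "locally_integrable D f" "locally_integrable D g"
    and "\<And>\<phi>. \<phi> \<in> test_functions D \<Longrightarrow> (LINT x|M. f x * \<phi> x) = (LINT x|M. g x * \<phi> x)"
  shows "AE x in M. f x = g x"
proof -
  have "AE x in M. 1 * f x + (- 1) * g x = 0"
    by (rule AE_eq_0_of_test_functions[OF open_D locally_integrable_lincomb[OF assms(1,2)]])
       (subst test_lincomb_integral, use assms in auto)
  then show ?thesis by eventually_elim simp
qed

lemma is_weak_deriv_unique: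
  assumes "is_weak_deriv D \<alpha> f g" "is_weak_deriv D \<alpha> f h" shows "AE x in M. g x = h x"
proof (rule AE_eq_of_test_functions)
  fix \<phi> :: "real ^ 'n \<Rightarrow> real" assume \<phi>: "\<phi> \<in> test_functions D"
  have "(LINT x|M. f x * pderiv_mi \<alpha> \<phi> x) = (-1) ^ mi_order \<alpha> * (LINT x|M. g x * \<phi> x)"
    "(LINT x|M. f x * pderiv_mi \<alpha> \<phi> x) = (-1) ^ mi_order \<alpha> * (LINT x|M. h x * \<phi> x)"
    using assms \<phi> unfolding is_weak_deriv_def by blast+
  then show "(LINT x|M. g x * \<phi> x) = (LINT x|M. h x * \<phi> x)" by simp
qed (use assms in \<open>auto simp: is_weak_deriv_def\<close>)

lemma is_weak_deriv_lincomb: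
  assumes "is_weak_deriv D \<alpha> f g" "is_weak_deriv D \<alpha> f' g'"
  shows "is_weak_deriv D \<alpha> (\<lambda>x. c * f x + d * f' x) (\<lambda>x. c * g x + d * g' x)"
proof -
  have l: "locally_integrable D f" "locally_integrable D g" "locally_integrable D f'" "locally_integrable D g'"
    using assms by (auto simp: is_weak_deriv_def)
  have "(LINT x|M. (c * f x + d * f' x) * pderiv_mi \<alpha> \<phi> x) = (-1) ^ mi_order \<alpha> * (LINT x|M. (c * g x + d * g' x) * \<phi> x)"
    if \<phi>: "\<phi> \<in> test_functions D" for \<phi>
    unfolding test_lincomb_integral[OF l(1,3) test_functions_pderiv_mi[OF \<phi>]] test_lincomb_integral[OF l(2,4) \<phi>]
    using assms \<phi> by (simp add: is_weak_deriv_def algebra_simps)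
  then show ?thesis using l locally_integrable_lincomb by (simp add: is_weak_deriv_def)
qed

lemma weak_deriv_eqI: assumes "is_weak_deriv D \<alpha> f g" shows "AE x in M. weak_deriv D \<alpha> f x = g x"
  using is_weak_deriv_unique[OF someI[of "is_weak_deriv D \<alpha> f", OF assms] assms] by (simp add: weak_deriv_def)

text \<open>
  The classical derivatives of a test function are its weak derivatives. Via uniqueness this
  identifies the Sobolev norm of a test function.
\<close>

lemma is_weak_deriv_test: assumes "\<phi> \<in> test_functions D" shows "is_weak_deriv D \<alpha> \<phi> (pderiv_mi \<alpha> \<phi>)"
proof -
  have "(LINT x|M. \<phi> x * pderiv_mi \<alpha> \<psi> x) = (-1) ^ mi_order \<alpha> * (LINT x|M. pderiv_mi \<alpha> \<phi> x * \<psi> x)"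
    if \<psi>: "\<psi> \<in> test_functions D" for \<psi>
  proof -
    have tr: "(LINT x|M. f x * g x) = (\<integral>x. f x * g x \<partial>lborel)" if f: "f \<in> test_functions D" and g: "g \<in> test_functions D" for f g :: "real ^ 'n \<Rightarrow> real"
    proof -
      have [measurable]: "f \<in> borel_measurable borel" "g \<in> borel_measurable borel"
        using f g by (auto intro: test_functions_borel_measurable)
      have "(LINT x|M. f x * g x) = (LINT x|lebesgue. f x * g x)"
        using integral_lebesgue_on_eq(1)[OF D_sets, of "\<lambda>x. f x * g x"] test_functions_outside[OF f] by simp
      also have "\<dots> = (\<integral>x. f x * g x \<partial>lborel)" by (rule integral_completion) simp
      finally show ?thesis .
    qed
    show ?thesis
      unfolding tr[OF assms test_functions_pderiv_mi[OF \<psi>]] tr[OF test_functions_pderiv_mi[OF assms] \<psi>]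
      by (rule integral_by_parts_pderiv_mi) (use assms \<psi> in \<open>auto intro: test_functions_mono\<close>)
  qed
  then show ?thesis
    using test_locally_integrable[OF assms] test_locally_integrable[OF test_functions_pderiv_mi[OF assms]]
    by (simp add: is_weak_deriv_def)
qed

end

section \<open>Sobolev spaces of nonnegative order\<close>

locale sobolev_setting = bounded_open D for D :: "(real ^ 'n::finite) set" +
  fixes p :: real assumes p: "1 < p"
begin

abbreviation W where "W s \<equiv> sobolev_fun s p D"
abbreviation NW where "NW s \<equiv> sobolev_fun_norm s p D"
abbreviation wd where "wd \<equiv> weak_deriv D"

text \<open>
  An element of a Sobolev space has some weak derivative in \<open>L\<^sup>p\<close>, and the one that \<open>weak_deriv\<close> chooses
  agrees with it almost everywhere.
\<close>

lemma weak_deriv_Lp: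
  assumes "f \<in> W s" "mi_order \<alpha> \<le> s"
  shows "is_weak_deriv D \<alpha> f (wd \<alpha> f)" "p_integrable M p (wd \<alpha> f)"
proof -
  obtain g where g: "p_integrable M p g" "is_weak_deriv D \<alpha> f g" using assms by (auto simp: sobolev_fun_def Lp_fun_iff)
  show wd: "is_weak_deriv D \<alpha> f (wd \<alpha> f)"
    unfolding weak_deriv_def using g(2) by (rule someI[of "is_weak_deriv D \<alpha> f"])
  then have m: "wd \<alpha> f \<in> borel_measurable M"
    by (intro locally_integrable_measurable open_D) (simp add: is_weak_deriv_def)
  have AE: "AE x in M. \<bar>g x\<bar> powr p = \<bar>wd \<alpha> f x\<bar> powr p"
    using is_weak_deriv_unique[OF g(2) wd] by eventually_elim simp
  have "integrable M (\<lambda>x. \<bar>wd \<alpha> f x\<bar> powr p)"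
    by (rule integrable_cong_AE_imp[OF _ _ AE]) (use g m in \<open>auto simp: p_integrable_def\<close>)
  then show "p_integrable M p (wd \<alpha> f)" using m by (simp add: p_integrable_def)
qed

lemma sobolev_fun_p_integrable: "f \<in> W s \<Longrightarrow> p_integrable M p f"
  by (simp add: sobolev_fun_def Lp_fun_iff)

lemma sobolev_fun_memI:
  assumes "p_integrable M p f" "\<And>\<alpha>. mi_order \<alpha> \<le> s \<Longrightarrow> p_integrable M p (G \<alpha>) \<and> is_weak_deriv D \<alpha> f (G \<alpha>)"
  shows "f \<in> W s"
proof -
  have "\<exists>g\<in>Lp_fun p D. is_weak_deriv D \<alpha> f g" if "mi_order \<alpha> \<le> s" for \<alpha>
    by (rule bexI[of _ "G \<alpha>"]) (use assms(2)[OF that] in \<open>simp_all add: Lp_fun_iff\<close>)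
  then show ?thesis using assms(1) by (simp add: sobolev_fun_def Lp_fun_iff)
qed

lemma fscale_add_eq: "fscale c f + fscale d g = (\<lambda>x. c * f x + d * g x :: real)"
  by (auto simp: fscale_def)

lemma sobolev_fun_lincomb: "f \<in> W s \<Longrightarrow> g \<in> W s \<Longrightarrow> fscale c f + fscale d g \<in> W s"
  unfolding fscale_add_eq
proof (rule sobolev_fun_memI[where G="\<lambda>\<alpha> x. c * wd \<alpha> f x + d * wd \<alpha> g x"])
  assume f: "f \<in> W s" and g: "g \<in> W s"
  show "p_integrable M p (\<lambda>x. c * f x + d * g x)"
    using p by (intro p_integrable_lincomb sobolev_fun_p_integrable[OF f] sobolev_fun_p_integrable[OF g]) simp
  fix \<alpha> :: "'n multi_index" assume \<alpha>: "mi_order \<alpha> \<le> s"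
  show "p_integrable M p (\<lambda>x. c * wd \<alpha> f x + d * wd \<alpha> g x) \<and>
      is_weak_deriv D \<alpha> (\<lambda>x. c * f x + d * g x) (\<lambda>x. c * wd \<alpha> f x + d * wd \<alpha> g x)"
    using p by (intro conjI p_integrable_lincomb is_weak_deriv_lincomb weak_deriv_Lp[OF f \<alpha>] weak_deriv_Lp[OF g \<alpha>]) simp
qed

lemma sobolev_fun_zero: "0 \<in> W s"
proof (rule sobolev_fun_memI[where G="\<lambda>_. 0"])
  have l: "locally_integrable D 0" by (simp add: locally_integrable_def zero_fun_def)
  then show "p_integrable M p 0 \<and> is_weak_deriv D \<alpha> 0 0" for \<alpha>
    using p by (simp add: p_integrable_def is_weak_deriv_def zero_fun_def)
qed (use p in \<open>simp add: p_integrable_def zero_fun_def\<close>)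

lemma sobolev_fun_fscale: "f \<in> W s \<Longrightarrow> fscale c f \<in> W s"
  using sobolev_fun_lincomb[of f s f c 0] by simp

lemma sobolev_fun_add: "f \<in> W s \<Longrightarrow> g \<in> W s \<Longrightarrow> f + g \<in> W s"
  using sobolev_fun_lincomb[of f s g 1 1] by simp

lemma weak_deriv_lincomb:
  assumes "f \<in> W s" "g \<in> W s" "mi_order \<alpha> \<le> s"
  shows "AE x in M. wd \<alpha> (fscale c f + fscale d g) x = c * wd \<alpha> f x + d * wd \<alpha> g x"
  unfolding fscale_add_eq by (intro weak_deriv_eqI is_weak_deriv_lincomb weak_deriv_Lp(1)[OF _ assms(3)] assms)

definition energy :: "nat \<Rightarrow> (real ^ 'n \<Rightarrow> real) \<Rightarrow> real" where
  "energy s f = (\<Sum>\<alpha> | mi_order \<alpha> \<le> s. LINT x|M. \<bar>wd \<alpha> f x\<bar> powr p)"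

lemma sobolev_fun_norm_energy: "NW s f = energy s f powr (1 / p)"
  by (simp add: sobolev_fun_norm_def energy_def)

lemma energy_nonneg: "0 \<le> energy s f"
  unfolding energy_def by (intro sum_nonneg) simp

lemma energy_norm: "energy s f = NW s f powr p"
  using p energy_nonneg[of s f] by (simp add: sobolev_fun_norm_energy powr_powr)

lemma energy_lincomb:
  assumes f: "f \<in> W s" and g: "g \<in> W s"
  shows "energy s (fscale c f + fscale d g) = (\<Sum>\<alpha> | mi_order \<alpha> \<le> s. LINT x|M. \<bar>c * wd \<alpha> f x + d * wd \<alpha> g x\<bar> powr p)"
  unfolding energy_def
proof (rule sum.cong)
  fix \<alpha> :: "'n multi_index" assume "\<alpha> \<in> {\<alpha>. mi_order \<alpha> \<le> s}"
  then have \<alpha>: "mi_order \<alpha> \<le> s" by simp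
  have [measurable]: "wd \<alpha> f \<in> borel_measurable M" "wd \<alpha> g \<in> borel_measurable M" "wd \<alpha> (fscale c f + fscale d g) \<in> borel_measurable M"
    using weak_deriv_Lp(2)[OF f \<alpha>] weak_deriv_Lp(2)[OF g \<alpha>] weak_deriv_Lp(2)[OF sobolev_fun_lincomb[OF f g] \<alpha>] by (auto simp: p_integrable_def)
  show "(LINT x|M. \<bar>wd \<alpha> (fscale c f + fscale d g) x\<bar> powr p) = (LINT x|M. \<bar>c * wd \<alpha> f x + d * wd \<alpha> g x\<bar> powr p)"
    using weak_deriv_lincomb[OF f g \<alpha>, of c d] by (intro integral_cong_AE) (auto elim: eventually_mono)
qed simp

lemma integrable_lincomb:
  assumes f: "f \<in> W s" and g: "g \<in> W s" and \<alpha>: "mi_order \<alpha> \<le> s"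
  shows "integrable M (\<lambda>x. \<bar>c * wd \<alpha> f x + d * wd \<alpha> g x\<bar> powr p)"
  using p_integrable_lincomb[OF _ weak_deriv_Lp(2)[OF f \<alpha>] weak_deriv_Lp(2)[OF g \<alpha>]] p by (simp add: p_integrable_def)

lemma integrable_wd:
  assumes f: "f \<in> W s" and \<alpha>: "mi_order \<alpha> \<le> s"
  shows "integrable M (\<lambda>x. \<bar>wd \<alpha> f x\<bar> powr p)"
  using weak_deriv_Lp(2)[OF f \<alpha>] by (simp add: p_integrable_def)

lemma energy_fscale: assumes "f \<in> W s" shows "energy s (fscale c f) = \<bar>c\<bar> powr p * energy s f"
proof -
  have "energy s (fscale c f) = (\<Sum>\<alpha> | mi_order \<alpha> \<le> s. LINT x|M. \<bar>c * wd \<alpha> f x\<bar> powr p)"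
    using energy_lincomb[OF assms assms, of c 0] by simp
  then show ?thesis by (simp add: energy_def abs_mult powr_mult sum_distrib_left)
qed

text \<open>
  The energy of a linear combination is the integral of \<open>\<bar>a x + b y\<bar> powr p\<close> at the weak derivatives \<open>x\<close> of \<open>f\<close>
  and \<open>y\<close> of \<open>g\<close>, so inequalities between such expressions carry over from numbers to energies.
\<close>

lemma energy_inequality:
  assumes f: "f \<in> W s" and g: "g \<in> W s"
    and pointwise: "\<And>x y :: real. 0 \<le> (\<Sum>(c, a, b)\<leftarrow>L. c * \<bar>a * x + b * y\<bar> powr p)"
  shows "0 \<le> (\<Sum>(c, a, b)\<leftarrow>L. c * energy s (fscale a f + fscale b g))"
proof -
  define E where "E a b = energy s (fscale a f + fscale b g)" for a b
  have E: "E a b = (\<Sum>\<alpha> | mi_order \<alpha> \<le> s. LINT x|M. \<bar>a * wd \<alpha> f x + b * wd \<alpha> g x\<bar> powr p)" for a b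
    unfolding E_def by (rule energy_lincomb[OF f g])
  let ?h = "\<lambda>L \<alpha> x. \<Sum>(c, a, b)\<leftarrow>L. c * \<bar>a * wd \<alpha> f x + b * wd \<alpha> g x\<bar> powr p"
  have i: "integrable M (?h L \<alpha>)" if "mi_order \<alpha> \<le> s" for L \<alpha>
    by (induction L) (auto intro!: Bochner_Integration.integrable_add integrable_mult_right integrable_lincomb[OF f g that])
  have "(\<Sum>(c, a, b)\<leftarrow>L. c * E a b) = (\<Sum>\<alpha> | mi_order \<alpha> \<le> s. LINT x|M. ?h L \<alpha> x)"
  proof (induction L)
    case (Cons t L)
    obtain c a b where t: "t = (c, a, b)" by (cases t)
    have "(LINT x|M. ?h (t # L) \<alpha> x) = c * (LINT x|M. \<bar>a * wd \<alpha> f x + b * wd \<alpha> g x\<bar> powr p) + (LINT x|M. ?h L \<alpha> x)"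
      if "mi_order \<alpha> \<le> s" for \<alpha>
      using i[OF that, of L] integrable_lincomb[OF f g that, of a b] by (simp add: t)
    then show ?case using Cons.IH by (simp add: t E sum.distrib sum_distrib_left)
  qed simp
  also have "0 \<le> \<dots>" by (intro sum_nonneg integral_nonneg_AE AE_I2 pointwise)
  finally show ?thesis unfolding E_def .
qed

lemma energy_convex:
  assumes f: "f \<in> W s" and g: "g \<in> W s" and cd: "0 \<le> c" "0 \<le> d" "c + d = 1"
  shows "energy s (fscale c f + fscale d g) \<le> c * energy s f + d * energy s g"
proof -
  have "0 \<le> (\<Sum>(c, a, b)\<leftarrow>[(c, 1, 0), (d, 0, 1), (- 1, c, d)]. c * \<bar>a * x + b * y\<bar> powr p)" for x y
    using abs_powr_convex[OF _ cd, of p x y] p by simp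
  from energy_inequality[OF f g this] show ?thesis by simp
qed

lemma seminormed_sobolev_fun: "seminormed (W s) (NW s)"
proof -
  have "seminormed (W s) (\<lambda>f. energy s f powr (1 / p))"
    by (rule seminormed_powr)
       (use p in \<open>auto intro: sobolev_fun_zero sobolev_fun_add sobolev_fun_fscale energy_nonneg energy_fscale energy_convex\<close>)
  then show ?thesis by (simp add: sobolev_fun_norm_energy[abs_def])
qed

lemma energy_minus:
  assumes f: "f \<in> W s" and g: "g \<in> W s"
  shows "energy s (f - g) = (\<Sum>\<alpha> | mi_order \<alpha> \<le> s. LINT x|M. \<bar>wd \<alpha> f x - wd \<alpha> g x\<bar> powr p)"
  using energy_lincomb[OF f g, of 1 "-1"] by simp

lemma energy_uniformly_convex:
  assumes e: "e > 0"
  obtains C where "C \<ge> 0" "\<And>f g. f \<in> W s \<Longrightarrow> g \<in> W s \<Longrightarrow>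
     energy s (f - g) \<le> e * (energy s f + energy s g) + C * ((energy s f + energy s g) / 2 - energy s (midpoint_of f g))"
proof -
  obtain C where C: "C \<ge> 0" "\<And>a b :: real. \<bar>a - b\<bar> powr p \<le> e * (\<bar>a\<bar> powr p + \<bar>b\<bar> powr p) +
     C * ((\<bar>a\<bar> powr p + \<bar>b\<bar> powr p) / 2 - \<bar>(a + b) / 2\<bar> powr p)"
    using abs_powr_uniformly_convex[OF p e] by metis
  show ?thesis
  proof (rule that[OF C(1)])
    fix f g assume "f \<in> W s" "g \<in> W s"
    from energy_inequality[OF this, of "[(e + C / 2, 1, 0), (e + C / 2, 0, 1), (- C, 1/2, 1/2), (- 1, 1, - 1)]"] C(2)
    show "energy s (f - g) \<le> e * (energy s f + energy s g) + C * ((energy s f + energy s g) / 2 - energy s (midpoint_of f g))"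
      by (simp add: midpoint_of_def fun_vs.scale_right_distrib algebra_simps add_divide_distrib)
  qed
qed

lemma powr_less_cancel_base: "0 \<le> x \<Longrightarrow> 0 < y \<Longrightarrow> x powr p < y powr p \<Longrightarrow> x < y" for x y :: real
  using p powr_mono2[of p y x] by (meson less_imp_le not_le order_less_trans zero_less_one)

lemma uniformly_convexifiable_sobolev_fun: "uniformly_convexifiable (W s) (NW s)"
proof -
  interpret seminormed "W s" "NW s" by (rule seminormed_sobolev_fun)
  have en: "energy s f \<le> \<bar>R\<bar> powr p" if "f \<in> W s" "NW s f \<le> R" for f R
    unfolding energy_norm using that N_nonneg p by (intro powr_mono2) auto
  have "convexity_gauge (W s) (NW s) (energy s)"
    unfolding convexity_gauge_def
  proof (intro conjI ballI allI impI)
    show "\<exists>M. \<forall>u\<in>W s. NW s u \<le> R \<longrightarrow> energy s u \<le> M" for R using en by blast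
    show "energy s (midpoint_of u w) \<le> (energy s u + energy s w) / 2" if "u \<in> W s" "w \<in> W s" for u w
      using energy_convex[OF that, of "1/2" "1/2"] by (simp add: midpoint_of_def fun_vs.scale_right_distrib)
    fix R e :: real assume e: "e > 0"
    \<comment> \<open>Both terms of the estimate in \<open>energy_uniformly_convex\<close> are to be at most half of \<open>e powr p\<close>.\<close>
    define \<epsilon> where "\<epsilon> = e powr p / (4 * (\<bar>R\<bar> powr p + 1))"
    have \<epsilon>: "\<epsilon> > 0" unfolding \<epsilon>_def using e by (simp add: add_nonneg_pos)
    obtain C where C: "C \<ge> 0" "\<And>f g. f \<in> W s \<Longrightarrow> g \<in> W s \<Longrightarrow>
       energy s (f - g) \<le> \<epsilon> * (energy s f + energy s g) + C * ((energy s f + energy s g) / 2 - energy s (midpoint_of f g))"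
      using energy_uniformly_convex[OF \<epsilon>] by blast
    define d where "d = e powr p / (2 * (C + 1))"
    have d: "d > 0" unfolding d_def using e C(1) by simp
    show "\<exists>d>0. \<forall>u\<in>W s. \<forall>w\<in>W s. NW s u \<le> R \<and> NW s w \<le> R \<and>
        (energy s u + energy s w) / 2 - energy s (midpoint_of u w) < d \<longrightarrow> NW s (u - w) < e"
    proof (intro exI[of _ d] conjI ballI impI d)
      fix u w assume u: "u \<in> W s" and w: "w \<in> W s" and h: "NW s u \<le> R \<and> NW s w \<le> R \<and>
        (energy s u + energy s w) / 2 - energy s (midpoint_of u w) < d"
      let ?gap = "(energy s u + energy s w) / 2 - energy s (midpoint_of u w)"
      have "energy s u + energy s w \<le> 2 * (\<bar>R\<bar> powr p)" using en[OF u, of R] en[OF w, of R] h by auto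
      also have "\<dots> < 2 * (\<bar>R\<bar> powr p + 1)" by simp
      finally have "\<epsilon> * (energy s u + energy s w) < \<epsilon> * (2 * (\<bar>R\<bar> powr p + 1))" using \<epsilon> by (rule mult_strict_left_mono)
      also have "\<dots> = e powr p / 2" 
      proof -
        have "\<bar>R\<bar> powr p + 1 \<noteq> 0" using powr_ge_zero[of "\<bar>R\<bar>" p] by linarith
        moreover have "a / (4 * y) * (2 * y) = a / 2" if "y \<noteq> 0" for a y :: real using that by simp
        ultimately show ?thesis unfolding \<epsilon>_def by blast
      qed
      finally have 1: "\<epsilon> * (energy s u + energy s w) < e powr p / 2" .
      have "C * ?gap \<le> C * d" using h C(1) by (intro mult_left_mono) auto
      also have "C * d \<le> e powr p / 2" 
        unfolding d_def using C(1) by (simp add: divide_simps) (simp add: algebra_simps)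
      finally have "energy s (u - w) < e powr p" using C(2)[OF u w] 1 by argo
      then show "NW s (u - w) < e"
        unfolding energy_norm by (rule powr_less_cancel_base[OF N_nonneg[OF diff_mem[OF u w]] e])
    qed
  qed (rule energy_nonneg)
  then show ?thesis
    unfolding uniformly_convexifiable_def by (intro exI[of _ "\<lambda>x. x powr p"]) (simp add: energy_norm[abs_def])
qed

lemma energy_uniformly_smooth:
  assumes e: "e > 0"
  shows "\<exists>t>0. \<forall>x\<in>W s. \<forall>y\<in>W s.
       energy s (x + fscale t y) + energy s (x - fscale t y) \<le> 2 * energy s x + e * t * (energy s x + energy s y)"
proof -
  obtain t where t: "t > 0" "\<And>a b :: real. \<bar>a + t * b\<bar> powr p + \<bar>a - t * b\<bar> powr p \<le>
     2 * \<bar>a\<bar> powr p + e * t * (\<bar>a\<bar> powr p + \<bar>b\<bar> powr p)"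
    using abs_powr_uniformly_smooth[OF p e] by metis
  show ?thesis
  proof (intro exI[of _ t] conjI t(1) ballI)
    fix f g assume "f \<in> W s" "g \<in> W s"
    from energy_inequality[OF this, of "[(2 + e * t, 1, 0), (e * t, 0, 1), (- 1, 1, t), (- 1, 1, - t)]"] t(2)
    show "energy s (f + fscale t g) + energy s (f - fscale t g) \<le> 2 * energy s f + e * t * (energy s f + energy s g)"
      by (simp add: algebra_simps)
  qed
qed

lemma weak_deriv_distance_le_energy: "mi_order \<alpha> \<le> s \<Longrightarrow> f \<in> W s \<Longrightarrow> g \<in> W s \<Longrightarrow>
   (LINT x|M. \<bar>wd \<alpha> f x - wd \<alpha> g x\<bar> powr p) \<le> energy s (f - g)"
  unfolding energy_minus by (rule member_le_sum) (auto intro: finite_mi_order_le)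

lemma tendsto_integral_test:
  fixes f :: "nat \<Rightarrow> real ^ 'n \<Rightarrow> real"
  assumes f: "\<And>n. p_integrable M p (f n)" and g: "p_integrable M p g" and \<psi>: "\<psi> \<in> test_functions D"
    and lim: "(\<lambda>n. LINT x|M. \<bar>f n x - g x\<bar> powr p) \<longlonglongrightarrow> 0"
  shows "(\<lambda>n. LINT x|M. f n x * \<psi> x) \<longlonglongrightarrow> (LINT x|M. g x * \<psi> x)"
proof -
  obtain B where B: "B > 0" "\<And>x. norm (\<psi> x) \<le> B" using test_functions_bounded[OF \<psi>] by blast
  have d: "p_integrable M p (\<lambda>x. f n x - g x)" for n
    using p_integrable_lincomb[OF _ f g, where c=1 and d="-1"] p by simp
  have l1: "(\<lambda>n. LINT x|M. \<bar>f n x - g x\<bar>) \<longlonglongrightarrow> 0" by (rule L1_tendsto_0_of_Lp[OF p d lim])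
  have "(\<lambda>n. (LINT x|M. f n x * \<psi> x) - (LINT x|M. g x * \<psi> x)) \<longlonglongrightarrow> 0"
  proof (rule Lim_null_comparison)
    show "(\<lambda>n. B * (LINT x|M. \<bar>f n x - g x\<bar>)) \<longlonglongrightarrow> 0" using tendsto_mult_left[OF l1, of B] by simp
    show "\<forall>\<^sub>F n in sequentially. norm ((LINT x|M. f n x * \<psi> x) - (LINT x|M. g x * \<psi> x)) \<le> B * (LINT x|M. \<bar>f n x - g x\<bar>)"
    proof (intro always_eventually allI)
      fix n
      have li: "locally_integrable D (f n)" "locally_integrable D g" using f g p by (auto intro: Lp_locally_integrable)
      have "(LINT x|M. f n x * \<psi> x) - (LINT x|M. g x * \<psi> x) = (LINT x|M. (f n x - g x) * \<psi> x)"
        using test_lincomb_integral[OF li \<psi>, of 1 "-1"] by simp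
      also have "norm \<dots> \<le> (LINT x|M. B * \<bar>f n x - g x\<bar>)"
      proof (rule order_trans[OF integral_norm_bound integral_mono])
        have "locally_integrable D (\<lambda>x. f n x - g x)" using locally_integrable_lincomb[OF li, of 1 "-1"] by simp
        from integrable_norm[OF integrable_mult_test[OF this \<psi>]]
        show "integrable M (\<lambda>x. norm ((f n x - g x) * \<psi> x))" .
        show "integrable M (\<lambda>x. B * \<bar>f n x - g x\<bar>)" using p_integrable_imp_integrable[OF p d] by auto
        show "norm ((f n x - g x) * \<psi> x) \<le> B * \<bar>f n x - g x\<bar>" for x
          using mult_left_mono[OF B(2)[of x], of "\<bar>f n x - g x\<bar>"] by (simp add: abs_mult mult.commute)
      qed
      finally show "norm ((LINT x|M. f n x * \<psi> x) - (LINT x|M. g x * \<psi> x)) \<le> B * (LINT x|M. \<bar>f n x - g x\<bar>)" by simp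
    qed
  qed
  then show ?thesis by (rule LIM_zero_cancel)
qed

lemma weak_deriv_0_integral:
  assumes "f \<in> W s" "\<psi> \<in> test_functions D" shows "(LINT x|M. wd 0 f x * \<psi> x) = (LINT x|M. f x * \<psi> x)"
  using weak_deriv_Lp(1)[OF assms(1), of 0] assms(2) by (simp add: is_weak_deriv_def pderiv_mi_0 mi_order_0)

text \<open>
  The weak derivatives of a Cauchy sequence converge in \<open>L\<^sup>p\<close> to functions \<open>G \<alpha>\<close>. Convergence in \<open>L\<^sup>p\<close>
  suffices to pass to the limit in the integrals against test functions, so \<open>G \<alpha>\<close> is a weak derivative
  of \<open>G 0\<close>, and \<open>G 0\<close> is the limit in the Sobolev space.
\<close>

lemma complete_sobolev_fun: "complete_under (W s) (NW s)"
  unfolding complete_under_def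
proof (intro allI impI, elim conjE)
  fix w :: "nat \<Rightarrow> real ^ 'n \<Rightarrow> real"
  assume w: "\<forall>n. w n \<in> W s" and cau: "\<forall>e>0. \<exists>K. \<forall>m\<ge>K. \<forall>n\<ge>K. NW s (w m - w n) < e"
  interpret seminormed "W s" "NW s" by (rule seminormed_sobolev_fun)
  have "\<exists>g. p_integrable M p g \<and> (\<lambda>n. LINT x|M. \<bar>wd \<alpha> (w n) x - g x\<bar> powr p) \<longlonglongrightarrow> 0" if \<alpha>: "mi_order \<alpha> \<le> s" for \<alpha>
  proof -
    have c: "\<exists>K. \<forall>m\<ge>K. \<forall>n\<ge>K. (LINT x|M. \<bar>wd \<alpha> (w m) x - wd \<alpha> (w n) x\<bar> powr p) < e" if e: "e > 0" for e
    proof -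
      obtain K where K: "\<And>m n. m \<ge> K \<Longrightarrow> n \<ge> K \<Longrightarrow> NW s (w m - w n) < e powr (1 / p)"
        using cau[rule_format, of "e powr (1/p)"] e by auto
      have "(LINT x|M. \<bar>wd \<alpha> (w m) x - wd \<alpha> (w n) x\<bar> powr p) < e" if "m \<ge> K" "n \<ge> K" for m n
      proof -
        have "energy s (w m - w n) < (e powr (1 / p)) powr p"
          unfolding energy_norm using K[OF that] N_nonneg[OF diff_mem] w p by (intro powr_less_mono2) auto
        also have "\<dots> = e" using p e by (simp add: powr_powr)
        finally show ?thesis using weak_deriv_distance_le_energy[OF \<alpha>, of "w m" "w n"] w by simp
      qed
      then show ?thesis by blast
    qed
    show ?thesis
    proof (rule Lp_complete[OF p weak_deriv_Lp(2)[OF w[rule_format] \<alpha>] c])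
      fix g assume "p_integrable M p g" "(\<lambda>n. LINT x|M. \<bar>wd \<alpha> (w n) x - g x\<bar> powr p) \<longlonglongrightarrow> 0"
      then show ?thesis by blast
    qed
  qed
  then have "\<exists>G. \<forall>\<alpha>. mi_order \<alpha> \<le> s \<longrightarrow>
      p_integrable M p (G \<alpha>) \<and> (\<lambda>n. LINT x|M. \<bar>wd \<alpha> (w n) x - G \<alpha> x\<bar> powr p) \<longlonglongrightarrow> 0"
    by (intro choice allI) blast
  then obtain G where G: "\<And>\<alpha>. mi_order \<alpha> \<le> s \<Longrightarrow> p_integrable M p (G \<alpha>)"
    "\<And>\<alpha>. mi_order \<alpha> \<le> s \<Longrightarrow> (\<lambda>n. LINT x|M. \<bar>wd \<alpha> (w n) x - G \<alpha> x\<bar> powr p) \<longlonglongrightarrow> 0" by blast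
  have G0: "p_integrable M p (G 0)" by (rule G(1)) (simp add: mi_order_0)
  have weak: "is_weak_deriv D \<alpha> (G 0) (G \<alpha>)" if \<alpha>: "mi_order \<alpha> \<le> s" for \<alpha>
  proof -
    have "(LINT x|M. G 0 x * pderiv_mi \<alpha> \<phi> x) = (-1) ^ mi_order \<alpha> * (LINT x|M. G \<alpha> x * \<phi> x)" if \<phi>: "\<phi> \<in> test_functions D" for \<phi>
    proof (rule LIMSEQ_unique)
      show "(\<lambda>n. LINT x|M. wd 0 (w n) x * pderiv_mi \<alpha> \<phi> x) \<longlonglongrightarrow> (LINT x|M. G 0 x * pderiv_mi \<alpha> \<phi> x)"
        by (rule tendsto_integral_test[OF _ G0 test_functions_pderiv_mi[OF \<phi>] G(2)]) (use w weak_deriv_Lp(2)[of _ s 0] in \<open>auto simp: mi_order_0\<close>)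
      have "(LINT x|M. wd 0 (w n) x * pderiv_mi \<alpha> \<phi> x) = (-1) ^ mi_order \<alpha> * (LINT x|M. wd \<alpha> (w n) x * \<phi> x)" for n
        using weak_deriv_0_integral[OF w[rule_format, of n] test_functions_pderiv_mi[OF \<phi>]] weak_deriv_Lp(1)[OF w[rule_format] \<alpha>, of n] \<phi>
        by (simp add: is_weak_deriv_def)
      moreover have "(\<lambda>n. (-1) ^ mi_order \<alpha> * (LINT x|M. wd \<alpha> (w n) x * \<phi> x)) \<longlonglongrightarrow> (-1) ^ mi_order \<alpha> * (LINT x|M. G \<alpha> x * \<phi> x)"
        by (intro tendsto_mult_left tendsto_integral_test[OF _ G(1)[OF \<alpha>] \<phi> G(2)[OF \<alpha>]] weak_deriv_Lp(2)[OF w[rule_format] \<alpha>])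
      ultimately show "(\<lambda>n. LINT x|M. wd 0 (w n) x * pderiv_mi \<alpha> \<phi> x) \<longlonglongrightarrow> (-1) ^ mi_order \<alpha> * (LINT x|M. G \<alpha> x * \<phi> x)" by simp
    qed
    then show ?thesis using Lp_locally_integrable[OF p] G0 G(1)[OF \<alpha>] by (simp add: is_weak_deriv_def)
  qed
  have mem: "G 0 \<in> W s" using G(1) weak by (intro sobolev_fun_memI[OF G0]) blast
  have "(\<lambda>n. energy s (w n - G 0)) \<longlonglongrightarrow> (\<Sum>\<alpha> :: 'n multi_index | mi_order \<alpha> \<le> s. 0)"
    unfolding energy_minus[OF w[rule_format] mem]
  proof (rule tendsto_sum)
    fix \<alpha> :: "'n multi_index" assume "\<alpha> \<in> {\<alpha>. mi_order \<alpha> \<le> s}"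
    then have \<alpha>: "mi_order \<alpha> \<le> s" by simp
    have [measurable]: "wd \<alpha> (w n) \<in> borel_measurable M" "wd \<alpha> (G 0) \<in> borel_measurable M" "G \<alpha> \<in> borel_measurable M" for n
      using weak_deriv_Lp(2)[OF w[rule_format] \<alpha>] weak_deriv_Lp(2)[OF mem \<alpha>] G(1)[OF \<alpha>] by (auto simp: p_integrable_def)
    have "(LINT x|M. \<bar>wd \<alpha> (w n) x - wd \<alpha> (G 0) x\<bar> powr p) = (LINT x|M. \<bar>wd \<alpha> (w n) x - G \<alpha> x\<bar> powr p)" for n
      using weak_deriv_eqI[OF weak[OF \<alpha>]] by (intro integral_cong_AE) (auto elim: eventually_mono)
    then show "(\<lambda>n. LINT x|M. \<bar>wd \<alpha> (w n) x - wd \<alpha> (G 0) x\<bar> powr p) \<longlonglongrightarrow> 0" using G(2)[OF \<alpha>] by simp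
  qed
  then have "(\<lambda>n. energy s (w n - G 0)) \<longlonglongrightarrow> 0" by simp
  moreover have "0 powr (1 / p) = 0" by simp
  ultimately have "(\<lambda>n. NW s (w n - G 0)) \<longlonglongrightarrow> 0"
    unfolding sobolev_fun_norm_energy using p energy_nonneg
    by (intro tendsto_zero_powrI[where b="1/p"]) auto
  then show "\<exists>u\<in>W s. (\<lambda>n. NW s (w n - u)) \<longlonglongrightarrow> 0" using mem by blast
qed

lemma test_function_mem_sobolev_fun: "\<phi> \<in> test_functions D \<Longrightarrow> \<phi> \<in> W s"
  using p by (intro sobolev_fun_memI[where G="\<lambda>\<alpha>. pderiv_mi \<alpha> \<phi>"] conjI is_weak_deriv_test
    test_p_integrable[of _ D] test_functions_pderiv_mi) auto

lemma L1_le_sobolev_norm: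
  assumes "f \<in> W s" shows "(LINT x|M. \<bar>wd 0 f x\<bar>) \<le> (measure M (space M) + 1) * NW s f"
proof -
  have "(LINT x|M. \<bar>wd 0 f x\<bar> powr p) \<le> energy s f"
    unfolding energy_def by (rule member_le_sum[where i=0]) (auto intro: finite_mi_order_le simp: mi_order_0)
  then have "(LINT x|M. \<bar>wd 0 f x\<bar> powr p) powr (1 / p) \<le> NW s f"
    unfolding sobolev_fun_norm_energy using p by (intro powr_mono2) auto
  then have "(measure M (space M) + 1) * (LINT x|M. \<bar>wd 0 f x\<bar> powr p) powr (1 / p) \<le>
      (measure M (space M) + 1) * NW s f"
    by (intro mult_left_mono) auto
  then show ?thesis using L1_le_Lp[OF p weak_deriv_Lp(2)[OF assms, of 0]] by (simp add: mi_order_0)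
qed

lemma test_integral_bound:
  assumes f: "f \<in> W s" and \<phi>: "\<phi> \<in> test_functions D" and B: "\<And>x. \<bar>\<phi> x\<bar> \<le> B"
  shows "\<bar>LINT x|M. f x * \<phi> x\<bar> \<le> B * (measure M (space M) + 1) * NW s f"
proof -
  have 0: "is_weak_deriv D 0 f (wd 0 f)" "p_integrable M p (wd 0 f)" using weak_deriv_Lp[OF f, of 0] by (simp_all add: mi_order_0)
  have li: "locally_integrable D (wd 0 f)" using 0 by (simp add: is_weak_deriv_def)
  have B0: "B \<ge> 0" using B[of 0] by linarith
  have "\<bar>LINT x|M. f x * \<phi> x\<bar> = \<bar>LINT x|M. wd 0 f x * \<phi> x\<bar>" using weak_deriv_0_integral[OF f \<phi>] by simp
  also have "\<dots> \<le> (LINT x|M. B * \<bar>wd 0 f x\<bar>)"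
    unfolding real_norm_def[symmetric]
  proof (rule order_trans[OF integral_norm_bound integral_mono])
    show "integrable M (\<lambda>x. norm (wd 0 f x * \<phi> x))" by (rule integrable_norm[OF integrable_mult_test[OF li \<phi>]])
    show "integrable M (\<lambda>x. B * norm (wd 0 f x))" using p_integrable_imp_integrable[OF p 0(2)] by auto
    show "norm (wd 0 f x * \<phi> x) \<le> B * norm (wd 0 f x)" for x
      using mult_left_mono[OF B[of x], of "\<bar>wd 0 f x\<bar>"] by (simp add: abs_mult mult.commute)
  qed
  also have "\<dots> = B * (LINT x|M. \<bar>wd 0 f x\<bar>)" by simp
  also have "\<dots> \<le> B * ((measure M (space M) + 1) * NW s f)" using B0 by (intro mult_left_mono L1_le_sobolev_norm f)
  finally show ?thesis by (simp add: mult.assoc)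
qed

lemma test_norm_bound:
  obtains C where "C \<ge> 0" "\<And>\<phi>. \<phi> \<in> test_functions D \<Longrightarrow>
     NW s \<phi> \<le> C * (\<Sum>\<alpha> | mi_order \<alpha> \<le> s. SUP x. \<bar>pderiv_mi \<alpha> \<phi> x\<bar>)"
proof -
  define A where "A = {\<alpha> :: 'n multi_index. mi_order \<alpha> \<le> s}"
  define c where "c = real (card A) * measure M (space M)"
  have c: "c \<ge> 0" by (simp add: c_def)
  show ?thesis
  proof (rule that[of "c powr (1 / p)"])
    fix \<phi> :: "real ^ 'n \<Rightarrow> real" assume \<phi>: "\<phi> \<in> test_functions D"
    define S where "S \<alpha> = (SUP x. \<bar>pderiv_mi \<alpha> \<phi> x\<bar>)" for \<alpha>
    have le_S: "\<bar>pderiv_mi \<alpha> \<phi> x\<bar> \<le> S \<alpha>" for \<alpha> x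
      unfolding S_def using test_functions_bdd_above[OF test_functions_pderiv_mi[OF \<phi>]]
      by (intro cSUP_upper) auto
    have S0: "S \<alpha> \<ge> 0" for \<alpha> using le_S[of \<alpha> 0] by linarith
    define T where "T = sum S A"
    have ST: "S \<alpha> \<le> T" if "\<alpha> \<in> A" for \<alpha>
      unfolding T_def using that S0 finite_mi_order_le[of s] by (intro member_le_sum) (auto simp: A_def)
    have T0: "T \<ge> 0" unfolding T_def using S0 by (intro sum_nonneg) auto
    have "(LINT x|M. \<bar>wd \<alpha> \<phi> x\<bar> powr p) \<le> measure M (space M) * T powr p" if \<alpha>: "\<alpha> \<in> A" for \<alpha>
    proof -
      have i: "integrable M (\<lambda>x. \<bar>wd \<alpha> \<phi> x\<bar> powr p)" using \<alpha> by (intro integrable_wd[OF test_function_mem_sobolev_fun[OF \<phi>]]) (auto simp: A_def)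
      have "(LINT x|M. \<bar>wd \<alpha> \<phi> x\<bar> powr p) \<le> (LINT x|M. T powr p)"
      proof (rule integral_mono_AE[OF i])
        show "AE x in M. \<bar>wd \<alpha> \<phi> x\<bar> powr p \<le> T powr p"
          using weak_deriv_eqI[OF is_weak_deriv_test[OF \<phi>, of \<alpha>]]
        proof eventually_elim
          case (elim x)
          have "\<bar>pderiv_mi \<alpha> \<phi> x\<bar> \<le> T" using le_S[of \<alpha> x] ST[OF \<alpha>] by linarith
          then show ?case using elim p by (intro powr_mono2) auto
        qed
      qed simp
      then show ?thesis by simp
    qed
    then have "energy s \<phi> \<le> (\<Sum>\<alpha>\<in>A. measure M (space M) * T powr p)" unfolding energy_def A_def[symmetric] by (rule sum_mono)
    also have "\<dots> = c * T powr p" by (simp add: c_def)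
    finally have "NW s \<phi> \<le> (c * T powr p) powr (1 / p)"
      unfolding sobolev_fun_norm_energy using p energy_nonneg by (intro powr_mono2) auto
    also have "\<dots> = c powr (1 / p) * T" using c T0 p by (simp add: powr_mult powr_powr)
    finally show "NW s \<phi> \<le> c powr (1 / p) * (\<Sum>\<alpha> | mi_order \<alpha> \<le> s. SUP x. \<bar>pderiv_mi \<alpha> \<phi> x\<bar>)"
      by (simp add: T_def S_def A_def)
  qed simp
qed

abbreviation W0 where "W0 s \<equiv> sobolev_fun0 s p D"

lemma sobolev_fun0_subset: "W0 s \<subseteq> W s"
  by (auto simp: sobolev_fun0_def)

lemma test_function_mem_sobolev_fun0: assumes "\<phi> \<in> test_functions D" shows "\<phi> \<in> W0 s"
proof -
  interpret seminormed "W s" "NW s" by (rule seminormed_sobolev_fun)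
  have "NW s (\<phi> - \<phi>) < e" if "e > 0" for e using N_zero that by simp
  then show ?thesis using assms test_function_mem_sobolev_fun[OF assms] unfolding sobolev_fun0_def by blast
qed

lemma sobolev_fun0_lincomb: assumes f: "f \<in> W0 s" and g: "g \<in> W0 s" shows "fscale c f + fscale d g \<in> W0 s"
proof -
  interpret seminormed "W s" "NW s" by (rule seminormed_sobolev_fun)
  let ?N = "NW s"
  have fW: "f \<in> W s" and gW: "g \<in> W s" using f g sobolev_fun0_subset by auto
  have "\<exists>\<phi>\<in>test_functions D. ?N (fscale c f + fscale d g - \<phi>) < e" if e: "e > 0" for e
  proof -
    define \<delta> where "\<delta> = e / (\<bar>c\<bar> + \<bar>d\<bar> + 1)"
    have \<delta>: "\<delta> > 0" using e by (simp add: \<delta>_def add_nonneg_pos)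
    obtain \<phi> where \<phi>: "\<phi> \<in> test_functions D" "?N (f - \<phi>) < \<delta>"
      using f \<delta> unfolding sobolev_fun0_def by auto
    obtain \<psi> where \<psi>: "\<psi> \<in> test_functions D" "?N (g - \<psi>) < \<delta>"
      using g \<delta> unfolding sobolev_fun0_def by auto
    note mem = diff_mem[OF fW test_function_mem_sobolev_fun[OF \<phi>(1)]] diff_mem[OF gW test_function_mem_sobolev_fun[OF \<psi>(1)]]
    have eq: "fscale c f + fscale d g - (fscale c \<phi> + fscale d \<psi>) = fscale c (f - \<phi>) + fscale d (g - \<psi>)"
      by (auto simp: fscale_def algebra_simps)
    have "?N (fscale c f + fscale d g - (fscale c \<phi> + fscale d \<psi>)) \<le> ?N (fscale c (f - \<phi>)) + ?N (fscale d (g - \<psi>))"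
      unfolding eq by (intro N_triangle scale_mem mem)
    also have "\<dots> = \<bar>c\<bar> * ?N (f - \<phi>) + \<bar>d\<bar> * ?N (g - \<psi>)" using mem N_scale by simp
    also have "\<dots> \<le> \<bar>c\<bar> * \<delta> + \<bar>d\<bar> * \<delta>" using \<phi> \<psi> by (intro add_mono mult_left_mono) auto
    also have "\<dots> < (\<bar>c\<bar> + \<bar>d\<bar> + 1) * \<delta>" using \<delta> by (simp add: distrib_right)
    also have "\<dots> = e" by (simp add: \<delta>_def add_nonneg_pos less_imp_neq[symmetric])
    finally have "?N (fscale c f + fscale d g - (fscale c \<phi> + fscale d \<psi>)) < e" by simp
    then show ?thesis
      by (rule bexI[of _ "fscale c \<phi> + fscale d \<psi>"]) (intro test_functions_add test_functions_fscale \<phi>(1) \<psi>(1))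
  qed
  then show ?thesis using sobolev_fun_lincomb[OF fW gW] unfolding sobolev_fun0_def by blast
qed

lemma seminormed_sobolev_fun0: "seminormed (W0 s) (NW s)"
proof -
  interpret seminormed "W s" "NW s" by (rule seminormed_sobolev_fun)
  show ?thesis
  proof
    show "u + w \<in> W0 s" if "u \<in> W0 s" "w \<in> W0 s" for u w using sobolev_fun0_lincomb[OF that, of 1 1] by simp
    show "fscale c u \<in> W0 s" if "u \<in> W0 s" for c u using sobolev_fun0_lincomb[OF that that, of c 0] by simp
    show "0 \<in> W0 s" by (rule test_function_mem_sobolev_fun0[OF test_functions_zero])
  qed (use sobolev_fun0_subset N_scale N_triangle in blast)+
qed

lemma uniformly_smooth_sobolev_fun0: "uniformly_smooth (W0 s) (NW s)"
proof -
  have "uniformly_smooth (W0 s) (\<lambda>f. energy s f powr (1 / p))"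
  proof (rule uniformly_smooth_powr)
    show "u + fscale c w \<in> W0 s" if "u \<in> W0 s" "w \<in> W0 s" for u w c using sobolev_fun0_lincomb[OF that, of 1 c] by simp
    fix e :: real assume "e > 0"
    from energy_uniformly_smooth[OF this, of s] sobolev_fun0_subset show "\<exists>t>0. \<forall>x\<in>W0 s. \<forall>y\<in>W0 s.
       energy s (x + fscale t y) + energy s (x - fscale t y) \<le> 2 * energy s x + e * t * (energy s x + energy s y)" by blast
  qed (use p energy_nonneg convex_on_powr in auto)
  then show ?thesis by (simp add: sobolev_fun_norm_energy[abs_def])
qed

end

section \<open>Sobolev spaces of distributions\<close>

context sobolev_setting begin

lemma dist_of_fun_add: "f \<in> W s \<Longrightarrow> g \<in> W s \<Longrightarrow> dist_of_fun D (f + g) = dist_of_fun D f + dist_of_fun D g"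
  and dist_of_fun_fscale: "f \<in> W s \<Longrightarrow> dist_of_fun D (fscale c f) = fscale c (dist_of_fun D f)"
proof -
  have li: "locally_integrable D f" if "f \<in> W s" for f using Lp_locally_integrable[OF p sobolev_fun_p_integrable[OF that]] .
  show "f \<in> W s \<Longrightarrow> g \<in> W s \<Longrightarrow> dist_of_fun D (f + g) = dist_of_fun D f + dist_of_fun D g"
    using test_lincomb_integral[OF li li, of f g _ 1 1] by (auto simp: dist_of_fun_def fun_eq_iff)
  show "f \<in> W s \<Longrightarrow> dist_of_fun D (fscale c f) = fscale c (dist_of_fun D f)"
    using test_lincomb_integral[OF li li, of f f _ c 0] by (auto simp: dist_of_fun_def fun_eq_iff fscale_def)
qed

text \<open>
  Functions with the same distribution have the same weak derivatives, so even the choices made by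
  \<open>weak_deriv\<close> coincide.
\<close>

lemma sobolev_fun_norm_cong:
  assumes f: "f \<in> W s" and g: "g \<in> W s" and eq: "dist_of_fun D f = dist_of_fun D g"
  shows "NW s f = NW s g"
proof -
  have li: "locally_integrable D f" "locally_integrable D g" using Lp_locally_integrable[OF p] sobolev_fun_p_integrable f g by blast+
  have int: "(LINT x|M. f x * \<phi> x) = (LINT x|M. g x * \<phi> x)" if "\<phi> \<in> test_functions D" for \<phi>
    using fun_cong[OF eq, of \<phi>] that by (simp add: dist_of_fun_def)
  have "is_weak_deriv D \<alpha> f = is_weak_deriv D \<alpha> g" for \<alpha>
    unfolding is_weak_deriv_def using li int[OF test_functions_pderiv_mi] by (auto simp: fun_eq_iff)
  then show ?thesis unfolding sobolev_fun_norm_def weak_deriv_def by simp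
qed

lemma sobolev_norm_dist_of_fun:
  assumes f: "f \<in> W (nat s)" and s: "0 \<le> s"
  shows "sobolev_norm s p D (dist_of_fun D f) = NW (nat s) f"
proof -
  have "\<exists>g. g \<in> W (nat s) \<and> dist_of_fun D g = dist_of_fun D f" using f by blast
  from someI_ex[OF this] show ?thesis
    using sobolev_fun_norm_cong[OF _ f] s by (simp add: sobolev_norm_def)
qed

abbreviation W0_dual where "W0_dual s \<equiv> dual (W0 s) (NW s)"
abbreviation W0_dual_norm where "W0_dual_norm s \<equiv> dual_norm (W0 s) (NW s)"

text \<open>
  Test functions are dense in \<open>W0 s\<close>.
\<close>

lemma W0_dual_eqI:
  assumes l: "l \<in> W0_dual s" and l': "l' \<in> W0_dual s" and eq: "\<And>\<phi>. \<phi> \<in> test_functions D \<Longrightarrow> l \<phi> = l' \<phi>"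
  shows "l = l'"
proof
  fix f
  interpret W0: seminormed "W0 s" "NW s" by (rule seminormed_sobolev_fun0)
  interpret dual: seminormed "W0_dual s" "W0_dual_norm s" by (rule W0.seminormed_dual)
  show "l f = l' f"
  proof (cases "f \<in> W0 s")
    case True
    let ?m = "l - l'"
    have m: "?m \<in> W0_dual s" by (rule dual.diff_mem[OF l l'])
    have "\<bar>?m f\<bar> \<le> 0"
    proof (rule field_le_epsilon)
      fix e :: real assume e: "e > 0"
      define \<delta> where "\<delta> = e / (W0_dual_norm s ?m + 1)"
      have nn: "0 \<le> W0_dual_norm s ?m" by (rule dual.N_nonneg[OF m])
      have "\<delta> > 0" using e nn by (simp add: \<delta>_def)
      then obtain \<phi> where \<phi>: "\<phi> \<in> test_functions D" "NW s (f - \<phi>) < \<delta>"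
        using True unfolding sobolev_fun0_def by auto
      have "?m f = ?m (f - \<phi>)" using W0.dual_diff[OF m True test_function_mem_sobolev_fun0[OF \<phi>(1)]] eq[OF \<phi>(1)] by simp
      then have "\<bar>?m f\<bar> \<le> W0_dual_norm s ?m * NW s (f - \<phi>)"
        using W0.dual_norm_bound[OF m W0.diff_mem[OF True test_function_mem_sobolev_fun0[OF \<phi>(1)]]] by simp
      also have "\<dots> \<le> W0_dual_norm s ?m * \<delta>" using nn \<phi>(2) by (intro mult_left_mono) auto
      also have "\<dots> \<le> (W0_dual_norm s ?m + 1) * \<delta>" using \<open>\<delta> > 0\<close> by (intro mult_right_mono) auto
      also have "\<dots> = e" using nn by (simp add: \<delta>_def)
      finally show "\<bar>?m f\<bar> \<le> 0 + e" by simp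
    qed
    then show ?thesis by simp
  next
    case False
    then show ?thesis using W0.dual_outside l l' by metis
  qed
qed

lemma seminormed_W0_dual: "seminormed (W0_dual s) (W0_dual_norm s)"
  and complete_W0_dual: "complete_under (W0_dual s) (W0_dual_norm s)"
  and uniformly_convexifiable_W0_dual: "uniformly_convexifiable (W0_dual s) (W0_dual_norm s)"
  using seminormed.seminormed_dual[OF seminormed_sobolev_fun0] seminormed.complete_dual[OF seminormed_sobolev_fun0]
    seminormed.uniformly_convexifiable_dual[OF seminormed_sobolev_fun0 uniformly_smooth_sobolev_fun0]
  by auto

end

lemma conj_exponent_gt_1: "1 < p \<Longrightarrow> 1 < conj_exponent p"
  by (simp add: conj_exponent_def divide_simps)

context sobolev_setting begin

lemma conj_setting: "sobolev_setting D (conj_exponent p)"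
  by unfold_locales (rule conj_exponent_gt_1[OF p])

abbreviation "S s \<equiv> sobolev s p D"
abbreviation "NS s \<equiv> sobolev_norm s p D"

lemma sobolev_norm_dist_of_functional:
  assumes l: "l \<in> sobolev_neg (nat (- s)) p D" and s: "s < 0"
  shows "NS s (dist_of_functional D l) = sobolev_neg_norm (nat (- s)) p D l"
proof -
  interpret conj: sobolev_setting D "conj_exponent p" by (rule conj_setting)
  have "\<exists>l'. l' \<in> sobolev_neg (nat (- s)) p D \<and> dist_of_functional D l' = dist_of_functional D l" using l by blast
  from someI_ex[OF this] obtain l' where l': "l' = (SOME l'. l' \<in> sobolev_neg (nat (- s)) p D \<and> dist_of_functional D l' = dist_of_functional D l)"
    "l' \<in> sobolev_neg (nat (- s)) p D" "dist_of_functional D l' = dist_of_functional D l" by blast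
  have "l' = l"
    by (rule conj.W0_dual_eqI[OF l'(2) l]) (use fun_cong[OF l'(3)] in \<open>auto simp: dist_of_functional_def split: if_splits\<close>, metis)
  then show ?thesis using s l'(1) by (simp add: sobolev_norm_def)
qed

lemma seminormed_sobolev: "seminormed (S s) (NS s)"
  and complete_sobolev: "complete_under (S s) (NS s)"
  and uniformly_convexifiable_sobolev: "uniformly_convexifiable (S s) (NS s)"
proof -
  have "seminormed (S s) (NS s) \<and> complete_under (S s) (NS s) \<and> uniformly_convexifiable (S s) (NS s)"
  proof (cases "0 \<le> s")
    case True
    interpret V: seminormed "W (nat s)" "NW (nat s)" by (rule seminormed_sobolev_fun)
    note J = dist_of_fun_add[where s="nat s"] dist_of_fun_fscale[where s="nat s"] sobolev_norm_dist_of_fun[OF _ True]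
    have "S s = dist_of_fun D ` W (nat s)" using True by (simp add: sobolev_def)
    then show ?thesis
      using V.seminormed_image[of "dist_of_fun D" "NS s"] V.complete_image[of "dist_of_fun D" "NS s"]
        V.uniformly_convexifiable_image[of "dist_of_fun D" "NS s"] J
        complete_sobolev_fun uniformly_convexifiable_sobolev_fun by simp
  next
    case False
    interpret conj: sobolev_setting D "conj_exponent p" by (rule conj_setting)
    let ?J = "dist_of_functional D"
    interpret V: seminormed "sobolev_neg (nat (- s)) p D" "sobolev_neg_norm (nat (- s)) p D" by (rule conj.seminormed_W0_dual)
    have J: "?J (u + w) = ?J u + ?J w" "?J (fscale c u) = fscale c (?J u)" for u w c
      by (auto simp: dist_of_functional_def fscale_def fun_eq_iff)
    have N: "NS s (?J l) = sobolev_neg_norm (nat (- s)) p D l" if "l \<in> sobolev_neg (nat (- s)) p D" for l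
      using sobolev_norm_dist_of_functional[OF that] False by simp
    have "S s = ?J ` sobolev_neg (nat (- s)) p D" using False by (simp add: sobolev_def)
    then show ?thesis
      using V.seminormed_image[of ?J "NS s", OF J N] V.complete_image[of ?J "NS s", OF J N]
        V.uniformly_convexifiable_image[of ?J "NS s", OF J N]
        conj.complete_W0_dual conj.uniformly_convexifiable_W0_dual by simp
  qed
  then show "seminormed (S s) (NS s)" "complete_under (S s) (NS s)" "uniformly_convexifiable (S s) (NS s)" by auto
qed

lemma sobolev_linear_functional: assumes "T \<in> S s" shows "T \<in> linear_functionals (test_functions D)"
proof (cases "0 \<le> s")
  case True
  then obtain f where f: "f \<in> W (nat s)" "T = dist_of_fun D f" using assms by (auto simp: sobolev_def)
  have li: "locally_integrable D f" using Lp_locally_integrable[OF p sobolev_fun_p_integrable[OF f(1)]] .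
  have "(LINT x|M. f x * (u + w) x) = (LINT x|M. f x * u x) + (LINT x|M. f x * w x)"
    if "u \<in> test_functions D" "w \<in> test_functions D" for u w
    using integrable_mult_test[OF li that(1)] integrable_mult_test[OF li that(2)] by (simp add: distrib_left)
  moreover have "(LINT x|M. f x * fscale c u x) = c * (LINT x|M. f x * u x)" for c u
    by (simp add: fscale_def mult.left_commute)
  ultimately show ?thesis
    unfolding linear_functionals_def f(2) dist_of_fun_def by (simp add: test_functions_add test_functions_fscale)
next
  case False
  interpret conj: sobolev_setting D "conj_exponent p" by (rule conj_setting)
  interpret V: seminormed "conj.W0 (nat (- s))" "sobolev_fun_norm (nat (- s)) (conj_exponent p) D" by (rule conj.seminormed_sobolev_fun0)
  obtain l where l: "l \<in> sobolev_neg (nat (- s)) p D" "T = dist_of_functional D l" using assms False by (auto simp: sobolev_def)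
  show ?thesis
    unfolding linear_functionals_def l(2) dist_of_functional_def
    using V.dual_add[OF l(1) conj.test_function_mem_sobolev_fun0 conj.test_function_mem_sobolev_fun0] V.dual_scale[OF l(1) conj.test_function_mem_sobolev_fun0]
    by (simp add: test_functions_add test_functions_fscale)
qed

text \<open>
  This estimate has two purposes: it shows that the functionals in \<open>S s\<close> are distributions, and that
  convergence in norm implies convergence on every test function.
\<close>

lemma sobolev_eval_bound:
  obtains C K where "C \<ge> 0" "\<And>T \<phi>. T \<in> S s \<Longrightarrow> \<phi> \<in> test_functions D \<Longrightarrow>
     \<bar>T \<phi>\<bar> \<le> C * NS s T * (\<Sum>\<alpha> | mi_order \<alpha> \<le> K. SUP x. \<bar>pderiv_mi \<alpha> \<phi> x\<bar>)"
proof (cases "0 \<le> s")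
  case True
  \<comment> \<open>For \<open>s \<ge> 0\<close> the estimate holds with the supremum of \<open>\<phi>\<close> alone.\<close>
  have idx: "{\<alpha> :: 'n multi_index. mi_order \<alpha> \<le> 0} = {0}"
    by (auto simp: mi_order_def vec_eq_iff)
  show ?thesis
  proof (rule that[of "measure M (space M) + 1" 0])
    fix T and \<phi> :: "real ^ 'n \<Rightarrow> real" assume "T \<in> S s" and \<phi>: "\<phi> \<in> test_functions D"
    then obtain f where f: "f \<in> W (nat s)" "T = dist_of_fun D f" using True by (auto simp: sobolev_def)
    have "\<bar>\<phi> x\<bar> \<le> (SUP x. \<bar>\<phi> x\<bar>)" for x
      using test_functions_bdd_above[OF \<phi>] by (intro cSUP_upper) auto
    from test_integral_bound[OF f(1) \<phi> this]
    have "\<bar>T \<phi>\<bar> \<le> (SUP x. \<bar>\<phi> x\<bar>) * (measure M (space M) + 1) * NS s T"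
      using \<phi> unfolding f(2) sobolev_norm_dist_of_fun[OF f(1) True] by (simp add: dist_of_fun_def)
    then show "\<bar>T \<phi>\<bar> \<le> (measure M (space M) + 1) * NS s T * (\<Sum>\<alpha> | mi_order \<alpha> \<le> 0. SUP x. \<bar>pderiv_mi \<alpha> \<phi> x\<bar>)"
      unfolding idx by (simp add: pderiv_mi_0 mult_ac)
  qed (simp add: add_nonneg_nonneg)
next
  case False
  interpret conj: sobolev_setting D "conj_exponent p" by (rule conj_setting)
  interpret V: seminormed "conj.W0 (nat (- s))" "sobolev_fun_norm (nat (- s)) (conj_exponent p) D" by (rule conj.seminormed_sobolev_fun0)
  obtain C where C: "C \<ge> 0" "\<And>\<phi>. \<phi> \<in> test_functions D \<Longrightarrow>
     sobolev_fun_norm (nat (- s)) (conj_exponent p) D \<phi> \<le> C * (\<Sum>\<alpha> | mi_order \<alpha> \<le> nat (- s). SUP x. \<bar>pderiv_mi \<alpha> \<phi> x\<bar>)"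
    using conj.test_norm_bound[of "nat (- s)"] by metis
  show ?thesis
  proof (rule that[OF C(1), of "nat (- s)"])
    fix T and \<phi> :: "real ^ 'n \<Rightarrow> real" assume "T \<in> S s" and \<phi>: "\<phi> \<in> test_functions D"
    then obtain l where l: "l \<in> sobolev_neg (nat (- s)) p D" "T = dist_of_functional D l" using False by (auto simp: sobolev_def)
    have N: "NS s T = sobolev_neg_norm (nat (- s)) p D l"
      using sobolev_norm_dist_of_functional[OF l(1)] l(2) False by simp
    have "\<bar>T \<phi>\<bar> = \<bar>l \<phi>\<bar>" using \<phi> by (simp add: l(2) dist_of_functional_def)
    also have "\<dots> \<le> NS s T * sobolev_fun_norm (nat (- s)) (conj_exponent p) D \<phi>"
      unfolding N by (rule V.dual_norm_bound[OF l(1) conj.test_function_mem_sobolev_fun0[OF \<phi>]])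
    also have "\<dots> \<le> NS s T * (C * (\<Sum>\<alpha> | mi_order \<alpha> \<le> nat (- s). SUP x. \<bar>pderiv_mi \<alpha> \<phi> x\<bar>))"
      using V.dual_norm_nonneg[OF l(1)] unfolding N by (intro mult_left_mono C(2) \<phi>)
    finally show "\<bar>T \<phi>\<bar> \<le> C * NS s T * (\<Sum>\<alpha> | mi_order \<alpha> \<le> nat (- s). SUP x. \<bar>pderiv_mi \<alpha> \<phi> x\<bar>)" by (simp add: mult_ac)
  qed
qed

end

section \<open>Vector valued distributions\<close>

lemma bounded_linear_axis: "bounded_linear (axis r :: real \<Rightarrow> real ^ 'k::finite)"
proof -
  have eq: "(axis r :: real \<Rightarrow> real ^ 'k) = (\<lambda>y. y *\<^sub>R axis r 1)" by (auto simp: axis_def vec_eq_iff fun_eq_iff)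
  show ?thesis by (subst eq) (rule bounded_linear_scaleR_left)
qed

lemma linear_functionals_add: "T \<in> linear_functionals V \<Longrightarrow> u \<in> V \<Longrightarrow> w \<in> V \<Longrightarrow> T (u + w) = T u + T w"
  and linear_functionals_scale: "T \<in> linear_functionals V \<Longrightarrow> u \<in> V \<Longrightarrow> T (fscale c u) = c * T u"
  and linear_functionals_outside: "T \<in> linear_functionals V \<Longrightarrow> u \<notin> V \<Longrightarrow> T u = 0"
  by (auto simp: linear_functionals_def)

lemma linear_functionals_test_zero: "T \<in> linear_functionals (test_functions D) \<Longrightarrow> T 0 = 0"
  using linear_functionals_scale[of T "test_functions D" 0 0] test_functions_zero by auto

lemma test_functions_axis:
  fixes \<phi> :: "real ^ 'n::finite \<Rightarrow> real"
  shows "\<phi> \<in> test_functions D \<Longrightarrow> (\<lambda>x. axis r (\<phi> x) :: real ^ 'k::finite) \<in> test_functions D"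
  by (rule test_functions_linear[OF bounded_linear_axis])

lemma test_functions_nth:
  fixes \<phi> :: "real ^ 'n::finite \<Rightarrow> real ^ 'k::finite"
  shows "\<phi> \<in> test_functions D \<Longrightarrow> (\<lambda>x. \<phi> x $ r) \<in> test_functions D"
  by (rule test_functions_linear[OF bounded_linear_vec_nth])

lemma test_functions_axis_iff:
  fixes \<phi> :: "real ^ 'n::finite \<Rightarrow> real"
  shows "(\<lambda>x. axis r (\<phi> x) :: real ^ 'k::finite) \<in> test_functions D \<longleftrightarrow> \<phi> \<in> test_functions D"
  using test_functions_axis[of \<phi> D r] test_functions_nth[of "\<lambda>x. axis r (\<phi> x) :: real ^ 'k" D r] by auto

lemma linear_functional_decompose:
  fixes u :: "('n::finite, 'k::finite) vdist"
  assumes u: "u \<in> linear_functionals (test_functions D)" and \<phi>: "\<phi> \<in> test_functions D"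
  shows "u \<phi> = (\<Sum>r\<in>UNIV. dist_component r u (\<lambda>x. \<phi> x $ r))"
proof -
  let ?f = "\<lambda>r. (\<lambda>x. axis r (\<phi> x $ r)) :: real ^ 'n \<Rightarrow> real ^ 'k"
  have mem: "?f r \<in> test_functions D" for r using \<phi> test_functions_axis test_functions_nth by blast
  have "(\<lambda>x. \<Sum>r\<in>A. ?f r x) \<in> test_functions D \<and> u (\<lambda>x. \<Sum>r\<in>A. ?f r x) = (\<Sum>r\<in>A. u (?f r))" if "finite A" for A
    using that
  proof induction
    case empty then show ?case using linear_functionals_test_zero[OF u] test_functions_zero[of D] by (simp add: zero_fun_def)
  next
    case (insert r A)
    have "(\<lambda>x. \<Sum>r\<in>insert r A. ?f r x) = ?f r + (\<lambda>x. \<Sum>r\<in>A. ?f r x)" using insert by auto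
    then show ?case using insert linear_functionals_add[OF u mem[of r]] test_functions_add[OF mem[of r]] by simp
  qed
  from this[of UNIV] have "u (\<lambda>x. \<Sum>r\<in>UNIV. ?f r x) = (\<Sum>r\<in>UNIV. u (?f r))" by simp
  moreover have "(\<lambda>x. \<Sum>r\<in>UNIV. ?f r x) = \<phi>"
  proof
    fix x show "(\<Sum>r\<in>UNIV. ?f r x) = \<phi> x"
      by (simp add: vec_eq_iff axis_def if_distrib[of "\<lambda>y. y $ _"] cong: if_cong)
  qed
  ultimately show ?thesis by (simp add: dist_component_def)
qed

lemma dist_component_add: "dist_component r (u + w) = dist_component r u + dist_component r w"
  and dist_component_fscale: "dist_component r (fscale c u) = fscale c (dist_component r u)"
  and dist_component_diff: "dist_component r (u - w) = dist_component r u - dist_component r w"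
  by (auto simp: dist_component_def fscale_def fun_eq_iff)

lemma diff_op_add: "diff_op a m (u + w) \<phi> = diff_op a m u \<phi> + diff_op a m w \<phi>"
  and diff_op_fscale: "diff_op a m (fscale c u) \<phi> = c * diff_op a m u \<phi>"
  by (auto simp: diff_op_def dist_mult_def dist_deriv_def fscale_def distrib_left sum.distrib sum_distrib_left mult.left_commute)

lemma diff_op_tendsto:
  assumes "\<And>\<phi>. (\<lambda>n. w n \<phi>) \<longlonglongrightarrow> u \<phi>" shows "(\<lambda>n. diff_op a m (w n) \<phi>) \<longlonglongrightarrow> diff_op a m u \<phi>"
  unfolding diff_op_def dist_mult_def dist_deriv_def by (intro tendsto_sum tendsto_mult_left assms)

text \<open>
  Each \<open>x i powr p\<close> is at most \<open>x i * sum x A powr (p - 1)\<close>.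
\<close>

lemma sum_powr_le_powr_sum:
  fixes x :: "'i \<Rightarrow> real"
  assumes "finite A" "\<And>i. i \<in> A \<Longrightarrow> 0 \<le> x i" "p \<ge> 1"
  shows "(\<Sum>i\<in>A. x i powr p) powr (1 / p) \<le> sum x A"
proof -
  have X: "0 \<le> sum x A" using assms by (intro sum_nonneg)
  have eq: "y powr p = y * y powr (p - 1)" if "y \<ge> 0" for y :: real
    using that assms(3) by (cases "y = 0") (auto simp: powr_diff)
  have "(\<Sum>i\<in>A. x i powr p) = (\<Sum>i\<in>A. x i * x i powr (p - 1))" using assms eq by (intro sum.cong) auto
  also have "\<dots> \<le> (\<Sum>i\<in>A. x i * sum x A powr (p - 1))"
    using assms by (intro sum_mono mult_left_mono powr_mono2 member_le_sum) auto
  also have "\<dots> = sum x A powr p" using eq[OF X] by (simp add: sum_distrib_right)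
  finally have "(\<Sum>i\<in>A. x i powr p) powr (1 / p) \<le> (sum x A powr p) powr (1 / p)"
    using assms by (intro powr_mono2 sum_nonneg) auto
  then show ?thesis using X assms(3) by (simp add: powr_powr)
qed

context sobolev_setting begin

context
  fixes a :: "('n, 'k::finite) coeffs" and m :: nat and s :: int
begin

abbreviation V :: "('n, 'k) vdist set" where "V \<equiv> sobolev_solutions a m s p D"
abbreviation NV :: "('n, 'k) vdist \<Rightarrow> real" where "NV \<equiv> sobolev_vec_norm s p D"

interpretation S: seminormed "S s" "NS s" by (rule seminormed_sobolev)

text \<open>
  The continuity estimate that is required of a distribution follows from the estimates for the
  components, so for a limit of solutions it need not be verified separately.
\<close>

lemma distributionsI:
  fixes u :: "('n, 'k) vdist"
  assumes u: "u \<in> linear_functionals (test_functions D)" and comp: "\<And>r. dist_component r u \<in> S s"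
  shows "u \<in> distributions D"
proof -
  obtain C K where C: "C \<ge> 0" "\<And>T \<phi>. T \<in> S s \<Longrightarrow> \<phi> \<in> test_functions D \<Longrightarrow>
     \<bar>T \<phi>\<bar> \<le> C * NS s T * (\<Sum>\<alpha> | mi_order \<alpha> \<le> K. SUP x. \<bar>pderiv_mi \<alpha> \<phi> x\<bar>)"
    using sobolev_eval_bound[of s] by metis
  define B where "B = (\<Sum>r\<in>UNIV. C * NS s (dist_component r u))"
  have "\<bar>u \<phi>\<bar> \<le> B * (\<Sum>\<alpha> | mi_order \<alpha> \<le> K. SUP x. norm (pderiv_mi \<alpha> \<phi> x))" if \<phi>: "\<phi> \<in> test_functions D" for \<phi>
  proof -
    have sup: "(SUP x. \<bar>pderiv_mi \<alpha> (\<lambda>x. \<phi> x $ r) x\<bar>) \<le> (SUP x. norm (pderiv_mi \<alpha> \<phi> x))" for \<alpha> r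
    proof (rule cSUP_mono)
      show "bdd_above (range (\<lambda>x. norm (pderiv_mi \<alpha> \<phi> x)))"
        by (rule test_functions_bdd_above[OF test_functions_pderiv_mi[OF \<phi>]])
      fix x
      have "pderiv_mi \<alpha> (\<lambda>x. \<phi> x $ r) x = pderiv_mi \<alpha> \<phi> x $ r"
        using pderiv_mi_linear[OF bounded_linear_vec_nth test_functions_smooth[OF \<phi>]] by metis
      then show "\<exists>y\<in>UNIV. \<bar>pderiv_mi \<alpha> (\<lambda>x. \<phi> x $ r) x\<bar> \<le> norm (pderiv_mi \<alpha> \<phi> y)"
        using component_le_norm_cart[of "pderiv_mi \<alpha> \<phi> x" r] by auto
    qed simp
    have "\<bar>u \<phi>\<bar> \<le> (\<Sum>r\<in>UNIV. \<bar>dist_component r u (\<lambda>x. \<phi> x $ r)\<bar>)"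
      unfolding linear_functional_decompose[OF u \<phi>] by (rule sum_abs)
    also have "\<dots> \<le> (\<Sum>r\<in>UNIV. C * NS s (dist_component r u) * (\<Sum>\<alpha> | mi_order \<alpha> \<le> K. SUP x. norm (pderiv_mi \<alpha> \<phi> x)))"
    proof (rule sum_mono)
      fix r
      have "\<bar>dist_component r u (\<lambda>x. \<phi> x $ r)\<bar> \<le> C * NS s (dist_component r u) * (\<Sum>\<alpha> | mi_order \<alpha> \<le> K. SUP x. \<bar>pderiv_mi \<alpha> (\<lambda>x. \<phi> x $ r) x\<bar>)"
        by (rule C(2)[OF comp test_functions_nth[OF \<phi>]])
      also have "\<dots> \<le> C * NS s (dist_component r u) * (\<Sum>\<alpha> | mi_order \<alpha> \<le> K. SUP x. norm (pderiv_mi \<alpha> \<phi> x))"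
        using C(1) S.N_nonneg[OF comp] sup by (intro mult_left_mono sum_mono) auto
      finally show "\<bar>dist_component r u (\<lambda>x. \<phi> x $ r)\<bar> \<le> C * NS s (dist_component r u) * (\<Sum>\<alpha> | mi_order \<alpha> \<le> K. SUP x. norm (pderiv_mi \<alpha> \<phi> x))" .
    qed
    finally show ?thesis by (simp add: B_def sum_distrib_right)
  qed
  then show ?thesis using u unfolding distributions_def by blast
qed

lemma sobolev_solutions_iff:
  "u \<in> V \<longleftrightarrow> u \<in> linear_functionals (test_functions D) \<and> (\<forall>r. dist_component r u \<in> S s) \<and>
     (\<forall>\<phi>\<in>test_functions D. diff_op a m u \<phi> = 0)"
  using distributionsI[of u] by (auto simp: sobolev_solutions_def solutions_def vanishes_on_def distributions_def)

lemma sobolev_solutions_zero: "0 \<in> V"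
proof -
  have "dist_component r (0 :: ('n, 'k) vdist) = 0" for r by (auto simp: dist_component_def)
  then show ?thesis using S.zero_mem
    by (auto simp: sobolev_solutions_iff linear_functionals_def diff_op_def dist_mult_def dist_deriv_def)
qed

lemma sobolev_solutions_add: "u \<in> V \<Longrightarrow> w \<in> V \<Longrightarrow> u + w \<in> V"
  unfolding sobolev_solutions_iff by (auto simp: dist_component_add diff_op_add linear_functionals_def algebra_simps intro!: S.add_mem)

lemma sobolev_solutions_fscale: "u \<in> V \<Longrightarrow> fscale c u \<in> V"
  unfolding sobolev_solutions_iff by (auto simp: dist_component_fscale diff_op_fscale linear_functionals_def fscale_apply algebra_simps intro!: S.scale_mem)

lemma dist_component_mem_sobolev: "u \<in> V \<Longrightarrow> dist_component r u \<in> S s"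
  by (simp add: sobolev_solutions_iff)

lemma seminormed_sobolev_solutions: "seminormed V NV"
  unfolding sobolev_vec_norm_def[abs_def]
proof (rule seminormed_powr[OF _ sobolev_solutions_zero sobolev_solutions_add sobolev_solutions_fscale])
  show "0 < p" using p by simp
  show "0 \<le> (\<Sum>r\<in>UNIV. NS s (dist_component r u) powr p)" for u :: "('n, 'k) vdist" by (intro sum_nonneg) simp
  show "(\<Sum>r\<in>UNIV. NS s (dist_component r (fscale c u)) powr p) = \<bar>c\<bar> powr p * (\<Sum>r\<in>UNIV. NS s (dist_component r u) powr p)"
    if "u \<in> V" for c u
    unfolding dist_component_fscale sum_distrib_left
    using S.N_scale[OF dist_component_mem_sobolev[OF that]] S.N_nonneg[OF dist_component_mem_sobolev[OF that]] by (simp add: powr_mult)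
  fix u w c d assume u: "u \<in> V" and w: "w \<in> V" and cd: "0 \<le> c" "0 \<le> d" "c + d = (1::real)"
  have "(\<Sum>r\<in>UNIV. NS s (dist_component r (fscale c u + fscale d w)) powr p) \<le>
      (\<Sum>r\<in>UNIV. c * NS s (dist_component r u) powr p + d * NS s (dist_component r w) powr p)"
  proof (rule sum_mono)
    fix r
    let ?u = "dist_component r u" and ?w = "dist_component r w"
    have mem: "?u \<in> S s" "?w \<in> S s" using dist_component_mem_sobolev u w by auto
    have "NS s (fscale c ?u + fscale d ?w) \<le> c * NS s ?u + d * NS s ?w"
      using S.N_triangle[OF S.scale_mem[OF mem(1), of c] S.scale_mem[OF mem(2), of d]] S.N_scale mem cd by simp
    then have "NS s (fscale c ?u + fscale d ?w) powr p \<le> \<bar>c * NS s ?u + d * NS s ?w\<bar> powr p"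
      using p S.N_nonneg[OF S.add_mem[OF S.scale_mem[OF mem(1), of c] S.scale_mem[OF mem(2), of d]]] by (intro powr_mono2) auto
    also have "\<dots> \<le> c * NS s ?u powr p + d * NS s ?w powr p"
      using abs_powr_convex[of p c d "NS s ?u" "NS s ?w"] p cd S.N_nonneg mem by simp
    finally show "NS s (dist_component r (fscale c u + fscale d w)) powr p \<le> c * NS s ?u powr p + d * NS s ?w powr p"
      by (simp add: dist_component_add dist_component_fscale)
  qed
  then show "(\<Sum>r\<in>UNIV. NS s (dist_component r (fscale c u + fscale d w)) powr p) \<le>
      c * (\<Sum>r\<in>UNIV. NS s (dist_component r u) powr p) + d * (\<Sum>r\<in>UNIV. NS s (dist_component r w) powr p)"
    by (simp add: sum.distrib sum_distrib_left)
qed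

lemma sobolev_norm_component_le: assumes "u \<in> V" shows "NS s (dist_component r u) \<le> NV u"
proof -
  have "NS s (dist_component r u) = (NS s (dist_component r u) powr p) powr (1 / p)"
    using p S.N_nonneg[OF dist_component_mem_sobolev[OF assms]] by (simp add: powr_powr)
  also have "\<dots> \<le> (\<Sum>r\<in>UNIV. NS s (dist_component r u) powr p) powr (1 / p)"
    using p member_le_sum[of r UNIV "\<lambda>r. NS s (dist_component r u) powr p"] by (intro powr_mono2) auto
  finally show ?thesis by (simp add: sobolev_vec_norm_def)
qed

lemma sobolev_vec_norm_le_sum: assumes "u \<in> V" shows "NV u \<le> (\<Sum>r\<in>UNIV. NS s (dist_component r u))"
  unfolding sobolev_vec_norm_def
  by (rule sum_powr_le_powr_sum) (use p S.N_nonneg[OF dist_component_mem_sobolev[OF assms]] in auto)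

text \<open>
  The gauges of the components are added. All component gaps are nonnegative, so if the total gap is
  small, each of them is small, and with them the norms of the components of the difference.
\<close>

lemma convexity_gauge_sobolev_solutions: "\<exists>\<Phi>. convexity_gauge V NV \<Phi>"
proof -
  interpret V: seminormed V NV by (rule seminormed_sobolev_solutions)
  obtain F where F: "convexity_gauge (S s) (NS s) (\<lambda>T. F (NS s T))"
    using uniformly_convexifiable_sobolev[of s] unfolding uniformly_convexifiable_def by blast
  define f where "f T = F (NS s T)" for T
  let ?\<Phi> = "\<lambda>u :: ('n, 'k) vdist. \<Sum>r\<in>UNIV. f (dist_component r u)"
  define g where "g u w r = (f (dist_component r u) + f (dist_component r w)) / 2 - f (dist_component r (midpoint_of u w))"
    for u w :: "('n, 'k) vdist" and r
  have pos: "0 \<le> f T" if "T \<in> S s" for T using F that unfolding convexity_gauge_def f_def by simp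
  have cm: "dist_component r (midpoint_of u w) = midpoint_of (dist_component r u) (dist_component r w)" for u w :: "('n, 'k) vdist" and r
    by (simp add: midpoint_of_def dist_component_add dist_component_fscale)
  have g: "0 \<le> g u w r" if "u \<in> V" "w \<in> V" for u w r
    using F dist_component_mem_sobolev[OF that(1)] dist_component_mem_sobolev[OF that(2)] unfolding convexity_gauge_def g_def f_def cm by simp
  have gap: "(?\<Phi> u + ?\<Phi> w) / 2 -
      ?\<Phi> (midpoint_of u w) = (\<Sum>r\<in>UNIV. g u w r)" for u w :: "('n, 'k) vdist"
    by (simp add: g_def sum.distrib sum_subtractf sum_divide_distrib[symmetric])
  have "convexity_gauge V NV ?\<Phi>"
    unfolding convexity_gauge_def
  proof (intro conjI ballI allI impI)
    show "0 \<le> ?\<Phi> u" if "u \<in> V" for u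
      using dist_component_mem_sobolev[OF that] pos by (intro sum_nonneg) auto
    fix R
    have "\<exists>M. \<forall>T\<in>S s. NS s T \<le> R \<longrightarrow> f T \<le> M"
      using F unfolding convexity_gauge_def f_def by simp
    then obtain M where M: "\<And>T. T \<in> S s \<Longrightarrow> NS s T \<le> R \<Longrightarrow> f T \<le> M" by blast
    have "?\<Phi> u \<le> (\<Sum>r\<in>(UNIV :: 'k set). M)" if "u \<in> V" "NV u \<le> R" for u
    proof (rule sum_mono)
      fix r show "f (dist_component r u) \<le> M"
        using sobolev_norm_component_le[OF that(1), of r] that(2) by (intro M dist_component_mem_sobolev[OF that(1)]) simp
    qed
    then show "\<exists>M. \<forall>u\<in>V. NV u \<le> R \<longrightarrow> ?\<Phi> u \<le> M" by blast
  next
    fix u w assume "u \<in> V" "w \<in> V"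
    then have "0 \<le> (\<Sum>r\<in>UNIV. g u w r)" using g by (intro sum_nonneg) auto
    then show "?\<Phi> (midpoint_of u w) \<le> (?\<Phi> u + ?\<Phi> w) / 2"
      using gap[of u w] by linarith
  next
    fix R e :: real assume e: "e > 0"
    define e' where "e' = e / real CARD('k)"
    have "e' > 0" using e by (simp add: e'_def)
    from convexity_gaugeD[OF F this, of R] obtain d where d: "d > 0"
      "\<And>T U. T \<in> S s \<Longrightarrow> U \<in> S s \<Longrightarrow> NS s T \<le> R \<Longrightarrow> NS s U \<le> R \<Longrightarrow> (f T + f U) / 2 - f (midpoint_of T U) < d \<Longrightarrow> NS s (T - U) < e'"
      unfolding f_def by blast
    show "\<exists>d>0. \<forall>u\<in>V. \<forall>w\<in>V. NV u \<le> R \<and> NV w \<le> R \<and>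
        (?\<Phi> u + ?\<Phi> w) / 2 -
          ?\<Phi> (midpoint_of u w) < d \<longrightarrow> NV (u - w) < e"
      unfolding gap
    proof (intro exI[of _ d] conjI ballI impI d(1))
      fix u w assume u: "u \<in> V" and w: "w \<in> V" and h: "NV u \<le> R \<and> NV w \<le> R \<and> (\<Sum>r\<in>UNIV. g u w r) < d"
      \<comment> \<open>With \<open>e' = e / k\<close> for \<open>k\<close> components the norms of the components add up to less than \<open>e\<close>.\<close>
      have each: "NS s (dist_component r (u - w)) < e'" for r
        unfolding dist_component_diff
      proof (rule d(2)[OF dist_component_mem_sobolev[OF u] dist_component_mem_sobolev[OF w]])
        show "NS s (dist_component r u) \<le> R" "NS s (dist_component r w) \<le> R"
          using sobolev_norm_component_le[OF u, of r] sobolev_norm_component_le[OF w, of r] h by auto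
        have "g u w r \<le> (\<Sum>r\<in>UNIV. g u w r)" using g[OF u w] by (intro member_le_sum) auto
        then show "(f (dist_component r u) + f (dist_component r w)) / 2 - f (midpoint_of (dist_component r u) (dist_component r w)) < d"
          using h unfolding g_def cm by linarith
      qed
      have "NV (u - w) \<le> (\<Sum>r\<in>UNIV. NS s (dist_component r (u - w)))" by (rule sobolev_vec_norm_le_sum[OF V.diff_mem[OF u w]])
      also have "\<dots> < (\<Sum>r\<in>(UNIV :: 'k set). e')" by (rule sum_strict_mono) (use each in auto)
      also have "\<dots> = e" by (simp add: e'_def)
      finally show "NV (u - w) < e" .
    qed
  qed
  then show ?thesis by blast
qed

text \<open>
  The components of a Cauchy sequence converge in the scalar Sobolev space. Their limits are the
  components of a functional \<open>u\<close>, to which the sequence converges on every test function; so \<open>u\<close> solves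
  the equation.
\<close>

lemma complete_sobolev_solutions: "complete_under V NV"
  unfolding complete_under_def
proof (intro allI impI, elim conjE)
  fix w :: "nat \<Rightarrow> ('n, 'k) vdist"
  assume w: "\<forall>n. w n \<in> V" and cau: "\<forall>e>0. \<exists>K. \<forall>m\<ge>K. \<forall>n\<ge>K. NV (w m - w n) < e"
  interpret V: seminormed V NV by (rule seminormed_sobolev_solutions)
  have mem: "dist_component r (w n) \<in> S s" for r n using dist_component_mem_sobolev w by blast
  have "\<exists>T\<in>S s. (\<lambda>n. NS s (dist_component r (w n) - T)) \<longlonglongrightarrow> 0" for r
  proof (rule complete_underD[OF complete_sobolev mem])
    fix e :: real assume "e > 0"
    then obtain K where K: "\<And>m n. m \<ge> K \<Longrightarrow> n \<ge> K \<Longrightarrow> NV (w m - w n) < e" using cau by blast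
    have "NS s (dist_component r (w m) - dist_component r (w n)) < e" if "m \<ge> K" "n \<ge> K" for m n
      using sobolev_norm_component_le[OF V.diff_mem, of "w m" "w n" r] K[OF that] w by (simp add: dist_component_diff)
    then show "\<exists>K. \<forall>m\<ge>K. \<forall>n\<ge>K. NS s (dist_component r (w m) - dist_component r (w n)) < e" by blast
  qed
  then have "\<exists>T. \<forall>r. T r \<in> S s \<and> (\<lambda>n. NS s (dist_component r (w n) - T r)) \<longlonglongrightarrow> 0"
    by (intro choice allI) blast
  then obtain T where T: "\<And>r. T r \<in> S s" "\<And>r. (\<lambda>n. NS s (dist_component r (w n) - T r)) \<longlonglongrightarrow> 0" by blast
  have Tl: "T r \<in> linear_functionals (test_functions D)" for r by (rule sobolev_linear_functional[OF T(1)])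
  obtain C K where C: "C \<ge> 0" "\<And>T \<phi>. T \<in> S s \<Longrightarrow> \<phi> \<in> test_functions D \<Longrightarrow>
     \<bar>T \<phi>\<bar> \<le> C * NS s T * (\<Sum>\<alpha> | mi_order \<alpha> \<le> K. SUP x. \<bar>pderiv_mi \<alpha> \<phi> x\<bar>)"
    using sobolev_eval_bound[of s] by metis
  have Tlim: "(\<lambda>n. dist_component r (w n) \<phi>) \<longlonglongrightarrow> T r \<phi>" if \<phi>: "\<phi> \<in> test_functions D" for r \<phi>
  proof (rule LIM_zero_cancel, rule Lim_null_comparison)
    let ?B = "\<Sum>\<alpha> | mi_order \<alpha> \<le> K. SUP x. \<bar>pderiv_mi \<alpha> \<phi> x\<bar>"
    show "(\<lambda>n. C * NS s (dist_component r (w n) - T r) * ?B) \<longlonglongrightarrow> 0"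
      using tendsto_mult_right[OF tendsto_mult_left[OF T(2)], of C r ?B] by simp
    show "\<forall>\<^sub>F n in sequentially. norm (dist_component r (w n) \<phi> - T r \<phi>) \<le> C * NS s (dist_component r (w n) - T r) * ?B"
      using C(2)[OF S.diff_mem[OF mem T(1)] \<phi>] by (intro always_eventually) auto
  qed
  define u :: "('n, 'k) vdist" where "u \<phi> = (if \<phi> \<in> test_functions D then \<Sum>r\<in>UNIV. T r (\<lambda>x. \<phi> x $ r) else 0)" for \<phi>
  have lim: "(\<lambda>n. w n \<phi>) \<longlonglongrightarrow> u \<phi>" for \<phi>
  proof (cases "\<phi> \<in> test_functions D")
    case True
    have "w n \<phi> = (\<Sum>r\<in>UNIV. dist_component r (w n) (\<lambda>x. \<phi> x $ r))" for n
      by (rule linear_functional_decompose[OF _ True]) (use w sobolev_solutions_iff in blast)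
    then show ?thesis using True unfolding u_def by (simp add: tendsto_sum Tlim test_functions_nth)
  next
    case False
    have "w n \<phi> = 0" for n by (rule linear_functionals_outside[OF _ False]) (use w sobolev_solutions_iff in blast)
    then show ?thesis using False by (simp add: u_def)
  qed
  have ulin: "u \<in> linear_functionals (test_functions D)"
    unfolding linear_functionals_def
  proof (intro CollectI conjI ballI allI impI)
    have wl: "w n \<in> linear_functionals (test_functions D)" for n using w sobolev_solutions_iff by blast
    show "u (x + y) = u x + u y" if "x \<in> test_functions D" "y \<in> test_functions D" for x y
      using tendsto_add[OF lim lim, of x y] LIMSEQ_unique[OF lim, of "x + y"] linear_functionals_add[OF wl that] by simp
    show "u (fscale c x) = c * u x" if "x \<in> test_functions D" for c x
      using tendsto_mult_left[OF lim, of c x] LIMSEQ_unique[OF lim, of "fscale c x"] linear_functionals_scale[OF wl that] by simp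
  qed (simp add: u_def)
  have comp: "dist_component r u = T r" for r
  proof
    fix \<phi> :: "real ^ 'n \<Rightarrow> real"
    show "dist_component r u \<phi> = T r \<phi>"
    proof (cases "\<phi> \<in> test_functions D")
      case True
      have "(\<lambda>n. dist_component r (w n) \<phi>) \<longlonglongrightarrow> dist_component r u \<phi>" unfolding dist_component_def by (rule lim)
      then show ?thesis using Tlim[OF True] LIMSEQ_unique by blast
    next
      case False
      then show ?thesis using linear_functionals_outside[OF Tl False]
        by (simp add: dist_component_def u_def test_functions_axis_iff)
    qed
  qed
  have "diff_op a m u \<phi> = 0" if "\<phi> \<in> test_functions D" for \<phi>
  proof -
    have "diff_op a m (w n) \<phi> = 0" for n using w sobolev_solutions_iff that by blast
    then show ?thesis using diff_op_tendsto[of w u a m \<phi>, OF lim] by (simp add: LIMSEQ_const_iff)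
  qed
  then have uV: "u \<in> V" using ulin comp T(1) by (simp add: sobolev_solutions_iff)
  have "(\<lambda>n. NV (w n - u)) \<longlonglongrightarrow> 0"
  proof (rule Lim_null_comparison)
    show "(\<lambda>n. \<Sum>r\<in>UNIV. NS s (dist_component r (w n) - T r)) \<longlonglongrightarrow> 0"
      using tendsto_sum[of UNIV "\<lambda>r n. NS s (dist_component r (w n) - T r)" "\<lambda>_. 0"] T(2) by simp
    have "NV (w n - u) \<le> (\<Sum>r\<in>UNIV. NS s (dist_component r (w n) - T r))" for n
      using sobolev_vec_norm_le_sum[OF V.diff_mem, of "w n" u] w uV by (simp add: dist_component_diff comp)
    moreover have "0 \<le> NV (w n - u)" for n using V.N_nonneg[OF V.diff_mem] w uV by blast
    ultimately show "\<forall>\<^sub>F n in sequentially. norm (NV (w n - u)) \<le> (\<Sum>r\<in>UNIV. NS s (dist_component r (w n) - T r))" by simp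
  qed
  then show "\<exists>u\<in>V. (\<lambda>n. NV (w n - u)) \<longlonglongrightarrow> 0" using uV by blast
qed

end

end

section \<open>The misfit\<close>

lemma misfit_infinity_eq:
  "misfit \<infinity> N h (truncation N g) = Max {\<bar>g \<nu> $ r - h \<nu> $ r\<bar> | \<nu> r. \<nu> < N}"
proof -
  have "{\<bar>(truncation N g - truncation N h) \<nu> $ r\<bar> | \<nu> r. \<nu> < N} = {\<bar>g \<nu> $ r - h \<nu> $ r\<bar> | \<nu> r. \<nu> < N}"
    by (auto simp: truncation_def)
  then show ?thesis by (simp add: misfit_def lq_norm_def)
qed

lemma real_of_ereal_ge_1: "1 \<le> q \<Longrightarrow> q \<noteq> \<infinity> \<Longrightarrow> 1 \<le> real_of_ereal q"
  by (cases q) auto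

lemma misfit_finite_eq:
  assumes "1 \<le> q" "q \<noteq> \<infinity>"
  shows "misfit q N h (truncation N g) =
    (\<Sum>\<nu><N. \<Sum>r\<in>UNIV. \<bar>g \<nu> $ r - h \<nu> $ r\<bar> powr real_of_ereal q) / real_of_ereal q"
proof -
  have eq: "(\<Sum>\<nu><N. \<Sum>r\<in>UNIV. \<bar>(truncation N g - truncation N h) \<nu> $ r\<bar> powr real_of_ereal q) =
    (\<Sum>\<nu><N. \<Sum>r\<in>UNIV. \<bar>g \<nu> $ r - h \<nu> $ r\<bar> powr real_of_ereal q)"
    by (intro sum.cong) (auto simp: truncation_def)
  have "0 \<le> (\<Sum>\<nu><N. \<Sum>r\<in>UNIV. \<bar>g \<nu> $ r - h \<nu> $ r\<bar> powr real_of_ereal q)" by (intro sum_nonneg) auto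
  then show ?thesis
    using assms(2) real_of_ereal_ge_1[OF assms] unfolding misfit_def lq_norm_def eq by (simp add: powr_powr)
qed

lemma finite_range_residuals: "finite {\<bar>g \<nu> $ r - h \<nu> $ (r :: 'k::finite)\<bar> | \<nu> r. \<nu> < (N::nat)}"
proof -
  have "{\<bar>g \<nu> $ r - h \<nu> $ r\<bar> | \<nu> r. \<nu> < N} = (\<lambda>(\<nu>, r). \<bar>g \<nu> $ r - h \<nu> $ r\<bar>) ` ({..<N} \<times> UNIV)" by auto
  then show ?thesis by simp
qed

lemma misfit_eq_0: assumes "1 \<le> q" "N \<ge> 1" shows "misfit q N h (truncation N h) = 0"
proof (cases "q = \<infinity>")
  case True
  have "{\<bar>h \<nu> $ r - h \<nu> $ r\<bar> | \<nu> r. \<nu> < N} = {0 :: real}" using assms(2) by (auto intro: exI[of _ 0])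
  then show ?thesis unfolding True misfit_infinity_eq by (simp only: Max_singleton)
next
  case False
  then show ?thesis using misfit_finite_eq[OF assms(1) False, of N h h] real_of_ereal_ge_1[OF assms(1) False] by simp
qed

lemma misfit_nonneg: assumes "1 \<le> q" "N \<ge> 1" shows "0 \<le> misfit q N h (truncation N g)"
proof (cases "q = \<infinity>")
  case True
  have "\<bar>g 0 $ undefined - h 0 $ undefined\<bar> \<le> Max {\<bar>g \<nu> $ r - h \<nu> $ r\<bar> | \<nu> r. \<nu> < N}"
    using assms(2) by (intro Max_ge finite_range_residuals) auto
  then show ?thesis unfolding True misfit_infinity_eq by linarith
next
  case False
  show ?thesis
    unfolding misfit_finite_eq[OF assms(1) False] using real_of_ereal_ge_1[OF assms(1) False]
    by (intro divide_nonneg_nonneg sum_nonneg) auto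
qed

text \<open>
  For finite \<open>q\<close> the misfit of \<open>g N\<close> is at least \<open>1 / q\<close> times the \<open>q\<close>-th power of the deviation in any single
  measurement \<open>\<nu> < N\<close>, and for \<open>q = \<infinity>\<close> it is at least the deviation itself.
\<close>

lemma measurements_tendsto_of_misfit:
  assumes q: "1 \<le> q" and lim: "(\<lambda>N. misfit q N h (truncation N (g N))) \<longlonglongrightarrow> 0"
  shows "(\<lambda>N. g N \<nu> $ r) \<longlonglongrightarrow> h \<nu> $ r"
proof (rule LIM_zero_cancel)
  show "(\<lambda>N. g N \<nu> $ r - h \<nu> $ r) \<longlonglongrightarrow> 0"
  proof (cases "q = \<infinity>")
    case True
    show ?thesis
    proof (rule Lim_null_comparison[OF _ lim])
      show "\<forall>\<^sub>F N in sequentially. norm (g N \<nu> $ r - h \<nu> $ r) \<le> misfit q N h (truncation N (g N))"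
        using eventually_gt_at_top[of \<nu>]
      proof eventually_elim
        case (elim N)
        then show ?case unfolding True misfit_infinity_eq real_norm_def
          by (intro Max_ge finite_range_residuals) auto
      qed
    qed
  next
    case False
    define Q where "Q = real_of_ereal q"
    have Q: "Q \<ge> 1" unfolding Q_def by (rule real_of_ereal_ge_1[OF q False])
    have "(\<lambda>N. Q * misfit q N h (truncation N (g N))) \<longlonglongrightarrow> 0" using tendsto_mult_left[OF lim, of Q] by simp
    then have "(\<lambda>N. (Q * misfit q N h (truncation N (g N))) powr (1 / Q)) \<longlonglongrightarrow> 0"
    proof (rule tendsto_zero_powrI[OF _ tendsto_const])
      show "\<forall>\<^sub>F N in sequentially. 0 \<le> Q * misfit q N h (truncation N (g N))"
        using eventually_ge_at_top[of 1]
        by eventually_elim (intro mult_nonneg_nonneg misfit_nonneg[OF q], use Q in auto)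
    qed (use Q in auto)
    then show ?thesis
    proof (rule Lim_null_comparison[rotated])
      show "\<forall>\<^sub>F N in sequentially. norm (g N \<nu> $ r - h \<nu> $ r) \<le> (Q * misfit q N h (truncation N (g N))) powr (1 / Q)"
        using eventually_gt_at_top[of \<nu>]
      proof eventually_elim
        case (elim N)
        let ?y = "\<bar>g N \<nu> $ r - h \<nu> $ r\<bar>"
        have "?y powr Q \<le> (\<Sum>r\<in>UNIV. \<bar>g N \<nu> $ r - h \<nu> $ r\<bar> powr Q)"
          by (rule member_le_sum[where f="\<lambda>r. \<bar>g N \<nu> $ r - h \<nu> $ r\<bar> powr Q"]) auto
        also have "\<dots> \<le> (\<Sum>\<nu><N. \<Sum>r\<in>UNIV. \<bar>g N \<nu> $ r - h \<nu> $ r\<bar> powr Q)"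
          by (rule member_le_sum[where f="\<lambda>\<nu>. \<Sum>r\<in>UNIV. \<bar>g N \<nu> $ r - h \<nu> $ r\<bar> powr Q"]) (use elim in \<open>auto intro: sum_nonneg\<close>)
        also have "\<dots> = Q * misfit q N h (truncation N (g N))"
          using misfit_finite_eq[OF q False, of N h "g N"] Q by (simp add: Q_def)
        finally have "?y powr Q \<le> Q * misfit q N h (truncation N (g N))" .
        then have "(?y powr Q) powr (1 / Q) \<le> (Q * misfit q N h (truncation N (g N))) powr (1 / Q)"
          using Q by (intro powr_mono2) auto
        then show ?case using Q by (simp add: powr_powr)
      qed
    qed
  qed
qed

section \<open>Weak convergence and solvability\<close>

context seminormed begin

lemma dual_tendsto:
  assumes l: "l \<in> dual V N" and w: "\<And>n. w n \<in> V" and u: "u \<in> V" and lim: "(\<lambda>n. N (w n - u)) \<longlonglongrightarrow> 0"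
  shows "(\<lambda>n. l (w n)) \<longlonglongrightarrow> l u"
proof (rule LIM_zero_cancel, rule Lim_null_comparison)
  show "(\<lambda>n. dual_norm V N l * N (w n - u)) \<longlonglongrightarrow> 0" using tendsto_mult_left[OF lim, of "dual_norm V N l"] by simp
  show "\<forall>\<^sub>F n in sequentially. norm (l (w n) - l u) \<le> dual_norm V N l * N (w n - u)"
    using dual_norm_bound[OF l diff_mem[OF w u]] dual_diff[OF l w u] by (intro always_eventually) simp
qed

text \<open>
  Along a bounded sequence, convergence of the values of functionals passes from a set \<open>G\<close> to its span
  and then to the closure of the span. Index 0 is left out because the minimisers are specified for
  \<open>N \<ge> 1\<close> only.
\<close>

lemma weakly_convergesI:
  assumes w: "\<And>n. n \<ge> 1 \<Longrightarrow> w n \<in> V" and u: "u \<in> V" and bnd: "\<And>n. n \<ge> 1 \<Longrightarrow> N (w n) \<le> R"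
    and G: "G \<subseteq> dual V N" and conv: "\<And>g. g \<in> G \<Longrightarrow> (\<lambda>n. g (w n)) \<longlonglongrightarrow> g u"
    and dense: "\<And>l e. l \<in> dual V N \<Longrightarrow> e > 0 \<Longrightarrow> \<exists>g\<in>fun_vs.span G. dual_norm V N (l - g) < e"
  shows "weakly_converges V N w u"
  unfolding weakly_converges_def
proof
  interpret dual: seminormed "dual V N" "dual_norm V N" by (rule seminormed_dual)
  fix l assume l: "l \<in> dual V N"
  have span: "g \<in> dual V N \<and> (\<lambda>n. g (w n)) \<longlonglongrightarrow> g u" if "g \<in> fun_vs.span G" for g
    using that
  proof (rule fun_vs.span_induct[where P="\<lambda>g. g \<in> dual V N \<and> (\<lambda>n. g (w n)) \<longlonglongrightarrow> g u"])
    show "fun_vs.subspace {g. g \<in> dual V N \<and> (\<lambda>n. g (w n)) \<longlonglongrightarrow> g u}"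
      unfolding fun_vs.subspace_def
      by (auto simp: fscale_apply intro: dual.zero_mem dual.add_mem dual.scale_mem tendsto_add tendsto_mult_left)
  qed (use G conv in blast)
  define K where "K = \<bar>R\<bar> + N u + 1"
  have K: "K > 0" using N_nonneg[OF u] by (simp add: K_def)
  show "(\<lambda>n. l (w n)) \<longlonglongrightarrow> l u"
  proof (rule LIMSEQ_I)
    fix e :: real assume e: "e > 0"
    then obtain g where g: "g \<in> fun_vs.span G" "dual_norm V N (l - g) < e / (2 * K)"
      using dense[OF l, of "e / (2 * K)"] K by auto
    have gd: "g \<in> dual V N" and glim: "(\<lambda>n. g (w n)) \<longlonglongrightarrow> g u" using span[OF g(1)] by auto
    have lg: "l - g \<in> dual V N" by (rule dual.diff_mem[OF l gd])
    obtain n0 where n0: "\<And>n. n \<ge> n0 \<Longrightarrow> \<bar>g (w n) - g u\<bar> < e / 2"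
      using LIMSEQ_D[OF glim, of "e / 2"] e by auto
    have "norm (l (w n) - l u) < e" if n: "n \<ge> max n0 1" for n
    proof -
      have wn: "w n \<in> V" using w n by simp
      have "N (w n - u) \<le> K" using N_diff_le[OF wn u] bnd[of n] n by (simp add: K_def)
      moreover have "\<bar>(l - g) (w n - u)\<bar> \<le> dual_norm V N (l - g) * N (w n - u)"
        by (rule dual_norm_bound[OF lg diff_mem[OF wn u]])
      ultimately have "\<bar>(l - g) (w n - u)\<bar> \<le> e / (2 * K) * K"
        using g(2) dual_norm_nonneg[OF lg] N_nonneg[OF diff_mem[OF wn u]] K e
        by (elim order_trans) (intro mult_mono, auto)
      then have "\<bar>(l - g) (w n - u)\<bar> \<le> e / 2" using K by simp
      moreover have "l (w n) - l u = (l - g) (w n - u) + (g (w n) - g u)"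
        using dual_diff[OF lg wn u] by simp
      moreover have "\<bar>g (w n) - g u\<bar> < e / 2" using n0[of n] n by simp
      ultimately show ?thesis unfolding real_norm_def by linarith
    qed
    then show "\<exists>n0. \<forall>n\<ge>n0. norm (l (w n) - l u) < e" by blast
  qed
qed

end

lemma abs_midpoint_diff_le:
  fixes x y h e :: real assumes "\<bar>x - h\<bar> \<le> e" "\<bar>y - h\<bar> \<le> e" shows "\<bar>(x + y) / 2 - h\<bar> \<le> e"
  using assms by (simp add: abs_le_iff field_simps)

text \<open>
  The sets of all \<open>u\<close> in the ball of radius \<open>R\<close> whose first \<open>n\<close> measurements deviate from the data by at
  most \<open>1 / (n + 1)\<close> are convex, decrease with \<open>n\<close>, and each of them contains \<open>w i\<close> for large \<open>i\<close>. Points that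
  are chosen from them as in \<open>nested_convex_sets_have_limit\<close> converge in norm, so the limit has the
  given measurements.
\<close>

lemma (in seminormed) solvable_of_approximate_solutions:
  fixes v :: "nat \<Rightarrow> 'k::finite \<Rightarrow> ('a \<Rightarrow> real) \<Rightarrow> real"
  assumes compl: "complete_under V N" and \<Phi>: "convexity_gauge V N \<Phi>"
    and v: "\<And>j r. v j r \<in> dual V N"
    and w: "\<And>n. n \<ge> 1 \<Longrightarrow> w n \<in> V" and bnd: "\<And>n. n \<ge> 1 \<Longrightarrow> N (w n) \<le> R"
    and lim: "\<And>j r. (\<lambda>n. v j r (w n)) \<longlonglongrightarrow> h j r"
  shows "\<exists>u\<in>V. \<forall>j r. v j r u = h j r"
proof -
  define C where "C n = {u \<in> V. N u \<le> R \<and> (\<forall>j<n. \<forall>r. \<bar>v j r u - h j r\<bar> \<le> inverse (real (Suc n)))}" for n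
  have ne: "C n \<noteq> {}" for n
  proof -
    have "\<forall>\<^sub>F i in sequentially. \<forall>j\<in>{..<n}. \<forall>r\<in>UNIV. \<bar>v j r (w i) - h j r\<bar> < inverse (real (Suc n))"
      using tendstoD[OF lim] by (intro eventually_ball_finite ballI) (auto simp: dist_real_def)
    with eventually_ge_at_top[of 1]
    have "\<forall>\<^sub>F i in sequentially. w i \<in> C n"
      by eventually_elim (auto simp: C_def w bnd intro: less_imp_le)
    then show ?thesis using eventually_happens'[OF sequentially_bot] by blast
  qed
  have dec: "C (Suc n) \<subseteq> C n" for n
  proof -
    have "inverse (real (Suc (Suc n))) \<le> inverse (real (Suc n))" by (intro le_imp_inverse_le) auto
    then have "x \<le> inverse (real (Suc n))" if "x \<le> inverse (real (Suc (Suc n)))" for x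
      using that by linarith
    then show ?thesis unfolding C_def using less_Suc_eq by blast
  qed
  have mid: "midpoint_of u w \<in> C n" if "u \<in> C n" "w \<in> C n" for n u w
  proof -
    have uw: "u \<in> V" "w \<in> V" using that by (auto simp: C_def)
    have "v j r (midpoint_of u w) = (v j r u + v j r w) / 2" for j r
      unfolding midpoint_of_def using dual_scale[OF v add_mem[OF uw]] dual_add[OF v uw] by simp
    then have "\<bar>v j r (midpoint_of u w) - h j r\<bar> \<le> inverse (real (Suc n))" if "j < n" for j r
      using \<open>u \<in> C n\<close> \<open>w \<in> C n\<close> that by (simp only:) (rule abs_midpoint_diff_le, auto simp: C_def)
    moreover have "N (midpoint_of u w) \<le> R" using that N_midpoint_le[OF uw] by (simp add: C_def)
    ultimately show ?thesis using midpoint_mem[OF uw] by (simp add: C_def)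
  qed
  obtain x u where x: "\<And>n. x n \<in> C n" and u: "u \<in> V" and xu: "(\<lambda>n. N (x n - u)) \<longlonglongrightarrow> 0"
  proof (rule nested_convex_sets_have_limit[OF compl \<Phi>, of C R])
    show "C n \<noteq> {}" "C (Suc n) \<subseteq> C n" for n by (rule ne, rule dec)
    show "midpoint_of u w \<in> C n" if "u \<in> C n" "w \<in> C n" for n u w by (rule mid[OF that])
  qed (auto simp: C_def)
  have xV: "x n \<in> V" for n using x by (auto simp: C_def)
  have "v j r u = h j r" for j r
  proof (rule LIMSEQ_unique)
    show "(\<lambda>n. v j r (x n)) \<longlonglongrightarrow> v j r u" by (rule dual_tendsto[OF v xV u xu])
    show "(\<lambda>n. v j r (x n)) \<longlonglongrightarrow> h j r"
    proof (rule LIM_zero_cancel, rule Lim_null_comparison[OF _ LIMSEQ_inverse_real_of_nat])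
      show "\<forall>\<^sub>F n in sequentially. norm (v j r (x n) - h j r) \<le> inverse (real (Suc n))"
        using eventually_gt_at_top[of j] by eventually_elim (use x in \<open>auto simp: C_def\<close>)
    qed
  qed
  then show ?thesis using u by blast
qed

theorem corollary2p7:
  fixes X D :: "(real ^ 'n::finite) set"
    and a :: "('n, 'k::finite) coeffs" and m :: nat
    and s :: int and p :: real and q :: ereal
    and v :: "nat \<Rightarrow> 'k \<Rightarrow> ('n, 'k) vdist \<Rightarrow> real"
    and h0 :: "nat \<Rightarrow> real ^ 'k" and b :: "nat \<Rightarrow> real" and u0 :: "nat \<Rightarrow> ('n, 'k) vdist"
  assumes "CARD('n) \<ge> 2"
    and "domain X"
    and "\<And>\<alpha>. mi_order \<alpha> \<le> m \<Longrightarrow> smooth_on X (a \<alpha>)"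
    and "elliptic_on X a m"
    and "unique_continuation X (diff_op a m)"
    and "unique_continuation X (formal_adjoint a m)"
    and "domain D" and "compact (closure D)" and "closure D \<subseteq> X"
    and "smooth_boundary D"
    and "1 < p"
    and "\<And>C. C \<in> components (X - D) \<Longrightarrow> \<not> compact C"
    and "\<And>j r. v j r \<in> dual (sobolev_solutions a m s p D) (sobolev_vec_norm s p D)"
    and "inj (\<lambda>(j, r). v j r)" and "fun_vs.independent (range (\<lambda>(j, r). v j r))"
    and "\<And>j r. dual_norm (sobolev_solutions a m s p D) (sobolev_vec_norm s p D) (v j r) \<le> 1"
    and "\<And>l \<epsilon>. l \<in> dual (sobolev_solutions a m s p D) (sobolev_vec_norm s p D) \<Longrightarrow> \<epsilon> > 0 \<Longrightarrow>
           \<exists>w\<in>fun_vs.span (range (\<lambda>(j, r). v j r)).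
             dual_norm (sobolev_solutions a m s p D) (sobolev_vec_norm s p D) (l - w) < \<epsilon>"
    and "h0 \<in> bounded_sequences"
    and "1 \<le> q"
    and "\<And>N. N \<ge> 1 \<Longrightarrow> b N > 0" and "b \<longlonglongrightarrow> 0"
    and "\<And>N. N \<ge> 1 \<Longrightarrow>
           is_arg_min (regularised_misfit s p D v q h0 b N) (\<lambda>u. u \<in> sobolev_solutions a m s p D) (u0 N)"
  shows "((\<exists>u\<in>sobolev_solutions a m s p D. measurement v u = h0) \<longleftrightarrow>
          (\<exists>C0>0. \<forall>N\<ge>1. regularised_misfit s p D v q h0 b N (u0 N) \<le> C0 * b N)) \<and>
         (\<forall>u\<in>sobolev_solutions a m s p D. measurement v u = h0 \<longrightarrow>
            weakly_converges (sobolev_solutions a m s p D) (sobolev_vec_norm s p D) u0 u)"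
proof -
  interpret sobolev_setting D p
    using \<open>domain D\<close> \<open>compact (closure D)\<close> \<open>1 < p\<close>
    by unfold_locales (auto simp: domain_def bounded_closure_image dest: compact_imp_bounded intro: bounded_subset[OF _ closure_subset])
  let ?V = "sobolev_solutions a m s p D :: ('n, 'k) vdist set" and ?N = "sobolev_vec_norm s p D :: ('n, 'k) vdist \<Rightarrow> real"
  let ?F = "regularised_misfit s p D v q h0 b"
  let ?m = "\<lambda>N u. misfit q N h0 (truncation N (measurement v u))"
  interpret seminormed ?V ?N by (rule seminormed_sobolev_solutions)
  note v = assms(13) and dense = assms(17) and q = \<open>1 \<le> q\<close> and b_pos = assms(20) and b_lim = assms(21) and minimizer = assms(22)
  have u0: "u0 N \<in> ?V" and min: "u \<in> ?V \<Longrightarrow> ?F N (u0 N) \<le> ?F N u" if "N \<ge> 1" for N u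
    using minimizer[OF that] by (auto simp: is_arg_min_def not_less)
  have F: "?F N u = ?m N u + b N * ?N u" for N u by (simp add: regularised_misfit_def)
  have small: "?N (u0 N) \<le> C0" "?m N (u0 N) \<le> C0 * b N" if "?F N (u0 N) \<le> C0 * b N" "N \<ge> 1" for N C0
  proof -
    have "b N * ?N (u0 N) \<le> b N * C0" using that misfit_nonneg[OF q that(2), of h0 "measurement v (u0 N)"] by (simp add: F mult.commute)
    then show "?N (u0 N) \<le> C0" using b_pos[OF that(2)] by simp
    have "0 \<le> b N * ?N (u0 N)" using b_pos[OF that(2)] N_nonneg[OF u0[OF that(2)]] by simp
    then show "?m N (u0 N) \<le> C0 * b N" using that(1) by (simp add: F)
  qed
  have meas: "(\<lambda>N. v j r (u0 N)) \<longlonglongrightarrow> h0 j $ r" if C0: "\<And>N. N \<ge> 1 \<Longrightarrow> ?F N (u0 N) \<le> C0 * b N" for C0 j r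
  proof -
    have "(\<lambda>N. C0 * b N) \<longlonglongrightarrow> 0" using tendsto_mult_left[OF b_lim, of C0] by simp
    then have "(\<lambda>N. ?m N (u0 N)) \<longlonglongrightarrow> 0"
    proof (rule Lim_null_comparison[rotated])
      show "\<forall>\<^sub>F N in sequentially. norm (?m N (u0 N)) \<le> C0 * b N"
        using eventually_ge_at_top[of 1]
      proof eventually_elim
        case (elim N)
        then show ?case
          using small(2)[OF C0[OF elim] elim] misfit_nonneg[OF q elim, of h0 "measurement v (u0 N)"] by simp
      qed
    qed
    from measurements_tendsto_of_misfit[OF q this, of j r] show ?thesis by (simp add: measurement_def)
  qed
  have bound: "?F N (u0 N) \<le> ?N u * b N" if "u \<in> ?V" "measurement v u = h0" "N \<ge> 1" for u N
    using min[OF that(3,1)] misfit_eq_0[OF q that(3), of h0] that(2) by (simp add: F mult.commute)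
  show ?thesis
  proof (intro conjI iffI ballI impI)
    assume "\<exists>u\<in>?V. measurement v u = h0"
    then obtain u where u: "u \<in> ?V" "measurement v u = h0" by blast
    have "?F N (u0 N) \<le> (?N u + 1) * b N" if "N \<ge> 1" for N
      using bound[OF u that] b_pos[OF that] by (simp add: distrib_right)
    then show "\<exists>C0>0. \<forall>N\<ge>1. ?F N (u0 N) \<le> C0 * b N"
      using N_nonneg[OF u(1)] by (intro exI[of _ "?N u + 1"]) auto
  next
    assume "\<exists>C0>0. \<forall>N\<ge>1. ?F N (u0 N) \<le> C0 * b N"
    then obtain C0 where C0: "\<And>N. N \<ge> 1 \<Longrightarrow> ?F N (u0 N) \<le> C0 * b N" by blast
    obtain \<Phi> where \<Phi>: "convexity_gauge ?V ?N \<Phi>" using convexity_gauge_sobolev_solutions by blast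
    have "\<exists>u\<in>?V. \<forall>j r. v j r u = h0 j $ r"
      by (rule solvable_of_approximate_solutions[OF complete_sobolev_solutions \<Phi> v u0 small(1)[OF C0] meas[OF C0]])
    then show "\<exists>u\<in>?V. measurement v u = h0" by (auto simp: measurement_def vec_eq_iff fun_eq_iff)
  next
    fix u assume u: "u \<in> ?V" "measurement v u = h0"
    have vu: "h0 j $ r = v j r u" for j r unfolding u(2)[symmetric] by (simp add: measurement_def)
    show "weakly_converges ?V ?N u0 u"
    proof (rule weakly_convergesI[OF u0 u(1) small(1)[OF bound[OF u]] _ _ dense])
      show "range (\<lambda>(j, r). v j r) \<subseteq> dual ?V ?N" using v by auto
      show "(\<lambda>n. g (u0 n)) \<longlonglongrightarrow> g u" if "g \<in> range (\<lambda>(j, r). v j r)" for g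
        using that meas[OF bound[OF u]] by (auto simp: vu)
    qed
  qed
qed

end
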